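(* For each of the groups $G=T$ and $G=V$ (Thompson's groups) and every $k\in\mathbb{N}$: every semi-simple action of $G$ on a complete CAT(0) space of topological dimension $k$ has a global fixed point. (That is, $T$ and $V$ have property $\mathrm{F}\mathcal{A}_k$ for semi-simple actions for every $k\in\mathbb{N}$.)
   Context: A standard dyadic interval is an interval $[a/2^b,(a+1)/2^b]\subset[0,1]$ with $a,b$ integers, $b\ge 0$. Thompson's group $V$ is the group of piecewise linear right-continuous bijections of $[0,1)$ which are described by two divisions of the unit interval into the same finite number of standard dyadic intervals and a bijection between the pieces, each (half-open) piece of the first division being mapped onto the corresponding piece of the second by the increasing affine map (so all derivatives are powers of $2$). Thompson's group $T$ is the group of piecewise linear homeomorphisms of $S^1=[0,1]/\{0=1\}$ of this same form (i.e. the bijection between pieces preserves their cyclic order). For an isometry $\gamma$ of a metric space $(X,d)$, let $|\gamma|=\inf\{d(x,\gamma(x))\mid x\in X\}$; $\gamma$ is semi-simple if this infimum is attained. An isometric action of a group on a metric space is semi-simple if every group element acts as a semi-simple isometry. A global fixed point is a point fixed by all group elements. CAT(0) spaces are taken to be non-empty. Topological dimension means covering dimension. *)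

theory Defs
  imports "HOL-Analysis.Analysis" "HOL-Algebra.Group_Action" "HOL-Library.Disjoint_Sets"
begin

section \<open>Thompson's groups T and V\<close>

text \<open>A standard dyadic interval \<open>[a/2^b, (a+1)/2^b]\<close> in \<open>[0,1]\<close> is represented by the half-open
  piece \<open>[a/2^b, (a+1)/2^b)\<close>; divisions of \<open>[0,1]\<close> into standard dyadic intervals then correspond
  to partitions of \<open>[0,1)\<close> into finitely many such pieces.\<close>

definition dyadic_piece :: "real set \<Rightarrow> bool" where
  "dyadic_piece I \<longleftrightarrow>
     (\<exists>a b :: nat. a < 2 ^ b \<and> I = {real a / 2 ^ b ..< (real a + 1) / 2 ^ b})"

definition dyadic_division :: "real set set \<Rightarrow> bool" where
  "dyadic_division P \<longleftrightarrow>
     finite P \<and> partition_on {0..<1} P \<and> (\<forall>I\<in>P. dyadic_piece I)"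

definition increasing_affine_onto :: "(real \<Rightarrow> real) \<Rightarrow> real set \<Rightarrow> real set \<Rightarrow> bool" where
  "increasing_affine_onto f I J \<longleftrightarrow>
     (\<exists>m c. m > 0 \<and> (\<forall>x\<in>I. f x = m * x + c)) \<and> f ` I = J"

definition V_map :: "(real \<Rightarrow> real) \<Rightarrow> bool" where
  "V_map f \<longleftrightarrow>
     f \<in> Bij {0..<1} \<and>
     (\<exists>P Q \<sigma>. dyadic_division P \<and> dyadic_division Q \<and> bij_betw \<sigma> P Q \<and>
        (\<forall>I\<in>P. increasing_affine_onto f I (\<sigma> I)))"

definition thompson_V :: "(real \<Rightarrow> real) monoid" where
  "thompson_V = BijGroup {0..<1} \<lparr>carrier := {f. V_map f}\<rparr>"

text \<open>The circle \<open>[0,1]/{0=1}\<close>, with \<open>[0,1)\<close> as a set of representatives, carrying the quotient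
  topology.\<close>

definition circle_proj :: "real \<Rightarrow> real" where
  "circle_proj x = (if x = 1 then 0 else x)"

definition circle_topology :: "real topology" where
  "circle_topology =
     topology (\<lambda>U. U \<subseteq> {0..<1} \<and> openin (top_of_set {0..1}) {x \<in> {0..1}. circle_proj x \<in> U})"

lemma openin_circle_topology:
  "openin circle_topology U \<longleftrightarrow>
     U \<subseteq> {0..<1} \<and> openin (top_of_set {0..1}) {x \<in> {0..1}. circle_proj x \<in> U}"
proof -
  let ?pre = "\<lambda>U. {x \<in> {0..1}. circle_proj x \<in> U}"
  have Int: "?pre (U \<inter> V) = ?pre U \<inter> ?pre V" for U V
    by auto
  have Un: "?pre (\<Union>\<K>) = \<Union>(?pre ` \<K>)" for \<K>
    by auto
  have "istopology (\<lambda>U. U \<subseteq> {0..<1} \<and> openin (top_of_set {0..1}) (?pre U))"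
    unfolding istopology_def Int Un by (auto intro!: openin_Int openin_Union)
  then show ?thesis
    by (simp add: circle_topology_def)
qed

lemma topspace_circle_topology: "topspace circle_topology = {0..<1}"
proof (rule subset_antisym)
  show "topspace circle_topology \<subseteq> {0..<1}"
    using openin_circle_topology openin_topspace by blast
  have "{x \<in> {0..1::real}. circle_proj x \<in> {0..<1}} = {0..1}"
    by (auto simp: circle_proj_def)
  then have "openin circle_topology {0..<1}"
    by (simp add: openin_circle_topology)
  then show "{0..<1} \<subseteq> topspace circle_topology"
    by (rule openin_subset)
qed

lemma quotient_map_circle_proj: "quotient_map (top_of_set {0..1}) circle_topology circle_proj"
proof -
  have "circle_proj ` {0..1} = {0..<1}"
    by (force simp: circle_proj_def)
  then show ?thesis
    by (simp add: quotient_map_def topspace_circle_topology openin_circle_topology)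
qed

definition thompson_T :: "(real \<Rightarrow> real) monoid" where
  "thompson_T = BijGroup {0..<1}
     \<lparr>carrier := {f. V_map f \<and> homeomorphic_map circle_topology circle_topology f}\<rparr>"


section \<open>CAT(0) spaces\<close>

text \<open>The set \<open>S\<close> is a geodesic segment from \<open>x\<close> to \<open>y\<close>, i.e. the image of an isometric embedding
  of a compact interval.\<close>

definition geodesic_segment ::
    "'a set \<Rightarrow> ('a \<Rightarrow> 'a \<Rightarrow> real) \<Rightarrow> 'a set \<Rightarrow> 'a \<Rightarrow> 'a \<Rightarrow> bool" where
  "geodesic_segment X d S x y \<longleftrightarrow>
     (\<exists>l \<ge> 0. \<exists>c :: real \<Rightarrow> 'a. c ` {0..l} = S \<and> S \<subseteq> X \<and> c 0 = x \<and> c l = y \<and>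
        (\<forall>s\<in>{0..l}. \<forall>t\<in>{0..l}. d (c s) (c t) = \<bar>s - t\<bar>))"

text \<open>\<open>x'\<close> is the comparison point on the Euclidean side \<open>[p',q']\<close> of the point \<open>x\<close> of the
  geodesic side \<open>S\<close> from \<open>p\<close> to \<open>q\<close> (given that \<open>dist p' q' = d p q\<close>).\<close>

definition comparison_point ::
    "('a \<Rightarrow> 'a \<Rightarrow> real) \<Rightarrow> 'a set \<Rightarrow> 'a \<Rightarrow> real^2 \<Rightarrow> real^2 \<Rightarrow> 'a \<Rightarrow> real^2 \<Rightarrow> bool" where
  "comparison_point d S p p' q' x x' \<longleftrightarrow>
     x \<in> S \<and> x' \<in> closed_segment p' q' \<and> dist p' x' = d p x"

definition comparison_triangle ::
    "('a \<Rightarrow> 'a \<Rightarrow> real) \<Rightarrow> 'a \<Rightarrow> 'a \<Rightarrow> 'a \<Rightarrow> real^2 \<Rightarrow> real^2 \<Rightarrow> real^2 \<Rightarrow> bool" where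
  "comparison_triangle d p q r p' q' r' \<longleftrightarrow>
     dist p' q' = d p q \<and> dist q' r' = d q r \<and> dist r' p' = d r p"

definition CAT0_inequality ::
    "('a \<Rightarrow> 'a \<Rightarrow> real) \<Rightarrow> 'a \<Rightarrow> 'a \<Rightarrow> 'a \<Rightarrow> 'a set \<Rightarrow> 'a set \<Rightarrow> 'a set \<Rightarrow> bool" where
  "CAT0_inequality d p q r Spq Sqr Srp \<longleftrightarrow>
     (\<forall>p' q' r'. comparison_triangle d p q r p' q' r' \<longrightarrow>
        (let cmp = (\<lambda>x x'. comparison_point d Spq p p' q' x x' \<or>
                            comparison_point d Sqr q q' r' x x' \<or>
                            comparison_point d Srp r r' p' x x')
         in \<forall>x x' y y'. cmp x x' \<and> cmp y y' \<longrightarrow> d x y \<le> dist x' y'))"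

locale CAT0_space = Metric_space X d
  for X :: "'a set" and d :: "'a \<Rightarrow> 'a \<Rightarrow> real" +
  assumes nonempty: "X \<noteq> {}"
    and geodesic: "\<lbrakk>x \<in> X; y \<in> X\<rbrakk> \<Longrightarrow> \<exists>S. geodesic_segment X d S x y"
    and CAT0: "\<lbrakk>geodesic_segment X d Spq p q; geodesic_segment X d Sqr q r;
                geodesic_segment X d Srp r p\<rbrakk> \<Longrightarrow> CAT0_inequality d p q r Spq Sqr Srp"


section \<open>Covering dimension\<close>

text \<open>As for the (small inductive) dimension \<open>dimension_le\<close> of the library, values are
  integers from \<open>-1\<close> on, \<open>-1\<close> being the dimension of the empty space.\<close>

definition covering_dim_le :: "'a topology \<Rightarrow> int \<Rightarrow> bool" where
  "covering_dim_le T n \<longleftrightarrow> -1 \<le> n \<and>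
     (\<forall>\<U>. (\<forall>U\<in>\<U>. openin T U) \<and> \<Union>\<U> = topspace T \<longrightarrow>
       (\<exists>\<V>. (\<forall>V\<in>\<V>. openin T V) \<and> \<Union>\<V> = topspace T \<and>
            (\<forall>V\<in>\<V>. \<exists>U\<in>\<U>. V \<subseteq> U) \<and>
            (\<forall>x\<in>topspace T. finite {V\<in>\<V>. x \<in> V} \<and> int (card {V\<in>\<V>. x \<in> V}) \<le> n + 1)))"

definition has_covering_dim :: "'a topology \<Rightarrow> int \<Rightarrow> bool" where
  "has_covering_dim T n \<longleftrightarrow> covering_dim_le T n \<and> \<not> covering_dim_le T (n - 1)"


section \<open>Semi-simple isometric actions\<close>

definition translation_length :: "'a set \<Rightarrow> ('a \<Rightarrow> 'a \<Rightarrow> real) \<Rightarrow> ('a \<Rightarrow> 'a) \<Rightarrow> real" where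
  "translation_length X d \<gamma> = (INF x\<in>X. d x (\<gamma> x))"

definition semisimple :: "'a set \<Rightarrow> ('a \<Rightarrow> 'a \<Rightarrow> real) \<Rightarrow> ('a \<Rightarrow> 'a) \<Rightarrow> bool" where
  "semisimple X d \<gamma> \<longleftrightarrow> (\<exists>x\<in>X. d x (\<gamma> x) = translation_length X d \<gamma>)"

locale isometric_action = group_action G X \<phi> + Metric_space X d
  for G (structure) and X :: "'a set" and d :: "'a \<Rightarrow> 'a \<Rightarrow> real" and \<phi> +
  assumes isometry:
    "\<lbrakk>g \<in> carrier G; x \<in> X; y \<in> X\<rbrakk> \<Longrightarrow> d (\<phi> g x) (\<phi> g y) = d x y"

locale semisimple_action = isometric_action +
  assumes semisimple: "g \<in> carrier G \<Longrightarrow> semisimple X d (\<phi> g)"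

end

theory Submission
  imports Defs
begin

text \<open>Call a set of group elements displaceable if it has \<open>k + 1\<close> conjugates that commute elementwise. In
  a CAT(0) space of dimension \<open>k\<close>, if every choice of one set from each of \<open>k + 1\<close> pairs of convex
  sets has a common point, then the two sets of some pair meet. For the fixed point
  sets of conjugates this shows that two elliptic sets whose union is displaceable have a
  common fixed point; for horoballs it shows that commutators of displaceable elements are elliptic.
  Similarly, by Helly's theorem, finitely many elliptic elements have a common fixed point if any
  \<open>k + 1\<close> of them do.

  Now divide the circle into \<open>M = 2 ^ (k + 3)\<close> cells. The group \<open>T\<close> is generated by the rotates of one
  element \<open>y\<close> supported in two adjacent cells, and \<open>V\<close> by these and an involution swapping two cells. By
  the pentagon relation \<open>y\<close> is conjugate to a commutator of such rotates. Any \<open>k + 1\<close> generators fix a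
  common cell pointwise; squeezing its complement into each of \<open>k + 1\<close> disjoint cells displaces them.\<close>

section \<open>Lebesgue's covering theorem\<close>

text \<open>Semi-simplicity excludes parabolic isometries: an element without fixed points
  translates the orbit of a point of minimal displacement along a line. The obstacle is to exclude
  these hyperbolic elements without any local compactness. On the elements commuting with a
  hyperbolic \<open>h\<close>, the change of the Busemann function of its orbit is a homomorphism to
  the reals; it kills commutators, which is why commutators rather than arbitrary displaceable
  elements are shown to be elliptic. Dimension enters only through Lebesgue's covering theorem:
  \<open>k + 1\<close> free choices between two disjoint convex sets would span a cube of dimension
  \<open>k + 1\<close> whose opposite facets are kept apart. As for the number of cells,
  \<open>k + 1\<close> generators move at most \<open>2 * (k + 1)\<close> of them, and
  \<open>k + 1\<close> must be available as targets of the squeezing; \<open>8 * 2 ^ k\<close> is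
  enough for both and, being a power of two, makes the cells standard dyadic intervals. All rotates
  of the bump \<open>y\<close> are conjugate, so that a fixed point of one of them suffices, and the
  involution fixes a midpoint.\<close>

lemma kuhn_colouring:
  fixes c :: "(nat \<Rightarrow> nat) \<Rightarrow> nat"
  assumes p: "0 < p"
    and le: "\<And>x. \<forall>i. x i \<le> p \<Longrightarrow> c x \<le> n"
    and zero: "\<And>x j. \<forall>i. x i \<le> p \<Longrightarrow> j < n \<Longrightarrow> x j = 0 \<Longrightarrow> c x \<noteq> j"
    and top: "\<And>x j. \<forall>i. x i \<le> p \<Longrightarrow> j < n \<Longrightarrow> x j = p \<Longrightarrow> c x \<le> j"
  obtains q r where "\<And>i. q i \<le> p"
    and "\<And>j. j \<le> n \<Longrightarrow> (\<forall>i. r j i \<le> p) \<and> c (r j) = j \<and> (\<forall>i<n. q i \<le> r j i \<and> r j i \<le> q i + 1)"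
proof -
  \<comment> \<open>Kuhn's combinatorial lemma works with 0/1 labels per coordinate and reads off
    the first index with a nonzero label, or \<open>n\<close> if there is none. The labels are
    forced on the two extreme faces; elsewhere only the coordinate equal to the colour gets 1. The
    hypotheses \<open>zero\<close> and \<open>top\<close> keep the forced labels from disturbing the
    reading.\<close>
  define lab :: "(nat \<Rightarrow> nat) \<Rightarrow> nat \<Rightarrow> nat"
    where "lab x j = (if x j = 0 then 0 else if x j = p then 1 else if c x = j then 1 else 0)" for x j
  have red: "reduced n (lab x) = c x" if x: "\<forall>i. x i \<le> p" for x
  proof (rule reduced_labelling_unique)
    show "c x \<le> n" by (rule le[OF x])
    show "\<forall>i<c x. lab x i = 0"
    proof (intro allI impI)
      fix i assume i: "i < c x"
      then have "x i \<noteq> p" using top[OF x, of i] le[OF x] by linarith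
      then show "lab x i = 0" using i by (simp add: lab_def)
    qed
    show "c x = n \<or> lab x (c x) \<noteq> 0"
      using zero[OF x, of "c x"] le[OF x] by (cases "c x = n") (auto simp: lab_def)
  qed
  have "odd (card {s. ksimplex p n s \<and> (reduced n \<circ> lab) ` s = {..n}})"
    by (rule kuhn_combinatorial[OF p]) (use p in \<open>auto simp: lab_def\<close>)
  then have "{s. ksimplex p n s \<and> (reduced n \<circ> lab) ` s = {..n}} \<noteq> {}"
    by (rule odd_card_imp_not_empty)
  then obtain s b u where s: "kuhn_simplex p n b u s" and rl: "(reduced n \<circ> lab) ` s = {..n}"
    by (auto elim: ksimplex.cases)
  interpret kuhn_simplex p n b u s by fact
  have sle: "\<forall>i. x i \<le> p" if "x \<in> s" for x
  proof
    fix i show "x i \<le> p"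
      using s_space that out_eq_p[OF that, of i] by (cases "i < n") auto
  qed
  have "\<exists>x. j \<le> n \<longrightarrow> x \<in> s \<and> reduced n (lab x) = j" for j
  proof (cases "j \<le> n")
    case True
    then have "j \<in> (reduced n \<circ> lab) ` s" using rl by simp
    then show ?thesis by auto
  qed auto
  then obtain r where r: "\<And>j. j \<le> n \<Longrightarrow> r j \<in> s \<and> reduced n (lab (r j)) = j"
    by metis
  show ?thesis
  proof (rule that[of b r])
    show "b i \<le> p" for i
      using base base_out[of i] by (cases "i < n") (auto simp: Pi_iff less_imp_le)
    fix j assume "j \<le> n"
    then have rj: "r j \<in> s" "reduced n (lab (r j)) = j" using r by auto
    then show "(\<forall>i. r j i \<le> p) \<and> c (r j) = j \<and> (\<forall>i<n. b i \<le> r j i \<and> r j i \<le> b i + 1)"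
      using sle[OF rj(1)] red[OF sle[OF rj(1)]] base_le[OF rj(1)] le_Suc_base[OF rj(1)] by auto
  qed
qed

lemma covering_dim_leD:
  assumes "covering_dim_le T n" "\<forall>W\<in>\<U>. openin T W" "\<Union>\<U> = topspace T"
  shows "\<exists>\<V>. (\<forall>V\<in>\<V>. openin T V) \<and> \<Union>\<V> = topspace T \<and> (\<forall>V\<in>\<V>. \<exists>W\<in>\<U>. V \<subseteq> W) \<and>
    (\<forall>x\<in>topspace T. finite {V\<in>\<V>. x \<in> V} \<and> int (card {V\<in>\<V>. x \<in> V}) \<le> n + 1)"
proof -
  have *: "(\<forall>U\<in>\<U>. openin T U) \<and> \<Union>\<U> = topspace T"
    using assms by simp
  show ?thesis
    by (rule mp[OF spec[OF conjunct2[OF assms(1)[unfolded covering_dim_le_def]], of \<U>] *])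
qed

section \<open>Coverings of metric spaces of small covering dimension\<close>

context Metric_space
begin

text \<open>The depth of \<open>x\<close> inside \<open>W\<close>. The extra element 1 keeps the
  infimum over a nonempty set when \<open>W\<close> is the whole space, and the function stays
  1-Lipschitz.\<close>

definition codist :: "'a set \<Rightarrow> 'a \<Rightarrow> real" where
  "codist W x = Inf (insert 1 (d x ` (M - W)))"

lemma bdd_below_codist: "bdd_below (insert 1 (d x ` A))"
  by (rule bdd_belowI[of _ 0]) auto

lemma codist_le: "x \<in> M \<Longrightarrow> y \<in> M \<Longrightarrow> codist W x \<le> codist W y + d x y"
proof -
  assume xy: "x \<in> M" "y \<in> M"
  have "codist W x - d x y \<le> codist W y"
    unfolding codist_def[of W y]
  proof (rule cInf_greatest)
    fix r assume "r \<in> insert 1 (d y ` (M - W))"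
    then consider "r = 1" | z where "z \<in> M - W" "r = d y z" by auto
    then show "codist W x - d x y \<le> r"
    proof cases
      case 1
      have "codist W x \<le> 1" unfolding codist_def by (rule cInf_lower[OF _ bdd_below_codist]) simp
      then show ?thesis using 1 nonneg[of x y] by linarith
    next
      case 2
      have "codist W x \<le> d x z"
        unfolding codist_def by (rule cInf_lower[OF _ bdd_below_codist]) (use 2 in simp)
      then show ?thesis using 2 triangle[of x y z] xy by simp
    qed
  qed simp
  then show ?thesis by simp
qed

lemma codist_lipschitz: "x \<in> M \<Longrightarrow> y \<in> M \<Longrightarrow> \<bar>codist W x - codist W y\<bar> \<le> d x y"
  using codist_le[of x y W] codist_le[of y x W] commute[of x y] by linarith

lemma codist_pos_iff:
  assumes "openin mtopology W" "x \<in> M"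
  shows "0 < codist W x \<longleftrightarrow> x \<in> W"
proof
  assume "x \<in> W"
  then obtain e where e: "e > 0" "mball x e \<subseteq> W"
    using assms openin_mtopology by blast
  have "min 1 e \<le> codist W x"
    unfolding codist_def
  proof (rule cInf_greatest)
    fix r assume "r \<in> insert 1 (d x ` (M - W))"
    then show "min 1 e \<le> r" using e assms(2) by force
  qed simp
  then show "0 < codist W x" using e by linarith
next
  assume pos: "0 < codist W x"
  show "x \<in> W"
  proof (rule ccontr)
    assume "x \<notin> W"
    have "codist W x \<le> d x x"
      unfolding codist_def by (rule cInf_lower[OF _ bdd_below_codist]) (use \<open>x \<notin> W\<close> assms in blast)
    then show False using pos assms by simp
  qed
qed

text \<open>Lebesgue's covering theorem for the \<open>n\<close>-cube, transported to a space of covering dimension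
  less than \<open>n\<close> along a map defined on the cube. Points of the cube are sequences of which only
  the first \<open>n\<close> entries matter.\<close>

lemma lebesgue_covering:
  fixes f :: "(nat \<Rightarrow> real) \<Rightarrow> 'a" and U :: "nat \<Rightarrow> 'a set"
  assumes dim: "covering_dim_le mtopology (int k)" and kn: "k < n"
    and opn: "\<And>j. j \<le> n \<Longrightarrow> openin mtopology (U j)" and cov: "M \<subseteq> (\<Union>j\<le>n. U j)"
    and fM: "\<And>t. t \<in> UNIV \<rightarrow> {0..1} \<Longrightarrow> f t \<in> M"
    and cont: "\<And>t e. t \<in> UNIV \<rightarrow> {0..1} \<Longrightarrow> e > 0 \<Longrightarrow>
       \<exists>\<delta>>0. \<forall>s\<in>UNIV \<rightarrow> {0..1}. (\<forall>i<n. \<bar>s i - t i\<bar> < \<delta>) \<longrightarrow> d (f s) (f t) < e"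
    and face0: "\<And>t i. t \<in> UNIV \<rightarrow> {0..1} \<Longrightarrow> i < n \<Longrightarrow> t i = 0 \<Longrightarrow> f t \<notin> U i"
    and face1: "\<And>t i j. t \<in> UNIV \<rightarrow> {0..1} \<Longrightarrow> i < n \<Longrightarrow> t i = 1 \<Longrightarrow> i < j \<Longrightarrow> j \<le> n \<Longrightarrow> f t \<notin> U j"
  shows False
proof -
  have "\<forall>W\<in>U ` {..n}. openin mtopology W" using opn by auto
  moreover have "\<Union>(U ` {..n}) = topspace mtopology"
  proof -
    have "U j \<subseteq> M" if "j \<le> n" for j using openin_subset[OF opn[OF that]] by simp
    then have "\<Union>(U ` {..n}) \<subseteq> M" by blast
    with cov show ?thesis
      unfolding topspace_mtopology by (rule equalityI[rotated])
  qed
  ultimately have "\<exists>\<V>. (\<forall>V\<in>\<V>. openin mtopology V) \<and> \<Union>\<V> = topspace mtopology \<and>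
      (\<forall>V\<in>\<V>. \<exists>W\<in>U ` {..n}. V \<subseteq> W) \<and>
      (\<forall>x\<in>topspace mtopology. finite {V\<in>\<V>. x \<in> V} \<and> int (card {V\<in>\<V>. x \<in> V}) \<le> int k + 1)"
    by (rule covering_dim_leD[OF dim])
  then obtain \<V> where \<V>: "\<forall>V\<in>\<V>. openin mtopology V" "\<Union>\<V> = M"
      "\<forall>V\<in>\<V>. \<exists>W\<in>U ` {..n}. V \<subseteq> W"
      "\<forall>x\<in>M. finite {V\<in>\<V>. x \<in> V} \<and> int (card {V\<in>\<V>. x \<in> V}) \<le> int k + 1"
    unfolding topspace_mtopology by (elim exE conjE)
  then have "\<forall>V\<in>\<V>. \<exists>j\<le>n. V \<subseteq> U j" by auto
  then obtain c where c: "\<And>V. V \<in> \<V> \<Longrightarrow> c V \<le> n \<and> V \<subseteq> U (c V)" by metis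
  \<comment> \<open>The refinement is regrouped by the index of a containing \<open>U j\<close>, so
    that the cover again has \<open>n + 1\<close> members and inherits the behaviour on the
    faces.\<close>
  define W where "W j = \<Union>{V\<in>\<V>. c V = j}" for j
  have Wopen: "openin mtopology (W j)" for j
    unfolding W_def using \<V>(1) by (intro openin_Union) auto
  have WU: "W j \<subseteq> U j" for j unfolding W_def using c by auto
  have Wcov: "\<exists>j\<le>n. x \<in> W j" if "x \<in> M" for x
    using that \<V>(2) c unfolding W_def by blast
  have Wempty: "\<exists>j\<le>n. x \<notin> W j" if "x \<in> M" for x
  proof (rule ccontr)
    assume "\<not> (\<exists>j\<le>n. x \<notin> W j)"
    \<comment> \<open>A common point would lie in one member of \<V> for each index, that is in
      \<open>n + 1 > k + 1\<close> members.\<close>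
    then have "{..n} \<subseteq> c ` {V\<in>\<V>. x \<in> V}" unfolding W_def by auto
    then have "card {..n} \<le> card {V\<in>\<V>. x \<in> V}"
      using \<V>(4) that by (meson card_image_le card_mono finite_imageI le_trans)
    then show False using \<V>(4) that kn by force
  qed
  define lam where "lam j = codist (W j)" for j
  have lam_pos: "0 < lam j x \<longleftrightarrow> x \<in> W j" if "x \<in> M" for j x
    unfolding lam_def by (rule codist_pos_iff[OF Wopen that])
  \<comment> \<open>The colour of a point is an index where it lies deepest. Continuity of
    \<open>lam\<close> then makes all depths agree at a limit of points of every colour.\<close>
  define col where "col x = (SOME j. j \<le> n \<and> (\<forall>i\<le>n. lam i x \<le> lam j x))" for x
  have col: "col x \<le> n \<and> (\<forall>i\<le>n. lam i x \<le> lam (col x) x)" for x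
  proof -
    have "Max ((\<lambda>i. lam i x) ` {..n}) \<in> (\<lambda>i. lam i x) ` {..n}" by (rule Max_in) auto
    then obtain j where j: "j \<le> n" "Max ((\<lambda>i. lam i x) ` {..n}) = lam j x" by (rule imageE) simp
    have "lam i x \<le> lam j x" if "i \<le> n" for i
      unfolding j(2)[symmetric] by (rule Max_ge) (use that in auto)
    then have "\<exists>j. j \<le> n \<and> (\<forall>i\<le>n. lam i x \<le> lam j x)" using j(1) by blast
    then show ?thesis unfolding col_def by (rule someI_ex)
  qed
  have colU: "x \<in> U (col x)" if "x \<in> M" for x
  proof -
    obtain j where j: "j \<le> n" "x \<in> W j" using Wcov[OF \<open>x \<in> M\<close>] by blast
    have "0 < lam j x" using lam_pos[OF that, of j] j(2) by simp
    also have "lam j x \<le> lam (col x) x" using col[of x] j(1) by simp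
    finally show ?thesis using lam_pos[OF that, of "col x"] subsetD[OF WU] by simp
  qed
  define grid where "grid p x = (\<lambda>i. real (x i) / real p)" for p and x :: "nat \<Rightarrow> nat"
  have gridc: "grid p x \<in> UNIV \<rightarrow> {0..1}" if "\<forall>i. x i \<le> p" for p x
    using that by (auto simp: grid_def divide_le_eq_1 intro!: divide_nonneg_nonneg)
  have "\<exists>q r. (\<forall>i. q i \<le> Suc p) \<and> (\<forall>j\<le>n. (\<forall>i. r j i \<le> Suc p) \<and> col (f (grid (Suc p) (r j))) = j \<and>
          (\<forall>i<n. q i \<le> r j i \<and> r j i \<le> q i + 1))" for p
  proof (rule kuhn_colouring[of "Suc p" "\<lambda>x. col (f (grid (Suc p) x))" n])
    fix q r
    assume "\<And>i. q i \<le> Suc p"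
      "\<And>j. j \<le> n \<Longrightarrow> (\<forall>i. r j i \<le> Suc p) \<and> col (f (grid (Suc p) (r j))) = j \<and>
        (\<forall>i<n. q i \<le> r j i \<and> r j i \<le> q i + 1)"
    then show ?thesis by (intro exI[of _ q] exI[of _ r]) simp
  next
    show "col (f (grid (Suc p) x)) \<le> n" for x using col by blast
    show "col (f (grid (Suc p) x)) \<noteq> j" if x: "\<forall>i. x i \<le> Suc p" and j: "j < n" "x j = 0" for x j
    proof -
      have "f (grid (Suc p) x) \<notin> U j"
        by (rule face0[OF gridc[OF x] j(1)]) (simp add: grid_def j)
      then show ?thesis using colU[OF fM[OF gridc[OF x]]] by metis
    qed
    show "col (f (grid (Suc p) x)) \<le> j" if x: "\<forall>i. x i \<le> Suc p" and j: "j < n" "x j = Suc p" for x j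
    proof (rule ccontr)
      assume "\<not> col (f (grid (Suc p) x)) \<le> j"
      then have "f (grid (Suc p) x) \<notin> U (col (f (grid (Suc p) x)))"
        using col[of "f (grid (Suc p) x)"]
        by (intro face1[OF gridc[OF x] j(1)]) (auto simp: grid_def j simp del: of_nat_Suc)
      then show False using colU[OF fM[OF gridc[OF x]]] by metis
    qed
  qed simp
  then have "\<forall>p. \<exists>qr. (\<forall>i. fst qr i \<le> Suc p) \<and> (\<forall>j\<le>n. (\<forall>i. snd qr j i \<le> Suc p) \<and>
      col (f (grid (Suc p) (snd qr j))) = j \<and> (\<forall>i<n. fst qr i \<le> snd qr j i \<and> snd qr j i \<le> fst qr i + 1))"
    by simp
  from choice[OF this] obtain qr where qr: "\<And>p. (\<forall>i. fst (qr p) i \<le> Suc p) \<and> (\<forall>j\<le>n. (\<forall>i. snd (qr p) j i \<le> Suc p) \<and>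
      col (f (grid (Suc p) (snd (qr p) j))) = j \<and>
      (\<forall>i<n. fst (qr p) i \<le> snd (qr p) j i \<and> snd (qr p) j i \<le> fst (qr p) i + 1))"
    by blast
  define q where "q p = fst (qr p)" for p
  define r where "r p = snd (qr p)" for p
  have q: "\<And>p i. q p i \<le> Suc p"
    and r: "\<And>p j. j \<le> n \<Longrightarrow> (\<forall>i. r p j i \<le> Suc p) \<and> col (f (grid (Suc p) (r p j))) = j \<and>
          (\<forall>i<n. q p i \<le> r p j i \<and> r p j i \<le> q p i + 1)"
    using qr unfolding q_def r_def by simp_all
  define Q where "Q p = grid (Suc p) (q p)" for p
  have Qc: "Q p \<in> UNIV \<rightarrow> {0..1}" for p unfolding Q_def using q by (intro gridc) auto
  \<comment> \<open>Compactness of the cube in its first \<open>n\<close> coordinates: the base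
    points of the fully coloured simplices accumulate at some \<open>l\<close>.\<close>
  have sub: "\<forall>B\<subseteq>{..<n}. \<exists>l::nat \<Rightarrow> real. \<exists>\<rho>. strict_mono \<rho> \<and>
      (\<forall>e>0. \<forall>\<^sub>F p in sequentially. \<forall>i\<in>B. dist (Q (\<rho> p) i) (l i) < e)"
  proof (rule compact_lemma_general[where unproj = "\<lambda>x. x"])
    fix i show "bounded ((\<lambda>x. x i) ` range Q)"
      by (rule boundedI[of _ 1]) (use Qc in \<open>force simp: Pi_iff abs_le_iff\<close>)
  qed auto
  obtain l \<rho> where \<rho>: "strict_mono \<rho>"
    and l0: "\<forall>e>0. \<forall>\<^sub>F p in sequentially. \<forall>i\<in>{..<n}. dist (Q (\<rho> p) i) (l i) < e"
    using mp[OF spec[OF sub, of "{..<n}"] subset_refl] by (elim exE conjE)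
  have l: "\<forall>\<^sub>F p in sequentially. \<forall>i<n. \<bar>Q (\<rho> p) i - l i\<bar> < e" if "e > 0" for e
    using mp[OF spec[OF l0, of e] that] by (simp add: dist_real_def Ball_def)
  define t where "t i = (if i < n then l i else 0)" for i
  have tc: "t \<in> UNIV \<rightarrow> {0..1}"
  proof
    fix i show "t i \<in> {0..1}"
    proof (cases "i < n")
      case True
      have lim: "(\<lambda>p. Q (\<rho> p) i) \<longlonglongrightarrow> l i"
        unfolding tendsto_iff dist_real_def
      proof (intro allI impI)
        fix e :: real assume "e > 0"
        from l[OF this] show "\<forall>\<^sub>F p in sequentially. \<bar>Q (\<rho> p) i - l i\<bar> < e"
          by eventually_elim (use True in auto)
      qed
      have "Q (\<rho> p) i \<in> {0..1}" for p by (rule funcset_mem[OF Qc]) simp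
      from closed_sequentially[OF closed_atLeastAtMost this lim] have "l i \<in> {0..1}" .
      then show ?thesis using True by (simp add: t_def)
    qed (simp add: t_def)
  qed
  \<comment> \<open>Points of colour \<open>j\<close> occur arbitrarily close to \<open>t\<close>,
    and there \<open>lam j\<close> is maximal. As \<open>j\<close> is arbitrary, all depths at
    \<open>t\<close> coincide.\<close>
  have key: "lam i (f t) \<le> lam j (f t)" if ij: "i \<le> n" "j \<le> n" for i j
  proof (rule field_le_epsilon)
    fix e :: real assume e: "e > 0"
    from e have "e / 2 > 0" by simp
    from cont[OF tc this] obtain \<delta> where \<delta>: "\<delta> > 0"
      "\<And>s. s \<in> UNIV \<rightarrow> {0..1} \<Longrightarrow> (\<forall>i<n. \<bar>s i - t i\<bar> < \<delta>) \<Longrightarrow> d (f s) (f t) < e / 2"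
      by (elim exE conjE) blast
    have "\<forall>\<^sub>F p in sequentially. 1 / real (Suc p) < \<delta> / 2"
      unfolding inverse_eq_divide[symmetric]
      by (rule order_tendstoD(2)[OF LIMSEQ_inverse_real_of_nat]) (use \<delta>(1) in simp)
    then have "\<forall>\<^sub>F p in sequentially. 1 / real (Suc (\<rho> p)) < \<delta> / 2"
      by (rule eventually_subseq[OF \<rho>])
    moreover have "\<forall>\<^sub>F p in sequentially. \<forall>i<n. \<bar>Q (\<rho> p) i - l i\<bar> < \<delta> / 2"
      using l[of "\<delta> / 2"] \<delta>(1) by simp
    ultimately have "\<forall>\<^sub>F p in sequentially. 1 / real (Suc (\<rho> p)) < \<delta> / 2 \<and> (\<forall>i<n. \<bar>Q (\<rho> p) i - l i\<bar> < \<delta> / 2)"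
      by eventually_elim auto
    from eventually_happens'[OF sequentially_bot this]
    obtain p where p: "1 / real (Suc (\<rho> p)) < \<delta> / 2" "\<forall>i<n. \<bar>Q (\<rho> p) i - l i\<bar> < \<delta> / 2"
      by (elim exE conjE)
    define s where "s = grid (Suc (\<rho> p)) (r (\<rho> p) j)"
    have sc: "s \<in> UNIV \<rightarrow> {0..1}" unfolding s_def using r[OF ij(2), of "\<rho> p"] by (intro gridc) (elim conjE)
    have "\<bar>s i - t i\<bar> < \<delta>" if i: "i < n" for i
    proof -
      have qr: "q (\<rho> p) i \<le> r (\<rho> p) j i" "r (\<rho> p) j i \<le> q (\<rho> p) i + 1" using r[OF ij(2)] i by auto
      have "\<bar>s i - Q (\<rho> p) i\<bar> = \<bar>real (r (\<rho> p) j i) - real (q (\<rho> p) i)\<bar> / real (Suc (\<rho> p))"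
        unfolding s_def Q_def grid_def by (simp add: diff_divide_distrib[symmetric] del: of_nat_Suc)
      also have "\<dots> \<le> 1 / real (Suc (\<rho> p))" using qr by (intro divide_right_mono) auto
      finally have "\<bar>s i - Q (\<rho> p) i\<bar> \<le> 1 / real (Suc (\<rho> p))" .
      moreover have "\<bar>Q (\<rho> p) i - l i\<bar> < \<delta> / 2" using p(2) i by blast
      moreover have "t i = l i" using i by (simp add: t_def)
      ultimately show ?thesis using p(1) by linarith
    qed
    then have ds: "d (f s) (f t) < e / 2" by (intro \<delta>(2)[OF sc] allI impI)
    have "col (f s) = j" using r[OF ij(2), of "\<rho> p"] unfolding s_def by (elim conjE)
    then have "lam i (f s) \<le> lam j (f s)"
      using col[of "f s"] ij(1) by simp
    moreover have "\<bar>lam i (f s) - lam i (f t)\<bar> \<le> d (f s) (f t)" "\<bar>lam j (f s) - lam j (f t)\<bar> \<le> d (f s) (f t)"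
      unfolding lam_def using fM[OF sc] fM[OF tc] by (auto intro: codist_lipschitz)
    ultimately show "lam i (f t) \<le> lam j (f t) + e" using ds by linarith
  qed
  \<comment> \<open>Equal depths are impossible: some \<open>W i\<close> contains \<open>f t\<close>
    and some \<open>W j\<close> does not.\<close>
  from Wcov[OF fM[OF tc]] Wempty[OF fM[OF tc]]
  obtain i j where "i \<le> n" "f t \<in> W i" "j \<le> n" "f t \<notin> W j"
    by (elim exE conjE)
  then show False using key[of i j] lam_pos[OF fM[OF tc], of i] lam_pos[OF fM[OF tc], of j] by simp
qed

end

section \<open>Geodesics and convex sets\<close>

lemma dist_vector_2: "dist (vector [x, y] :: real^2) (vector [x', y']) = sqrt ((x - x')\<^sup>2 + (y - y')\<^sup>2)"
  by (simp add: dist_vec_def L2_set_def UNIV_2 dist_real_def)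

text \<open>The CAT(0) inequality is assumed for all comparison triangles, so it has content only
  once one exists.\<close>

lemma euclidean_triangle_exists:
  fixes a b c :: real
  assumes "0 \<le> a" "0 \<le> b" "0 \<le> c" "a \<le> b + c" "b \<le> a + c" "c \<le> a + b"
  obtains p q r :: "real^2" where "dist p q = a" "dist q r = c" "dist r p = b"
proof (cases "a = 0")
  case True
  then have "b = c" using assms by simp
  show ?thesis
    by (rule that[of "vector [0, 0]" "vector [0, 0]" "vector [b, 0]"])
       (use True \<open>b = c\<close> assms in \<open>simp_all add: dist_vector_2\<close>)
next
  case False
  then have a: "a > 0" using assms by simp
  \<comment> \<open>The law of cosines: the coordinate of the third vertex along the first
    side.\<close>
  define x where "x = (a\<^sup>2 + b\<^sup>2 - c\<^sup>2) / (2 * a)"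
  have ax: "2 * a * x = a\<^sup>2 + b\<^sup>2 - c\<^sup>2" using a by (simp add: x_def)
  have "\<bar>2 * a * x\<bar> \<le> 2 * a * b"
  proof -
    have "c\<^sup>2 \<le> (a + b)\<^sup>2" using assms by (intro power_mono) auto
    moreover have "(a - b)\<^sup>2 \<le> c\<^sup>2" using assms by (intro abs_le_square_iff[THEN iffD1]) auto
    ultimately show ?thesis unfolding ax by (simp add: power2_eq_square algebra_simps abs_le_iff)
  qed
  then have "\<bar>x\<bar> \<le> b" using a by (simp add: abs_mult)
  then have xb: "x\<^sup>2 \<le> b\<^sup>2" using assms(2) by (metis abs_le_square_iff abs_of_nonneg)
  define y where "y = sqrt (b\<^sup>2 - x\<^sup>2)"
  have y: "y\<^sup>2 = b\<^sup>2 - x\<^sup>2" using xb by (simp add: y_def)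
  have 1: "(a - x)\<^sup>2 + (0 - y)\<^sup>2 = c\<^sup>2" using ax y by (simp add: power2_eq_square algebra_simps)
  have 2: "(x - 0)\<^sup>2 + (y - 0)\<^sup>2 = b\<^sup>2" using y by simp
  show ?thesis
    by (rule that[of "vector [0, 0]" "vector [a, 0]" "vector [x, y]"])
       (use 1 2 assms in \<open>simp_all only: dist_vector_2, simp_all\<close>)
qed

text \<open>Stewart's theorem, the Euclidean identity whose CAT(0) counterpart is
  \<open>CN_inequality\<close>.\<close>

lemma dist_affine_combination_sq:
  fixes p q r :: "'a::real_inner"
  shows "(dist (p + t *\<^sub>R (q - p)) r)\<^sup>2 = (1 - t) * (dist r p)\<^sup>2 + t * (dist r q)\<^sup>2 - t * (1 - t) * (dist p q)\<^sup>2"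
  by (simp add: dist_norm power2_norm_eq_inner inner_diff_left inner_diff_right inner_add_left inner_add_right
      inner_commute algebra_simps)

lemma affine_combination_in_closed_segment:
  fixes p q :: "'a::real_normed_vector"
  assumes "0 \<le> t" "t \<le> 1"
  shows "p + t *\<^sub>R (q - p) \<in> closed_segment p q" "dist p (p + t *\<^sub>R (q - p)) = t * dist p q"
  using assms by (auto simp: in_segment algebra_simps dist_norm norm_minus_commute intro!: exI[of _ t])
     (metis abs_of_nonneg norm_minus_commute norm_scaleR scaleR_right_diff_distrib)

context CAT0_space
begin

text \<open>Segments are reparametrised proportionally to arc length over [0, 1]; a degenerate
  segment then needs no separate case.\<close>

lemma geodesic_segmentE:
  assumes S: "geodesic_segment X d S x y"
  obtains c where "x \<in> X" "y \<in> X"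
    "\<And>t. t \<in> {0..1} \<Longrightarrow> c t \<in> S \<and> c t \<in> X \<and> d x (c t) = t * d x y \<and> d (c t) y = (1 - t) * d x y"
    "\<And>s t. s \<in> {0..1} \<Longrightarrow> t \<in> {0..1} \<Longrightarrow> d (c s) (c t) = \<bar>s - t\<bar> * d x y"
    "c 0 = x" "c 1 = y"
proof -
  from S obtain l c where l: "l \<ge> 0" and c: "c ` {0..l} = S" "S \<subseteq> X" "c 0 = x" "c l = y"
    "\<And>s t. s \<in> {0..l} \<Longrightarrow> t \<in> {0..l} \<Longrightarrow> d (c s) (c t) = \<bar>s - t\<bar>"
    unfolding geodesic_segment_def by auto
  have ld: "d x y = l" using c(5)[of 0 l] c(3,4) l by simp
  have tl: "t * l \<in> {0..l}" if "t \<in> {0..1}" for t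
    using that l by (auto intro: mult_nonneg_nonneg mult_left_le_one_le)
  have dd: "d (c (s * l)) (c (t * l)) = \<bar>s - t\<bar> * d x y" if "s \<in> {0..1}" "t \<in> {0..1}" for s t
    using c(5)[OF tl[OF that(1)] tl[OF that(2)]] l ld by (simp add: abs_mult[symmetric] left_diff_distrib[symmetric]) (metis abs_mult abs_of_nonneg)
  show ?thesis
  proof (rule that[of "\<lambda>t. c (t * l)"])
    show "x \<in> X" "y \<in> X" using c l by (metis atLeastAtMost_iff imageI order_refl subsetD)+
    show "c (t * l) \<in> S \<and> c (t * l) \<in> X \<and> d x (c (t * l)) = t * d x y \<and> d (c (t * l)) y = (1 - t) * d x y"
      if t: "t \<in> {0..1}" for t
    proof -
      have "c (t * l) \<in> S" using c(1) tl[OF t] by auto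
      moreover have "d x (c (t * l)) = t * d x y" using dd[of 0 t] t c(3) by simp
      moreover have "d (c (t * l)) y = (1 - t) * d x y" using dd[of t 1] t c(4) by simp
      ultimately show ?thesis using c(2) by auto
    qed
  qed (use dd c in auto)
qed

lemma comparison:
  assumes S: "geodesic_segment X d Spq p q" "geodesic_segment X d Sqr q r" "geodesic_segment X d Srp r p"
    and x: "x \<in> Spq" "d p x = t * d p q" "t \<in> {0..1}"
    and y: "y \<in> Srp" "d r y = s * d r p" "s \<in> {0..1}"
  obtains p' q' r' :: "real^2" where "dist p' q' = d p q" "dist q' r' = d q r" "dist r' p' = d r p"
    "d x y \<le> dist (p' + t *\<^sub>R (q' - p')) (r' + s *\<^sub>R (p' - r'))"
proof -
  have X: "p \<in> X" "q \<in> X" "r \<in> X" using S by (meson geodesic_segmentE)+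
  obtain p' q' r' :: "real^2" where tri: "dist p' q' = d p q" "dist q' r' = d q r" "dist r' p' = d r p"
    by (rule euclidean_triangle_exists[of "d p q" "d r p" "d q r"])
       (use X triangle commute in \<open>auto, metis+\<close>)
  have cmp: "comparison_point d Spq p p' q' x (p' + t *\<^sub>R (q' - p'))"
       "comparison_point d Srp r r' p' y (r' + s *\<^sub>R (p' - r'))"
    unfolding comparison_point_def
    using x y tri affine_combination_in_closed_segment[of t p' q'] affine_combination_in_closed_segment[of s r' p']
    by simp_all
  have "CAT0_inequality d p q r Spq Sqr Srp" by (rule CAT0[OF S])
  moreover have "comparison_triangle d p q r p' q' r'" using tri by (simp add: comparison_triangle_def)
  ultimately have "d x y \<le> dist (p' + t *\<^sub>R (q' - p')) (r' + s *\<^sub>R (p' - r'))"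
    unfolding CAT0_inequality_def Let_def using cmp by blast
  with tri show ?thesis by (rule that)
qed

text \<open>The point \<open>z\<close> is taken on one segment before \<open>r\<close> is chosen and
  is then compared with the vertex \<open>r\<close> of the triangle \<open>p q r\<close>. So the
  inequality holds for this \<open>z\<close> and all \<open>r\<close> at once; uniqueness of
  geodesics rests on that.\<close>

lemma stewart_segment:
  assumes "p \<in> X" "q \<in> X" "r \<in> X" "t \<in> {0..1}"
  shows "\<exists>z\<in>X. d p z = t * d p q \<and> d z q = (1 - t) * d p q \<and>
     (\<forall>r\<in>X. (d r z)\<^sup>2 \<le> (1 - t) * (d r p)\<^sup>2 + t * (d r q)\<^sup>2 - t * (1 - t) * (d p q)\<^sup>2)"
proof -
  obtain S where S: "geodesic_segment X d S p q" using geodesic assms by blast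
  obtain c where c: "c t \<in> S \<and> c t \<in> X \<and> d p (c t) = t * d p q \<and> d (c t) q = (1 - t) * d p q"
    by (rule geodesic_segmentE[OF S]) (use assms(4) in blast)
  have "(d r (c t))\<^sup>2 \<le> (1 - t) * (d r p)\<^sup>2 + t * (d r q)\<^sup>2 - t * (1 - t) * (d p q)\<^sup>2" if r: "r \<in> X" for r
  proof -
    obtain S1 where S1: "geodesic_segment X d S1 q r" using geodesic assms r by blast
    obtain S2 where S2: "geodesic_segment X d S2 r p" using geodesic assms r by blast
    have "r \<in> S2" using geodesic_segmentE[OF S2] by (metis atLeastAtMost_iff order_refl zero_le_one)
    then obtain p' q' r' :: "real^2" where tri: "dist p' q' = d p q" "dist q' r' = d q r" "dist r' p' = d r p"
      "d (c t) r \<le> dist (p' + t *\<^sub>R (q' - p')) (r' + 0 *\<^sub>R (p' - r'))"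
      by (rule comparison[OF S S1 S2, of "c t" t r 0, rotated 3]) (use c assms r in auto)
    then have "(d (c t) r)\<^sup>2 \<le> (dist (p' + t *\<^sub>R (q' - p')) r')\<^sup>2" by (intro power_mono) auto
    then show ?thesis
      unfolding dist_affine_combination_sq using tri by (simp add: commute dist_commute)
  qed
  then show ?thesis using c by blast
qed

text \<open>At a point with both prescribed distances the right-hand side of
  \<open>stewart_segment\<close> vanishes, so every such point equals the one constructed
  there.\<close>

lemma segment_point_unique:
  assumes "p \<in> X" "q \<in> X" "z \<in> X" "z' \<in> X" "t \<in> {0..1}"
    and z: "d p z = t * d p q" "d z q = (1 - t) * d p q"
    and z': "d p z' = t * d p q" "d z' q = (1 - t) * d p q"
  shows "z = z'"
proof -
  obtain w where w: "w \<in> X" "\<forall>r\<in>X. (d r w)\<^sup>2 \<le> (1 - t) * (d r p)\<^sup>2 + t * (d r q)\<^sup>2 - t * (1 - t) * (d p q)\<^sup>2"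
    using stewart_segment[of p q p t] assms by blast
  have "y = w" if y: "y \<in> X" "d p y = t * d p q" "d y q = (1 - t) * d p q" for y
  proof -
    have "(d y w)\<^sup>2 \<le> (1 - t) * (t * d p q)\<^sup>2 + t * ((1 - t) * d p q)\<^sup>2 - t * (1 - t) * (d p q)\<^sup>2"
      using w y by (metis commute)
    also have "\<dots> = 0" by (simp add: power2_eq_square algebra_simps)
    finally have "d y w = 0" by simp
    then show ?thesis using y w by simp
  qed
  then show ?thesis using assms by metis
qed

text \<open>Described by its two distances alone: uniqueness places it on every segment from
  \<open>x\<close> to \<open>y\<close>, and every isometry carries it along
  (\<open>act_gpt\<close>).\<close>

definition gpt :: "'a \<Rightarrow> 'a \<Rightarrow> real \<Rightarrow> 'a" where
  "gpt x y t = (SOME z. z \<in> X \<and> d x z = t * d x y \<and> d z y = (1 - t) * d x y)"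

lemma gpt:
  assumes "x \<in> X" "y \<in> X" "t \<in> {0..1}"
  shows gpt_in: "gpt x y t \<in> X" and dist_gpt_left: "d x (gpt x y t) = t * d x y"
    and dist_gpt_right: "d (gpt x y t) y = (1 - t) * d x y"
proof -
  have "\<exists>z. z \<in> X \<and> d x z = t * d x y \<and> d z y = (1 - t) * d x y"
    using stewart_segment[of x y x t] assms by blast
  from someI_ex[OF this] show "gpt x y t \<in> X" "d x (gpt x y t) = t * d x y" "d (gpt x y t) y = (1 - t) * d x y"
    unfolding gpt_def by auto
qed

lemma gpt_eqI:
  assumes "x \<in> X" "y \<in> X" "t \<in> {0..1}" "z \<in> X" "d x z = t * d x y" "d z y = (1 - t) * d x y"
  shows "gpt x y t = z"
  using segment_point_unique[of x y "gpt x y t" z t] assms gpt[of x y t] by blast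

lemma gpt_0 [simp]: "x \<in> X \<Longrightarrow> y \<in> X \<Longrightarrow> gpt x y 0 = x"
  and gpt_1 [simp]: "x \<in> X \<Longrightarrow> y \<in> X \<Longrightarrow> gpt x y 1 = y"
  by (auto intro!: gpt_eqI)

lemma gpt_same [simp]: "x \<in> X \<Longrightarrow> t \<in> {0..1} \<Longrightarrow> gpt x x t = x"
  by (auto intro!: gpt_eqI)

lemma gpt_commute: "x \<in> X \<Longrightarrow> y \<in> X \<Longrightarrow> t \<in> {0..1} \<Longrightarrow> gpt y x (1 - t) = gpt x y t"
  by (rule gpt_eqI) (auto simp: gpt commute[of y] commute[of _ x])

text \<open>For \<open>t = 1/2\<close> this is the inequality of Bruhat and Tits; it gives existence
  and uniqueness of nearest points.\<close>

lemma CN_inequality: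
  assumes "p \<in> X" "q \<in> X" "r \<in> X" "t \<in> {0..1}"
  shows "(d r (gpt p q t))\<^sup>2 \<le> (1 - t) * (d r p)\<^sup>2 + t * (d r q)\<^sup>2 - t * (1 - t) * (d p q)\<^sup>2"
proof -
  obtain w where "w \<in> X" "d p w = t * d p q" "d w q = (1 - t) * d p q"
    and w: "\<forall>r\<in>X. (d r w)\<^sup>2 \<le> (1 - t) * (d r p)\<^sup>2 + t * (d r q)\<^sup>2 - t * (1 - t) * (d p q)\<^sup>2"
    using stewart_segment[of p q p t] assms by blast
  then have "gpt p q t = w" using assms by (intro gpt_eqI) auto
  then show ?thesis using w assms by blast
qed

lemma gpt_in_segment:
  assumes S: "geodesic_segment X d S p q" and t: "t \<in> {0..1}"
  shows "gpt p q t \<in> S"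
proof -
  obtain c where "p \<in> X" "q \<in> X" and
     "c t \<in> S \<and> c t \<in> X \<and> d p (c t) = t * d p q \<and> d (c t) q = (1 - t) * d p q"
    by (rule geodesic_segmentE[OF S]) (use t in blast)
  then show ?thesis using gpt_eqI[of p q t "c t"] t by metis
qed

lemma dist_gpt_gpt:
  assumes "p \<in> X" "q \<in> X" "s \<in> {0..1}" "t \<in> {0..1}"
  shows "d (gpt p q s) (gpt p q t) = \<bar>s - t\<bar> * d p q"
proof -
  obtain S where S: "geodesic_segment X d S p q" using geodesic assms by blast
  obtain c where c: 
    "\<And>t. t \<in> {0..1} \<Longrightarrow> c t \<in> S \<and> c t \<in> X \<and> d p (c t) = t * d p q \<and> d (c t) q = (1 - t) * d p q"
    "\<And>s t. s \<in> {0..1} \<Longrightarrow> t \<in> {0..1} \<Longrightarrow> d (c s) (c t) = \<bar>s - t\<bar> * d p q"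
    by (rule geodesic_segmentE[OF S]) blast
  have "gpt p q s = c s" "gpt p q t = c t" using c(1) assms by (auto intro!: gpt_eqI)
  then show ?thesis using c(2) assms by simp
qed

text \<open>The comparison points divide two sides issuing from the same Euclidean vertex in the
  ratio \<open>t\<close>, so their distance is exactly \<open>t\<close> times the third
  side.\<close>

lemma gpt_convex_right:
  assumes "p \<in> X" "q \<in> X" "r \<in> X" "t \<in> {0..1}"
  shows "d (gpt p q t) (gpt p r t) \<le> t * d q r"
proof -
  obtain S S1 S2 where S: "geodesic_segment X d S p q" "geodesic_segment X d S1 q r" "geodesic_segment X d S2 r p"
    using geodesic assms by meson
  have r: "gpt p r t = gpt r p (1 - t)" using gpt_commute[of p r t] assms by simp
  have "gpt r p (1 - t) \<in> S2" using assms by (intro gpt_in_segment[OF S(3)]) auto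
  then obtain p' q' r' :: "real^2" where tri: "dist p' q' = d p q" "dist q' r' = d q r" "dist r' p' = d r p"
      "d (gpt p q t) (gpt r p (1 - t)) \<le> dist (p' + t *\<^sub>R (q' - p')) (r' + (1 - t) *\<^sub>R (p' - r'))"
    by (rule comparison[OF S, of "gpt p q t" t _ "1 - t", rotated 3])
       (use assms gpt[of p q t] gpt[of r p "1 - t"] gpt_in_segment[OF S(1)] in auto)
  have "(p' + t *\<^sub>R (q' - p')) - (r' + (1 - t) *\<^sub>R (p' - r')) = t *\<^sub>R (q' - r')"
    by (simp add: algebra_simps)
  then show ?thesis using tri r assms(4) by (simp add: dist_norm)
qed

text \<open>The quadrilateral is cut into two triangles along the diagonal from \<open>p\<close> to
  \<open>q'\<close>.\<close>

lemma gpt_convex: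
  assumes "p \<in> X" "q \<in> X" "p' \<in> X" "q' \<in> X" "t \<in> {0..1}"
  shows "d (gpt p q t) (gpt p' q' t) \<le> (1 - t) * d p p' + t * d q q'"
proof -
  have "d (gpt p q t) (gpt p q' t) \<le> t * d q q'" by (rule gpt_convex_right) (use assms in auto)
  moreover have "d (gpt p q' t) (gpt p' q' t) \<le> (1 - t) * d p p'"
    using gpt_convex_right[of q' p p' "1 - t"] gpt_commute[of p q' t] gpt_commute[of p' q' t] assms by auto
  moreover have "d (gpt p q t) (gpt p' q' t) \<le> d (gpt p q t) (gpt p q' t) + d (gpt p q' t) (gpt p' q' t)"
    by (rule triangle) (use assms gpt_in in auto)
  ultimately show ?thesis by linarith
qed

lemma dist_gpt_convex:
  assumes "p \<in> X" "q \<in> X" "z \<in> X" "t \<in> {0..1}"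
  shows "d (gpt p q t) z \<le> (1 - t) * d p z + t * d q z"
  using gpt_convex[of p q z z t] assms by simp

text \<open>The CN inequality is applied from \<open>y\<close> and from \<open>w\<close> to the
  midpoint of the diagonal from \<open>x\<close> to \<open>z\<close>. It is used in
  \<open>busemann_parallel_le\<close>, where squared distances to two rays are compared.\<close>

lemma quadrilateral_inequality:
  assumes "x \<in> X" "y \<in> X" "z \<in> X" "w \<in> X"
  shows "(d x z)\<^sup>2 + (d y w)\<^sup>2 \<le> (d x y)\<^sup>2 + (d y z)\<^sup>2 + (d z w)\<^sup>2 + (d w x)\<^sup>2"
proof -
  define m where "m = gpt x z (1/2)"
  have m: "m \<in> X" unfolding m_def using assms by (intro gpt_in) auto
  have "(d y m)\<^sup>2 \<le> 1/2 * (d y x)\<^sup>2 + 1/2 * (d y z)\<^sup>2 - 1/4 * (d x z)\<^sup>2"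
    using CN_inequality[of x z y "1/2"] assms by (simp add: m_def)
  moreover have "(d w m)\<^sup>2 \<le> 1/2 * (d w x)\<^sup>2 + 1/2 * (d w z)\<^sup>2 - 1/4 * (d x z)\<^sup>2"
    using CN_inequality[of x z w "1/2"] assms by (simp add: m_def)
  moreover have "(d y w)\<^sup>2 \<le> (d y m + d w m)\<^sup>2"
    by (intro power_mono) (use triangle[of y m w] assms m commute[of m w] in auto)
  moreover have "(d y m + d w m)\<^sup>2 \<le> 2 * (d y m)\<^sup>2 + 2 * (d w m)\<^sup>2"
    using zero_le_power2[of "d y m - d w m"] by (simp add: power2_eq_square algebra_simps)
  ultimately show ?thesis unfolding commute[of x y] commute[of z w] by linarith
qed

section \<open>Convex sets and nearest points\<close>

definition gconvex :: "'a set \<Rightarrow> bool" where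
  "gconvex C \<longleftrightarrow> C \<subseteq> X \<and> (\<forall>x\<in>C. \<forall>y\<in>C. \<forall>t\<in>{0..1}. gpt x y t \<in> C)"

lemma gconvexD: "gconvex C \<Longrightarrow> x \<in> C \<Longrightarrow> y \<in> C \<Longrightarrow> t \<in> {0..1} \<Longrightarrow> gpt x y t \<in> C"
  by (auto simp: gconvex_def)

lemma gconvex_space: "gconvex X"
  by (auto simp: gconvex_def gpt_in)

text \<open>Otherwise the midpoint of the two candidates would be strictly closer to
  \<open>x\<close>.\<close>

lemma nearest_point_unique:
  assumes C: "gconvex C" and x: "x \<in> X" and p: "p \<in> C" "\<And>c. c \<in> C \<Longrightarrow> d x p \<le> d x c"
    and q: "q \<in> C" "d x q \<le> d x p"
  shows "p = q"
proof -
  have X: "p \<in> X" "q \<in> X" using C p q by (auto simp: gconvex_def)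
  have m: "gpt p q (1/2) \<in> C" using gconvexD[OF C p(1) q(1)] by simp
  have "(d x p)\<^sup>2 \<le> (d x (gpt p q (1/2)))\<^sup>2" using p(2)[OF m] by (intro power_mono) auto
  moreover have "(d x (gpt p q (1/2)))\<^sup>2 \<le> 1/2 * (d x p)\<^sup>2 + 1/2 * (d x q)\<^sup>2 - 1/4 * (d p q)\<^sup>2"
    using CN_inequality[of p q x "1/2"] X x by simp
  moreover have "(d x q)\<^sup>2 \<le> (d x p)\<^sup>2" using q(2) by (intro power_mono) auto
  ultimately have "(d p q)\<^sup>2 \<le> 0" by linarith
  then show ?thesis using X by simp
qed

text \<open>Midpoints of members of a minimising sequence remain in \<open>C\<close>, so the CN
  inequality bounds the distance between late members by their excess over \<delta>. The sequence is
  therefore Cauchy, without any compactness.\<close>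

lemma nearest_point_exists:
  assumes complete: mcomplete and closed: "closedin mtopology C" and C: "gconvex C" "C \<noteq> {}" and x: "x \<in> X"
  obtains p where "p \<in> C" "\<And>c. c \<in> C \<Longrightarrow> d x p \<le> d x c"
proof -
  define \<delta> where "\<delta> = Inf (d x ` C)"
  have CX: "C \<subseteq> X" using C by (auto simp: gconvex_def)
  have bdd: "bdd_below (d x ` C)" by (rule bdd_belowI[of _ 0]) auto
  have \<delta>_le: "\<delta> \<le> d x c" if "c \<in> C" for c
    unfolding \<delta>_def by (rule cInf_lower) (use bdd that in auto)
  have \<delta>0: "0 \<le> \<delta>" unfolding \<delta>_def by (rule cInf_greatest) (use C in auto)
  have "\<exists>c\<in>C. d x c < \<delta> + 1 / real (Suc n)" for n
  proof (rule ccontr)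
    assume "\<not> ?thesis"
    then have "\<delta> + 1 / real (Suc n) \<le> \<delta>"
      unfolding \<delta>_def[symmetric] using C(2) by (subst (2) \<delta>_def) (intro cInf_greatest, auto)
    then show False by (simp add: divide_le_0_iff)
  qed
  then obtain s where s: "\<And>n. s n \<in> C" "\<And>n. d x (s n) < \<delta> + 1 / real (Suc n)" by metis
  have lim: "(\<lambda>n. d x (s n)) \<longlonglongrightarrow> \<delta>"
  proof (rule tendsto_sandwich[of "\<lambda>_. \<delta>" _ _ "\<lambda>n. \<delta> + 1 / real (Suc n)"])
    show "(\<lambda>n. \<delta> + 1 / real (Suc n)) \<longlonglongrightarrow> \<delta>"
      using tendsto_add[OF tendsto_const[of \<delta>] LIMSEQ_inverse_real_of_nat] by (simp add: inverse_eq_divide)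
  qed (use less_imp_le[OF s(2)] \<delta>_le[OF s(1)] in \<open>auto intro!: always_eventually\<close>)
  have close: "(d (s m) (s n))\<^sup>2 \<le> 2 * (d x (s m))\<^sup>2 + 2 * (d x (s n))\<^sup>2 - 4 * \<delta>\<^sup>2" for m n
  proof -
    have X: "s m \<in> X" "s n \<in> X" using s CX by auto
    have "gpt (s m) (s n) (1/2) \<in> C" using gconvexD[OF C(1) s(1) s(1)] by simp
    then have "\<delta>\<^sup>2 \<le> (d x (gpt (s m) (s n) (1/2)))\<^sup>2" using \<delta>_le \<delta>0 by (intro power_mono) auto
    also have "\<dots> \<le> 1/2 * (d x (s m))\<^sup>2 + 1/2 * (d x (s n))\<^sup>2 - 1/4 * (d (s m) (s n))\<^sup>2"
      using CN_inequality[of "s m" "s n" x "1/2"] X x by simp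
    finally show ?thesis by simp
  qed
  have "MCauchy s"
    unfolding MCauchy_def
  proof (intro conjI allI impI)
    show "range s \<subseteq> X" using s CX by auto
    fix e :: real assume e: "e > 0"
    have "(\<lambda>n. (d x (s n))\<^sup>2) \<longlonglongrightarrow> \<delta>\<^sup>2" by (intro tendsto_intros lim)
    then have "\<forall>\<^sub>F n in sequentially. (d x (s n))\<^sup>2 < \<delta>\<^sup>2 + e\<^sup>2 / 4"
      by (rule order_tendstoD) (use e in simp)
    then obtain N where N: "\<And>n. n \<ge> N \<Longrightarrow> (d x (s n))\<^sup>2 < \<delta>\<^sup>2 + e\<^sup>2 / 4"
      by (auto simp: eventually_sequentially)
    show "\<exists>N. \<forall>n n'. N \<le> n \<longrightarrow> N \<le> n' \<longrightarrow> d (s n) (s n') < e"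
    proof (intro exI[of _ N] allI impI)
      fix m n assume "N \<le> m" "N \<le> n"
      then have "(d (s m) (s n))\<^sup>2 < e\<^sup>2" using close[of m n] N[of m] N[of n] by simp
      then show "d (s m) (s n) < e" using e by (simp add: power2_less_imp_less)
    qed
  qed
  then obtain p where p: "limitin mtopology s p sequentially" using complete by (auto simp: mcomplete_def)
  have pC: "p \<in> C"
    by (rule limitin_closedin[OF p closed]) (use s(1) in simp_all)
  have "d x p \<le> \<delta>"
  proof (rule tendsto_lowerbound[of "\<lambda>n. d x (s n) + d (s n) p" _ sequentially])
    have "(\<lambda>n. d (s n) p) \<longlonglongrightarrow> 0" using p by (simp add: limitin_metric_dist_null)
    from tendsto_add[OF lim this] show "(\<lambda>n. d x (s n) + d (s n) p) \<longlonglongrightarrow> \<delta>" by simp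
    show "\<forall>\<^sub>F n in sequentially. d x p \<le> d x (s n) + d (s n) p"
    proof (intro always_eventually allI)
      fix n
      have "s n \<in> X" "p \<in> X" using s(1)[of n] pC CX by auto
      then show "d x p \<le> d x (s n) + d (s n) p" by (rule triangle[OF x])
    qed
  qed simp
  then have "d x p \<le> d x c" if "c \<in> C" for c using \<delta>_le[OF that] by linarith
  then show ?thesis by (rule that[OF pC])
qed

section \<open>Convex sets and dimension\<close>

definition cube_continuous :: "nat \<Rightarrow> ((nat \<Rightarrow> real) \<Rightarrow> 'a) \<Rightarrow> bool" where
  "cube_continuous n f \<longleftrightarrow> (\<forall>t\<in>UNIV \<rightarrow> {0..1}. f t \<in> X \<and>
     (\<forall>e>0. \<exists>\<delta>>0. \<forall>s\<in>UNIV \<rightarrow> {0..1}. (\<forall>i<n. \<bar>s i - t i\<bar> < \<delta>) \<longrightarrow> d (f s) (f t) < e))"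

lemma cube_continuous_in: "cube_continuous n f \<Longrightarrow> t \<in> UNIV \<rightarrow> {0..1} \<Longrightarrow> f t \<in> X"
  by (auto simp: cube_continuous_def)

lemma cube_continuousD:
  assumes "cube_continuous n f" "t \<in> UNIV \<rightarrow> {0..1}" "e > 0"
  shows "\<exists>\<delta>>0. \<forall>s\<in>UNIV \<rightarrow> {0..1}. (\<forall>i<n. \<bar>s i - t i\<bar> < \<delta>) \<longrightarrow> d (f s) (f t) < e"
  using mp[OF spec[OF conjunct2[OF bspec[OF assms(1)[unfolded cube_continuous_def] assms(2)]], of e] assms(3)] .

lemma cube_continuous_const: "x \<in> X \<Longrightarrow> cube_continuous n (\<lambda>_. x)"
  unfolding cube_continuous_def by (auto intro!: exI[of _ 1])

lemma cube_continuous_gpt: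
  assumes f: "cube_continuous n f" and g: "cube_continuous n g" and i: "i < n"
  shows "cube_continuous n (\<lambda>t. gpt (f t) (g t) (t i))"
  unfolding cube_continuous_def
proof (intro ballI conjI allI impI)
  fix t :: "nat \<Rightarrow> real" assume t: "t \<in> UNIV \<rightarrow> {0..1}"
  have ti: "t i \<in> {0..1}" by (rule funcset_mem[OF t]) simp
  note tX = cube_continuous_in[OF f t] cube_continuous_in[OF g t]
  show "gpt (f t) (g t) (t i) \<in> X" by (rule gpt_in[OF tX ti])
  fix e :: real assume e: "e > 0"
  then have e2: "e / 2 > 0" by simp
  obtain \<delta>1 where \<delta>1: "\<delta>1 > 0" "\<And>s. s \<in> UNIV \<rightarrow> {0..1} \<Longrightarrow> \<forall>i<n. \<bar>s i - t i\<bar> < \<delta>1 \<Longrightarrow> d (f s) (f t) < e / 2"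
    using cube_continuousD[OF f t e2] by (elim exE conjE) simp
  obtain \<delta>2 where \<delta>2: "\<delta>2 > 0" "\<And>s. s \<in> UNIV \<rightarrow> {0..1} \<Longrightarrow> \<forall>i<n. \<bar>s i - t i\<bar> < \<delta>2 \<Longrightarrow> d (g s) (g t) < e / 2"
    using cube_continuousD[OF g t e2] by (elim exE conjE) simp
  \<comment> \<open>One is added so that a degenerate geodesic causes no division by zero.\<close>
  define D where "D = d (f t) (g t) + 1"
  have D: "D > 0" "d (f t) (g t) \<le> D" unfolding D_def using nonneg[of "f t" "g t"] by linarith+
  show "\<exists>\<delta>>0. \<forall>s\<in>UNIV \<rightarrow> {0..1}. (\<forall>i<n. \<bar>s i - t i\<bar> < \<delta>) \<longrightarrow>
      d (gpt (f s) (g s) (s i)) (gpt (f t) (g t) (t i)) < e"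
  proof (intro exI[of _ "min (min \<delta>1 \<delta>2) (e / 2 / D)"] conjI ballI impI)
    show "0 < min (min \<delta>1 \<delta>2) (e / 2 / D)" using \<delta>1(1) \<delta>2(1) D(1) e by simp
    fix s :: "nat \<Rightarrow> real" assume s: "s \<in> UNIV \<rightarrow> {0..1}"
      and st: "\<forall>i<n. \<bar>s i - t i\<bar> < min (min \<delta>1 \<delta>2) (e / 2 / D)"
    have si: "s i \<in> {0..1}" by (rule funcset_mem[OF s]) simp
    note sX = cube_continuous_in[OF f s] cube_continuous_in[OF g s]
    have fs: "d (f s) (f t) < e / 2" by (rule \<delta>1(2)[OF s]) (use st in simp)
    have gs: "d (g s) (g t) < e / 2" by (rule \<delta>2(2)[OF s]) (use st in simp)
    have "d (gpt (f s) (g s) (s i)) (gpt (f t) (g t) (s i)) \<le> (1 - s i) * d (f s) (f t) + s i * d (g s) (g t)"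
      by (rule gpt_convex[OF sX tX si])
    also have "\<dots> \<le> (1 - s i) * (e / 2) + s i * (e / 2)"
      using fs gs si by (intro add_mono mult_left_mono) auto
    also have "\<dots> = e / 2" by (simp add: field_simps)
    finally have 1: "d (gpt (f s) (g s) (s i)) (gpt (f t) (g t) (s i)) \<le> e / 2" .
    have "d (gpt (f t) (g t) (s i)) (gpt (f t) (g t) (t i)) = \<bar>s i - t i\<bar> * d (f t) (g t)"
      by (rule dist_gpt_gpt[OF tX si ti])
    also have "\<dots> \<le> \<bar>s i - t i\<bar> * D" using D(2) by (intro mult_left_mono) auto
    also have "\<dots> < e / 2"
    proof (rule pos_less_divide_eq[OF D(1), THEN iffD1])
      show "\<bar>s i - t i\<bar> < e / 2 / D" using mp[OF spec[OF st, of i] i] by linarith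
    qed
    finally have 2: "d (gpt (f t) (g t) (s i)) (gpt (f t) (g t) (t i)) < e / 2" .
    show "d (gpt (f s) (g s) (s i)) (gpt (f t) (g t) (t i)) < e"
      using 1 2 triangle[OF gpt_in[OF sX si] gpt_in[OF tX si] gpt_in[OF tX ti]] by linarith
  qed
qed

lemma lebesgue_covering_cube:
  assumes dim: "covering_dim_le mtopology (int k)" and kn: "k < n"
    and opn: "\<And>j. j \<le> n \<Longrightarrow> openin mtopology (U j)" and cov: "X \<subseteq> (\<Union>j\<le>n. U j)"
    and f: "cube_continuous n f"
    and face0: "\<And>t i. t \<in> UNIV \<rightarrow> {0..1} \<Longrightarrow> i < n \<Longrightarrow> t i = 0 \<Longrightarrow> f t \<notin> U i"
    and face1: "\<And>t i j. t \<in> UNIV \<rightarrow> {0..1} \<Longrightarrow> i < n \<Longrightarrow> t i = 1 \<Longrightarrow> i < j \<Longrightarrow> j \<le> n \<Longrightarrow> f t \<notin> U j"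
  shows False
proof (rule lebesgue_covering[OF dim kn opn cov])
  show "f t \<in> X" if "t \<in> UNIV \<rightarrow> {0..1}" for t by (rule cube_continuous_in[OF f that])
  show "\<exists>\<delta>>0. \<forall>s\<in>UNIV \<rightarrow> {0..1}. (\<forall>i<n. \<bar>s i - t i\<bar> < \<delta>) \<longrightarrow> d (f s) (f t) < e"
    if "t \<in> UNIV \<rightarrow> {0..1}" "e > 0" for t e
    by (rule cube_continuousD[OF f that])
qed (assumption | rule face0 face1 | assumption)+

text \<open>A cube parametrisation of the geodesic simplex with vertices
  \<open>p i, ..., p (i + m)\<close>: the coordinate \<open>t i\<close> moves from the cone over the
  later vertices, at 0, to the apex \<open>p i\<close>, at 1.\<close>

primrec iterated_cone :: "(nat \<Rightarrow> 'a) \<Rightarrow> nat \<Rightarrow> nat \<Rightarrow> (nat \<Rightarrow> real) \<Rightarrow> 'a" where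
  "iterated_cone p 0 i t = p i"
| "iterated_cone p (Suc m) i t = gpt (iterated_cone p m (Suc i) t) (p i) (t i)"

lemma iterated_cone_continuous:
  assumes "\<And>j. p j \<in> X"
  shows "i + m \<le> n \<Longrightarrow> cube_continuous n (iterated_cone p m i)"
proof (induction m arbitrary: i)
  case 0
  have "iterated_cone p 0 i = (\<lambda>_. p i)" by (rule ext) simp
  then show ?case using cube_continuous_const[OF assms] by simp
next
  case (Suc m)
  have "iterated_cone p (Suc m) i = (\<lambda>t. gpt (iterated_cone p m (Suc i) t) (p i) (t i))"
    by (rule ext) simp
  then show ?case
    using cube_continuous_gpt[OF Suc.IH[of "Suc i"] cube_continuous_const[OF assms, of _ i], of i] Suc.prems by simp
qed

lemma iterated_cone_convex:
  assumes "gconvex C" "t \<in> UNIV \<rightarrow> {0..1}"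
  shows "(\<And>j. i \<le> j \<Longrightarrow> j \<le> i + m \<Longrightarrow> p j \<in> C) \<Longrightarrow> iterated_cone p m i t \<in> C"
proof (induction m arbitrary: i)
  case (Suc m)
  have "t i \<in> {0..1}" by (rule funcset_mem[OF assms(2)]) simp
  then show ?case by (simp only: iterated_cone.simps, intro gconvexD[OF assms(1)] Suc) auto
qed simp

text \<open>Coordinate 0 discards the vertex \<open>p l\<close>, the only one not known to lie in
  \<open>C\<close>.\<close>

lemma iterated_cone_0:
  assumes C: "gconvex C" and t: "t \<in> UNIV \<rightarrow> {0..1}" "t l = 0" and p: "\<And>j. p j \<in> X"
  shows "i \<le> l \<Longrightarrow> l < i + m \<Longrightarrow> (\<And>j. i \<le> j \<Longrightarrow> j \<le> i + m \<Longrightarrow> j \<noteq> l \<Longrightarrow> p j \<in> C) \<Longrightarrow>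
    iterated_cone p m i t \<in> C"
proof (induction m arbitrary: i)
  case (Suc m)
  have ti: "t i \<in> {0..1}" by (rule funcset_mem[OF t(1)]) simp
  show ?case
  proof (cases "l = i")
    case True
    have *: "iterated_cone p m (Suc i) t \<in> C"
      by (rule iterated_cone_convex[OF C t(1)]) (use Suc.prems True in auto)
    then have "iterated_cone p m (Suc i) t \<in> X" using C by (auto simp: gconvex_def)
    then show ?thesis using * p True t(2) by simp
  next
    case False
    have "iterated_cone p m (Suc i) t \<in> C" by (rule Suc.IH) (use Suc.prems False in auto)
    moreover have "p i \<in> C" by (rule Suc.prems) (use False in auto)
    ultimately show ?thesis using gconvexD[OF C _ _ ti] by simp
  qed
qed simp

text \<open>Coordinate 1 collapses the inner cone to \<open>p l\<close>, so only the vertices up to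
  \<open>l\<close> matter.\<close>

lemma iterated_cone_1:
  assumes C: "gconvex C" and t: "t \<in> UNIV \<rightarrow> {0..1}" "t l = 1" and p: "\<And>j. p j \<in> X"
  shows "i \<le> l \<Longrightarrow> l < i + m \<Longrightarrow> (\<And>j. i \<le> j \<Longrightarrow> j \<le> l \<Longrightarrow> p j \<in> C) \<Longrightarrow> iterated_cone p m i t \<in> C"
proof (induction m arbitrary: i)
  case (Suc m)
  have ti: "t i \<in> {0..1}" by (rule funcset_mem[OF t(1)]) simp
  have pi: "p i \<in> C" by (rule Suc.prems) (use Suc.prems in auto)
  show ?case
  proof (cases "l = i")
    case True
    have "iterated_cone p m (Suc i) t \<in> X"
      by (rule iterated_cone_convex[OF gconvex_space t(1) p])
    then show ?thesis using pi p True t(2) by simp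
  next
    case False
    have "iterated_cone p m (Suc i) t \<in> C" by (rule Suc.IH) (use Suc.prems False in auto)
    then show ?thesis using gconvexD[OF C _ pi ti] by simp
  qed
qed simp

text \<open>If the sets had no common point, their complements would cover \<open>X\<close>. The
  point \<open>p l\<close> lies in every set but \<open>C l\<close>. The simplex on these points,
  seen as a cube, has its face \<open>t i = 0\<close> in \<open>C i\<close> and its face
  \<open>t i = 1\<close> in every \<open>C j\<close> with \<open>j > i\<close>, which contradicts
  the covering theorem.\<close>

lemma helly_step:
  assumes dim: "covering_dim_le mtopology (int k)" and kn: "k < n"
    and closed: "\<And>j. j \<le> n \<Longrightarrow> closedin mtopology (C j)"
    and convex: "\<And>j. j \<le> n \<Longrightarrow> gconvex (C j)"
    and inter: "\<And>l. l \<le> n \<Longrightarrow> \<exists>x\<in>X. \<forall>j\<le>n. j \<noteq> l \<longrightarrow> x \<in> C j"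
  shows "\<exists>x\<in>X. \<forall>j\<le>n. x \<in> C j"
proof (rule ccontr)
  assume no: "\<not> ?thesis"
  obtain x0 where x0: "x0 \<in> X" using nonempty by blast
  have "\<exists>x\<in>X. l \<le> n \<longrightarrow> (\<forall>j\<le>n. j \<noteq> l \<longrightarrow> x \<in> C j)" for l
    using inter[of l] x0 by (cases "l \<le> n") auto
  then have "\<forall>l. \<exists>x. x \<in> X \<and> (l \<le> n \<longrightarrow> (\<forall>j\<le>n. j \<noteq> l \<longrightarrow> x \<in> C j))" by blast
  from choice[OF this] obtain p where p: "\<And>l. p l \<in> X" "\<And>l j. l \<le> n \<Longrightarrow> j \<le> n \<Longrightarrow> j \<noteq> l \<Longrightarrow> p l \<in> C j"
    by blast
  show False
  proof (rule lebesgue_covering_cube[OF dim kn, where U = "\<lambda>j. X - C j" and f = "iterated_cone p n 0"])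
    show "openin mtopology (X - C j)" if "j \<le> n" for j
      using closed[OF that] by (simp add: openin_diff)
    show "X \<subseteq> (\<Union>j\<le>n. X - C j)" using no by blast
    show "cube_continuous n (iterated_cone p n 0)"
      by (rule iterated_cone_continuous[OF p(1)]) simp
    fix t :: "nat \<Rightarrow> real" and i assume t: "t \<in> UNIV \<rightarrow> {0..1}" "i < n"
    show "iterated_cone p n 0 t \<notin> X - C i" if "t i = 0"
    proof -
      have "iterated_cone p n 0 t \<in> C i"
        by (rule iterated_cone_0[OF convex t(1) that p(1)]) (use t(2) p(2) in auto)
      then show ?thesis by simp
    qed
    show "iterated_cone p n 0 t \<notin> X - C j" if "t i = 1" "i < j" "j \<le> n" for j
    proof -
      have "iterated_cone p n 0 t \<in> C j"
        by (rule iterated_cone_1[OF convex[OF that(3)] t(1) that(1) p(1)]) (use t(2) that p(2) in auto)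
      then show ?thesis by simp
    qed
  qed
qed

text \<open>Induction on the index set: deleting one index leaves a family with a common point, so
  \<open>helly_step\<close> applies as long as there are more than \<open>k + 1\<close>
  sets.\<close>

theorem helly:
  assumes dim: "covering_dim_le mtopology (int k)" and fin: "finite I"
    and closed: "\<And>i. i \<in> I \<Longrightarrow> closedin mtopology (C i)"
    and convex: "\<And>i. i \<in> I \<Longrightarrow> gconvex (C i)"
    and inter: "\<And>J. J \<subseteq> I \<Longrightarrow> card J \<le> Suc k \<Longrightarrow> \<exists>x\<in>X. \<forall>i\<in>J. x \<in> C i"
  shows "\<exists>x\<in>X. \<forall>i\<in>I. x \<in> C i"
  using fin closed convex inter
proof (induction I rule: finite_psubset_induct)
  case (psubset I)
  show ?case
  proof (cases "card I \<le> Suc k")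
    case True
    then show ?thesis using psubset.prems(3)[of I] by simp
  next
    case False
    then obtain n where n: "card I = Suc n" "k < n" by (cases "card I") auto
    from ex_bij_betw_nat_finite[OF psubset.hyps(1)] obtain h where h: "bij_betw h {0..<card I} I" by blast
    then have h: "bij_betw h {..n} I" by (simp add: n(1) lessThan_Suc_atMost atLeast0LessThan)
    have hI: "h j \<in> I" if "j \<le> n" for j using bij_betwE[OF h] that by simp
    have "\<exists>x\<in>X. \<forall>j\<le>n. x \<in> C (h j)"
    proof (rule helly_step[OF dim n(2)])
      fix l assume l: "l \<le> n"
      have "\<exists>x\<in>X. \<forall>i\<in>I - {h l}. x \<in> C i"
      proof (rule psubset.IH)
        show "I - {h l} \<subset> I" using hI[OF l] by auto
        show "\<exists>x\<in>X. \<forall>i\<in>J. x \<in> C i" if "J \<subseteq> I - {h l}" "card J \<le> Suc k" for J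
          by (rule psubset.prems(3)) (use that in auto)
      qed (use psubset.prems in auto)
      then obtain x where x: "x \<in> X" "\<forall>i\<in>I - {h l}. x \<in> C i" by blast
      have "x \<in> C (h j)" if "j \<le> n" "j \<noteq> l" for j
      proof -
        have "h j \<noteq> h l" using bij_betw_imp_inj_on[OF h] that l by (auto dest: inj_onD)
        then show ?thesis using x(2) hI[OF that(1)] by simp
      qed
      then show "\<exists>x\<in>X. \<forall>j\<le>n. j \<noteq> l \<longrightarrow> x \<in> C (h j)" using x(1) by blast
    qed (use psubset.prems hI in auto)
    then show ?thesis using bij_betw_imp_surj_on[OF h] by (metis atMost_iff imageE)
  qed
qed

text \<open>The corner with coordinates 1 exactly on \<open>A\<close> is sent to \<open>P A\<close>;
  the cube between the corners is filled by interpolating one coordinate at a time.\<close>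

primrec multi_geodesic :: "nat \<Rightarrow> (nat set \<Rightarrow> 'a) \<Rightarrow> (nat \<Rightarrow> real) \<Rightarrow> 'a" where
  "multi_geodesic 0 P t = P {}"
| "multi_geodesic (Suc m) P t = gpt (multi_geodesic m P t) (multi_geodesic m (\<lambda>A. P (insert m A)) t) (t m)"

lemma multi_geodesic_continuous:
  "(\<And>A. P A \<in> X) \<Longrightarrow> m \<le> n \<Longrightarrow> cube_continuous n (multi_geodesic m P)"
proof (induction m arbitrary: P)
  case 0
  have "multi_geodesic 0 P = (\<lambda>_. P {})" by (rule ext) simp
  then show ?case using cube_continuous_const[OF 0(1)] by simp
next
  case (Suc m)
  have "multi_geodesic (Suc m) P =
      (\<lambda>t. gpt (multi_geodesic m P t) (multi_geodesic m (\<lambda>A. P (insert m A)) t) (t m))"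
    by (rule ext) simp
  then show ?case
    using cube_continuous_gpt[OF Suc.IH[of P] Suc.IH[of "\<lambda>A. P (insert m A)"], of m] Suc.prems by simp
qed

lemma multi_geodesic_convex:
  assumes C: "gconvex C" and t: "t \<in> UNIV \<rightarrow> {0..1}"
  shows "(\<And>A. A \<subseteq> {..<m} \<Longrightarrow> P A \<in> C) \<Longrightarrow> multi_geodesic m P t \<in> C"
proof (induction m arbitrary: P)
  case (Suc m)
  have "t m \<in> {0..1}" by (rule funcset_mem[OF t]) simp
  moreover have "multi_geodesic m P t \<in> C" by (rule Suc.IH) (rule Suc.prems, auto)
  moreover have "multi_geodesic m (\<lambda>A. P (insert m A)) t \<in> C" by (rule Suc.IH) (rule Suc.prems, auto)
  ultimately show ?case using gconvexD[OF C] by simp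
qed simp

lemma multi_geodesic_0:
  assumes C: "gconvex C" and t: "t \<in> UNIV \<rightarrow> {0..1}" "t i = 0"
  shows "i < m \<Longrightarrow> (\<And>A. P A \<in> X) \<Longrightarrow> (\<And>A. A \<subseteq> {..<m} \<Longrightarrow> i \<notin> A \<Longrightarrow> P A \<in> C) \<Longrightarrow> multi_geodesic m P t \<in> C"
proof (induction m arbitrary: P)
  case (Suc m)
  have tm: "t m \<in> {0..1}" by (rule funcset_mem[OF t(1)]) simp
  show ?case
  proof (cases "i = m")
    case True
    have *: "multi_geodesic m P t \<in> C"
      by (rule multi_geodesic_convex[OF C t(1)]) (rule Suc.prems, use True in auto)
    have "multi_geodesic m P t \<in> X" "multi_geodesic m (\<lambda>A. P (insert m A)) t \<in> X"
      by (rule multi_geodesic_convex[OF gconvex_space t(1) Suc.prems(2)])+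
    then show ?thesis using * True t(2) by simp
  next
    case False
    have "multi_geodesic m P t \<in> C"
      by (rule Suc.IH) (use Suc.prems(1,2) False in \<open>simp_all\<close>, rule Suc.prems, auto)
    moreover have "multi_geodesic m (\<lambda>A. P (insert m A)) t \<in> C"
      by (rule Suc.IH) (use Suc.prems(1,2) False in \<open>simp_all\<close>, rule Suc.prems, auto)
    ultimately show ?thesis using gconvexD[OF C _ _ tm] by simp
  qed
qed simp

lemma multi_geodesic_1:
  assumes C: "gconvex C" and t: "t \<in> UNIV \<rightarrow> {0..1}" "t i = 1"
  shows "i < m \<Longrightarrow> (\<And>A. P A \<in> X) \<Longrightarrow> (\<And>A. A \<subseteq> {..<m} \<Longrightarrow> i \<in> A \<Longrightarrow> P A \<in> C) \<Longrightarrow> multi_geodesic m P t \<in> C"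
proof (induction m arbitrary: P)
  case (Suc m)
  have tm: "t m \<in> {0..1}" by (rule funcset_mem[OF t(1)]) simp
  show ?case
  proof (cases "i = m")
    case True
    have *: "multi_geodesic m (\<lambda>A. P (insert m A)) t \<in> C"
      by (rule multi_geodesic_convex[OF C t(1)]) (rule Suc.prems, use True in auto)
    have "multi_geodesic m P t \<in> X" "multi_geodesic m (\<lambda>A. P (insert m A)) t \<in> X"
      by (rule multi_geodesic_convex[OF gconvex_space t(1) Suc.prems(2)])+
    then show ?thesis using * True t(2) by simp
  next
    case False
    have "multi_geodesic m P t \<in> C"
      by (rule Suc.IH) (use Suc.prems(1,2) False in \<open>simp_all\<close>, rule Suc.prems, auto)
    moreover have "multi_geodesic m (\<lambda>A. P (insert m A)) t \<in> C"
      by (rule Suc.IH) (use Suc.prems(1,2) False in \<open>simp_all\<close>, rule Suc.prems, auto)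
    ultimately show ?thesis using gconvexD[OF C _ _ tm] by simp
  qed
qed simp

text \<open>The corner \<open>A\<close> of a cube is sent to a point of all sets chosen by
  \<open>A\<close>, so by convexity the opposite facets \<open>t i = 0\<close> and
  \<open>t i = 1\<close> land in \<open>C i\<close> and \<open>D i\<close>. Lebesgue's theorem
  forbids such a cube of dimension greater than \<open>k\<close> if all pairs are disjoint.\<close>

theorem disjoint_pairs:
  assumes dim: "covering_dim_le mtopology (int k)" and kn: "k < n"
    and closed: "\<And>i. i < n \<Longrightarrow> closedin mtopology (C i) \<and> closedin mtopology (D i)"
    and convex: "\<And>i. i < n \<Longrightarrow> gconvex (C i) \<and> gconvex (D i)"
    and disj: "\<And>i. i < n \<Longrightarrow> C i \<inter> D i = {}"
    and inter: "\<And>A. \<exists>x\<in>X. \<forall>i<n. x \<in> (if i \<in> A then D i else C i)"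
  shows False
proof -
  have "\<forall>A. \<exists>x. x \<in> X \<and> (\<forall>i<n. x \<in> (if i \<in> A then D i else C i))" using inter by blast
  from choice[OF this] obtain P where P: "\<And>A. P A \<in> X"
      "\<And>A i. i < n \<Longrightarrow> P A \<in> (if i \<in> A then D i else C i)" by blast
  \<comment> \<open>The complement of \<open>F j\<close> has to miss the facet
    \<open>t j = 0\<close> and all facets \<open>t i = 1\<close> with \<open>i < j\<close>; for
    \<open>j = n\<close> there is no \<open>C\<close>. The complements cover: a point avoids
    \<open>F j\<close> for the least \<open>j\<close> such that it lies in \<open>D j\<close>, by
    disjointness, and it avoids \<open>F n\<close> if there is no such \<open>j\<close>.\<close>
  define F where "F j = (if j < n then C j else {}) \<union> (\<Union>i<j. D i)" for j
  show False
  proof (rule lebesgue_covering_cube[OF dim kn, where U = "\<lambda>j. X - F j" and f = "multi_geodesic n P"])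
    fix j assume "j \<le> n"
    then have "closedin mtopology (F j)"
      unfolding F_def using closed by (intro closedin_Un closedin_Union) auto
    then show "openin mtopology (X - F j)" by (simp add: openin_diff)
  next
    show "X \<subseteq> (\<Union>j\<le>n. X - F j)"
    proof
      fix x assume x: "x \<in> X"
      show "x \<in> (\<Union>j\<le>n. X - F j)"
      proof (cases "\<exists>i<n. x \<in> D i")
        case True
        define j where "j = (LEAST i. i < n \<and> x \<in> D i)"
        have j: "j < n" "x \<in> D j" using LeastI_ex[OF True] unfolding j_def by auto
        have "x \<notin> D i" if "i < j" for i
          using not_less_Least[of i "\<lambda>i. i < n \<and> x \<in> D i"] that j(1) unfolding j_def[symmetric] by auto
        moreover have "x \<notin> C j" using j disj[of j] by blast
        ultimately have "x \<notin> F j" by (auto simp: F_def)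
        then show ?thesis using x j(1) by (intro UN_I[of j]) auto
      next
        case False
        then have "x \<notin> F n" by (auto simp: F_def)
        then show ?thesis using x by (intro UN_I[of n]) auto
      qed
    qed
    show "cube_continuous n (multi_geodesic n P)"
      by (rule multi_geodesic_continuous[OF P(1)]) simp
    fix t :: "nat \<Rightarrow> real" and i assume t: "t \<in> UNIV \<rightarrow> {0..1}" "i < n"
    show "multi_geodesic n P t \<notin> X - F i" if "t i = 0"
    proof -
      have "multi_geodesic n P t \<in> C i"
        by (rule multi_geodesic_0[OF _ t(1) that t(2) P(1)]) (use convex[OF t(2)] in simp, use P(2)[OF t(2)] in presburger)
      then show ?thesis using t(2) by (simp add: F_def)
    qed
    show "multi_geodesic n P t \<notin> X - F j" if "t i = 1" "i < j" "j \<le> n" for j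
    proof -
      have "multi_geodesic n P t \<in> D i"
        by (rule multi_geodesic_1[OF _ t(1) that(1) t(2) P(1)]) (use convex[OF t(2)] in simp, use P(2)[OF t(2)] in presburger)
      then show ?thesis using that(2) by (auto simp: F_def)
    qed
  qed
qed

end

section \<open>Busemann functions\<close>

lemma (in Metric_space) closedin_lipschitz_sublevel:
  assumes L: "0 \<le> L" and f: "\<And>x y. x \<in> M \<Longrightarrow> y \<in> M \<Longrightarrow> f x \<le> f y + L * d x y"
  shows "closedin mtopology {x\<in>M. f x \<le> (c::real)}"
  unfolding closedin_metric
proof (intro conjI allI impI)
  fix x assume x: "x \<in> M - {x\<in>M. f x \<le> c}"
  \<comment> \<open>With \<open>L + 1\<close> in place of \<open>L\<close> the division is safe, and
    the ball of radius \<open>r\<close> still stays above the level \<open>c\<close>.\<close>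
  define r where "r = (f x - c) / (L + 1)"
  have "(L + 1) * r = f x - c" using L by (simp add: r_def)
  then have r2: "L * r + r = f x - c" by (simp only: distrib_right mult_1)
  have r1: "r > 0" using x L by (auto simp: r_def)
  have "disjnt {x\<in>M. f x \<le> c} (mball x r)"
    unfolding disjnt_iff
  proof (intro allI notI, elim conjE)
    fix y assume y: "y \<in> {x\<in>M. f x \<le> c}" "y \<in> mball x r"
    have "f x \<le> f y + L * d x y" using f[of x y] x y by simp
    also have "\<dots> \<le> c + L * r" using y L by (intro add_mono mult_left_mono) auto
    finally show False using r1 r2 by linarith
  qed
  with r1 show "\<exists>r>0. disjnt {x\<in>M. f x \<le> c} (mball x r)" by blast
qed auto

context CAT0_space
begin

text \<open>A geodesic ray known only at points of spacing \<open>L\<close>. The orbit of a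
  hyperbolic element provides such points directly, and no axis has to be constructed.\<close>

definition is_ray :: "real \<Rightarrow> (nat \<Rightarrow> 'a) \<Rightarrow> bool" where
  "is_ray L r \<longleftrightarrow> 0 < L \<and> (\<forall>m. r m \<in> X) \<and> (\<forall>m n. d (r m) (r (m + n)) = real n * L)"

definition busemann :: "real \<Rightarrow> (nat \<Rightarrow> 'a) \<Rightarrow> 'a \<Rightarrow> real" where
  "busemann L r y = lim (\<lambda>m. d y (r m) - real m * L)"

text \<open>The sequence decreases and is bounded below, both by the triangle inequality.\<close>

lemma busemann_limit:
  assumes r: "is_ray L r" and y: "y \<in> X"
  shows "(\<lambda>m. d y (r m) - real m * L) \<longlonglongrightarrow> busemann L r y"
proof -
  have rX: "r m \<in> X" for m using r by (simp add: is_ray_def)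
  have dr: "d (r m) (r (m + n)) = real n * L" for m n using r by (simp add: is_ray_def)
  have "decseq (\<lambda>m. d y (r m) - real m * L)"
  proof (rule decseq_SucI)
    fix m
    have "d y (r (Suc m)) \<le> d y (r m) + d (r m) (r (Suc m))" by (rule triangle) (auto simp: y rX)
    then show "d y (r (Suc m)) - real (Suc m) * L \<le> d y (r m) - real m * L"
      using dr[of m 1] by (simp add: algebra_simps)
  qed
  moreover have "- d (r 0) y \<le> d y (r m) - real m * L" for m
    using triangle[of "r 0" y "r m"] y rX dr[of 0 m] by simp
  ultimately obtain l where "(\<lambda>m. d y (r m) - real m * L) \<longlonglongrightarrow> l"
    using decseq_convergent[of "\<lambda>m. d y (r m) - real m * L" "- d (r 0) y"] by blast
  then show ?thesis unfolding busemann_def by (simp add: limI)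
qed

lemma busemann_lipschitz:
  assumes r: "is_ray L r" and y: "y \<in> X" and z: "z \<in> X"
  shows "busemann L r y \<le> busemann L r z + d y z"
proof (rule tendsto_le[OF sequentially_bot])
  show "(\<lambda>m. d y (r m) - real m * L) \<longlonglongrightarrow> busemann L r y" by (rule busemann_limit[OF r y])
  show "(\<lambda>m. d z (r m) - real m * L + d y z) \<longlonglongrightarrow> busemann L r z + d y z"
    by (intro tendsto_add tendsto_const busemann_limit[OF r z])
  have "d y (r m) \<le> d y z + d z (r m)" for m
    by (rule triangle) (use r y z in \<open>auto simp: is_ray_def\<close>)
  then show "\<forall>\<^sub>F m in sequentially. d y (r m) - real m * L \<le> d z (r m) - real m * L + d y z"
    by (intro always_eventually allI) (simp add: algebra_simps)
qed

lemma busemann_convex: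
  assumes r: "is_ray L r" and y: "y \<in> X" and z: "z \<in> X" and t: "t \<in> {0..1}"
  shows "busemann L r (gpt y z t) \<le> (1 - t) * busemann L r y + t * busemann L r z"
proof (rule tendsto_le[OF sequentially_bot])
  show "(\<lambda>m. d (gpt y z t) (r m) - real m * L) \<longlonglongrightarrow> busemann L r (gpt y z t)"
    by (rule busemann_limit[OF r gpt_in[OF y z t]])
  show "(\<lambda>m. (1 - t) * (d y (r m) - real m * L) + t * (d z (r m) - real m * L)) \<longlonglongrightarrow>
      (1 - t) * busemann L r y + t * busemann L r z"
    by (intro tendsto_add tendsto_mult tendsto_const busemann_limit[OF r] y z)
  have "d (gpt y z t) (r m) \<le> (1 - t) * d y (r m) + t * d z (r m)" for m
    by (rule dist_gpt_convex) (use r y z t in \<open>auto simp: is_ray_def\<close>)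
  then show "\<forall>\<^sub>F m in sequentially. d (gpt y z t) (r m) - real m * L \<le>
      (1 - t) * (d y (r m) - real m * L) + t * (d z (r m) - real m * L)"
    by (intro always_eventually allI) (simp add: algebra_simps)
qed

text \<open>The two rays are the halves of one line, and the path through \<open>y\<close> is no
  shorter than the line. Hence horoballs of negative level at the two ends are disjoint.\<close>

lemma busemann_opposite:
  assumes r: "is_ray L r" and r': "is_ray L r'" and opp: "\<And>m. d (r m) (r' m) = 2 * real m * L" and y: "y \<in> X"
  shows "0 \<le> busemann L r y + busemann L r' y"
proof (rule tendsto_lowerbound[OF _ _ sequentially_bot])
  show "(\<lambda>m. (d y (r m) - real m * L) + (d y (r' m) - real m * L)) \<longlonglongrightarrow> busemann L r y + busemann L r' y"
    by (intro tendsto_add busemann_limit r r' y)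
  have "2 * real m * L \<le> d y (r m) + d y (r' m)" for m
    using triangle''[of "r m" y "r' m"] r r' y opp[of m] by (simp add: is_ray_def)
  then show "\<forall>\<^sub>F m in sequentially. 0 \<le> (d y (r m) - real m * L) + (d y (r' m) - real m * L)"
    by (intro always_eventually allI) (simp add: algebra_simps)
qed

lemma dist_ray_over_n:
  assumes r: "is_ray L r" and y: "y \<in> X"
  shows "(\<lambda>m. d y (r m) / real m) \<longlonglongrightarrow> L"
proof -
  have "(\<lambda>m. (d y (r m) - real m * L) * (1 / real m) + L) \<longlonglongrightarrow> busemann L r y * 0 + L"
    by (intro tendsto_add tendsto_mult busemann_limit[OF r y] tendsto_const lim_1_over_n)
  moreover have "\<forall>\<^sub>F m in sequentially. (d y (r m) - real m * L) * (1 / real m) + L = d y (r m) / real m"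
    using eventually_gt_at_top[of 0] by eventually_elim (simp add: field_simps)
  ultimately show ?thesis by (simp add: tendsto_cong)
qed

text \<open>The quadrilateral inequality compares two differences of squares up to a constant
  \<open>K\<close>. Writing each as difference times sum and dividing by \<open>m\<close> turns the
  sums into \<open>L + L\<close> and makes \<open>K\<close> disappear in the limit.\<close>

lemma busemann_parallel_le:
  assumes r: "is_ray L r" and r': "is_ray L r'" and par: "\<And>m. d (r m) (r' m) \<le> D" and y: "y \<in> X" and z: "z \<in> X"
  shows "busemann L r y - busemann L r z \<le> busemann L r' y - busemann L r' z"
proof -
  let ?a = "\<lambda>m. d y (r m)" and ?e = "\<lambda>m. d z (r m)" and ?c = "\<lambda>m. d y (r' m)" and ?f = "\<lambda>m. d z (r' m)"
  have L: "0 < L" using r by (simp add: is_ray_def)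
  have diff: "(\<lambda>m. d y (q m) - d z (q m)) \<longlonglongrightarrow> busemann L q y - busemann L q z" if q: "is_ray L q" for q
    using tendsto_diff[OF busemann_limit[OF q y] busemann_limit[OF q z]] by simp
  have sum: "(\<lambda>m. d y (q m) / real m + d z (q m) / real m) \<longlonglongrightarrow> L + L" if q: "is_ray L q" for q
    by (intro tendsto_add dist_ray_over_n[OF q] y z)
  define K where "K = (d y z)\<^sup>2 + D\<^sup>2"
  have quad: "(?a m)\<^sup>2 + (?f m)\<^sup>2 \<le> (?e m)\<^sup>2 + (?c m)\<^sup>2 + K" for m
  proof -
    have "(d y (r m))\<^sup>2 + (d z (r' m))\<^sup>2 \<le> (d y z)\<^sup>2 + (d z (r m))\<^sup>2 + (d (r m) (r' m))\<^sup>2 + (d (r' m) y)\<^sup>2"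
      by (rule quadrilateral_inequality) (use r r' y z in \<open>auto simp: is_ray_def\<close>)
    moreover have "(d (r m) (r' m))\<^sup>2 \<le> D\<^sup>2" by (intro power_mono par) simp
    ultimately show ?thesis unfolding K_def by (simp add: commute[of "r' m" y])
  qed
  have "(busemann L r y - busemann L r z) * (L + L) \<le> (busemann L r' y - busemann L r' z) * (L + L) + K * 0"
  proof (rule tendsto_le[OF sequentially_bot])
    show "(\<lambda>m. (?a m - ?e m) * (?a m / real m + ?e m / real m)) \<longlonglongrightarrow> (busemann L r y - busemann L r z) * (L + L)"
      by (intro tendsto_mult diff[OF r] sum[OF r])
    show "(\<lambda>m. (?c m - ?f m) * (?c m / real m + ?f m / real m) + K * (1 / real m)) \<longlonglongrightarrow>
        (busemann L r' y - busemann L r' z) * (L + L) + K * 0"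
      by (intro tendsto_add tendsto_mult diff[OF r'] sum[OF r'] tendsto_const lim_1_over_n)
    show "\<forall>\<^sub>F m in sequentially. (?a m - ?e m) * (?a m / real m + ?e m / real m)
        \<le> (?c m - ?f m) * (?c m / real m + ?f m / real m) + K * (1 / real m)"
    proof (intro always_eventually allI)
      fix m
      have "(?a m - ?e m) * (?a m / real m + ?e m / real m) = ((?a m)\<^sup>2 - (?e m)\<^sup>2) / real m"
        by (simp add: add_divide_distrib[symmetric] power2_eq_square algebra_simps)
      also have "\<dots> \<le> ((?c m)\<^sup>2 - (?f m)\<^sup>2 + K) / real m"
        using quad[of m] by (intro divide_right_mono) auto
      also have "\<dots> = (?c m - ?f m) * (?c m / real m + ?f m / real m) + K * (1 / real m)"
        by (simp add: add_divide_distrib[symmetric] power2_eq_square algebra_simps)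
      finally show "(?a m - ?e m) * (?a m / real m + ?e m / real m)
        \<le> (?c m - ?f m) * (?c m / real m + ?f m / real m) + K * (1 / real m)" .
    qed
  qed
  then show ?thesis using L by simp
qed

lemma busemann_parallel:
  assumes r: "is_ray L r" and r': "is_ray L r'" and par: "\<And>m. d (r m) (r' m) \<le> D" and y: "y \<in> X" and z: "z \<in> X"
  shows "busemann L r y - busemann L r z = busemann L r' y - busemann L r' z"
  using busemann_parallel_le[OF r r' par y z] busemann_parallel_le[OF r' r _ y z, of D] par commute by (metis order_antisym)

lemma gconvex_sublevel:
  assumes f: "\<And>x y t. x \<in> X \<Longrightarrow> y \<in> X \<Longrightarrow> t \<in> {0..1} \<Longrightarrow> f (gpt x y t) \<le> (1 - t) * f x + t * f y"
  shows "gconvex {x\<in>X. f x \<le> (c::real)}"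
  unfolding gconvex_def
proof (intro conjI ballI)
  fix x y and t :: real assume x: "x \<in> {x\<in>X. f x \<le> c}" and y: "y \<in> {x\<in>X. f x \<le> c}" and t: "t \<in> {0..1}"
  have "f (gpt x y t) \<le> (1 - t) * f x + t * f y" by (rule f) (use x y t in auto)
  also have "\<dots> \<le> (1 - t) * c + t * c" using x y t by (intro add_mono mult_left_mono) auto
  also have "\<dots> = c" by (simp add: algebra_simps)
  finally show "gpt x y t \<in> {x\<in>X. f x \<le> c}" using x y t gpt_in by simp
qed auto

end

section \<open>Semi-simple actions\<close>

locale CAT0_semisimple_action = CAT0_space X d + semisimple_action G X d \<phi>
  for G (structure) and X :: "'a set" and d :: "'a \<Rightarrow> 'a \<Rightarrow> real" and \<phi> :: "'b \<Rightarrow> 'a \<Rightarrow> 'a" +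
  fixes k :: nat
  assumes complete: mcomplete and dim: "covering_dim_le mtopology (int k)"

sublocale CAT0_semisimple_action \<subseteq> grp: group G
  using group_hom by (simp add: group_hom_def)

context CAT0_semisimple_action
begin

lemma act_in [simp]: "g \<in> carrier G \<Longrightarrow> x \<in> X \<Longrightarrow> \<phi> g x \<in> X"
  using element_image by blast

lemma act_one [simp]: "x \<in> X \<Longrightarrow> \<phi> \<one> x = x"
  by (simp add: id_eq_one[symmetric])

lemmas act_mult = composition_rule

lemma act_inv [simp]: "g \<in> carrier G \<Longrightarrow> x \<in> X \<Longrightarrow> \<phi> (inv g) (\<phi> g x) = x"
  "g \<in> carrier G \<Longrightarrow> x \<in> X \<Longrightarrow> \<phi> g (\<phi> (inv g) x) = x"
  by (simp_all add: act_mult[symmetric])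

lemma act_gpt:
  assumes "g \<in> carrier G" "x \<in> X" "y \<in> X" "t \<in> {0..1}"
  shows "\<phi> g (gpt x y t) = gpt (\<phi> g x) (\<phi> g y) t"
  by (rule gpt_eqI[symmetric]) (use assms gpt in \<open>auto simp: isometry\<close>)

section \<open>Fixed point sets\<close>

definition fixed :: "'b set \<Rightarrow> 'a set" where
  "fixed A = {x\<in>X. \<forall>a\<in>A. \<phi> a x = x}"

lemma fixed_Un: "fixed (A \<union> B) = fixed A \<inter> fixed B"
  by (auto simp: fixed_def)

lemma fixed_subset: "fixed A \<subseteq> X"
  by (auto simp: fixed_def)

lemma gconvex_fixed: "A \<subseteq> carrier G \<Longrightarrow> gconvex (fixed A)"
  unfolding gconvex_def fixed_def by (auto simp: gpt_in act_gpt subset_iff)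

text \<open>The displacement \<open>d x (\<phi> a x)\<close> is 2-Lipschitz in \<open>x\<close>, and
  the fixed points of \<open>a\<close> form its sublevel set at 0.\<close>

lemma closedin_fixed:
  assumes A: "A \<subseteq> carrier G"
  shows "closedin mtopology (fixed A)"
proof (cases "A = {}")
  case True
  then show ?thesis by (simp add: fixed_def)
next
  case False
  have "closedin mtopology {x\<in>X. d x (\<phi> a x) \<le> 0}" if a: "a \<in> A" for a
  proof (rule closedin_lipschitz_sublevel[of 2])
    fix x y assume xy: "x \<in> X" "y \<in> X"
    have ax: "\<phi> a x \<in> X" "\<phi> a y \<in> X" using xy a A by auto
    have "d (\<phi> a y) (\<phi> a x) = d x y" using isometry[of a y x] a A xy commute by auto
    then show "d x (\<phi> a x) \<le> d y (\<phi> a y) + 2 * d x y"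
      using triangle[OF xy(1) xy(2) ax(1)] triangle[OF xy(2) ax(2) ax(1)] by linarith
  qed simp
  then have "closedin mtopology (\<Inter>a\<in>A. {x\<in>X. d x (\<phi> a x) \<le> 0})"
    using False by (intro closedin_Inter) auto
  also have "(\<Inter>a\<in>A. {x\<in>X. d x (\<phi> a x) \<le> 0}) = fixed A"
  proof -
    have "d x (\<phi> a x) \<le> 0 \<longleftrightarrow> \<phi> a x = x" if "a \<in> A" "x \<in> X" for a x
    proof -
      have "\<phi> a x \<in> X" using that A by auto
      then show ?thesis using that(2) nonneg[of x "\<phi> a x"] zero[of x "\<phi> a x"] by (metis order_antisym order_refl)
    qed
    then show ?thesis using False unfolding fixed_def by blast
  qed
  finally show ?thesis .
qed

text \<open>The nearest point of \<open>C\<close> to a fixed point of \<open>B\<close> is unique and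
  hence fixed too. This is where completeness of \<open>X\<close> enters.\<close>

lemma fixed_point_in_invariant_convex:
  assumes C: "closedin mtopology C" "gconvex C" "C \<noteq> {}" and B: "B \<subseteq> carrier G" "fixed B \<noteq> {}"
    and inv: "\<And>b x. b \<in> B \<Longrightarrow> x \<in> C \<Longrightarrow> \<phi> b x \<in> C"
  shows "\<exists>p\<in>C. p \<in> fixed B"
proof -
  obtain x where x: "x \<in> X" "\<And>b. b \<in> B \<Longrightarrow> \<phi> b x = x" using B(2) by (auto simp: fixed_def)
  obtain p where p: "p \<in> C" "\<And>c. c \<in> C \<Longrightarrow> d x p \<le> d x c"
    by (rule nearest_point_exists[OF complete C x(1)]) (rule that)
  have pX: "p \<in> X" using p C(2) by (auto simp: gconvex_def)
  have "\<phi> b p = p" if b: "b \<in> B" for b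
  proof -
    have "d x (\<phi> b p) = d (\<phi> b x) (\<phi> b p)" using x(2)[OF b] by simp
    also have "\<dots> = d x p" using isometry b B(1) x(1) pX by auto
    finally show ?thesis
      using nearest_point_unique[OF C(2) x(1) p inv[OF b p(1)]] by simp
  qed
  then show ?thesis using p(1) pX by (auto simp: fixed_def)
qed

section \<open>Conjugation and displaceable sets\<close>

definition conjg :: "'b \<Rightarrow> 'b \<Rightarrow> 'b" where
  "conjg t a = t \<otimes> a \<otimes> inv t"

lemma conjg_closed [simp]: "t \<in> carrier G \<Longrightarrow> a \<in> carrier G \<Longrightarrow> conjg t a \<in> carrier G"
  by (simp add: conjg_def)

lemma conjg_mult:
  assumes "t \<in> carrier G" "a \<in> carrier G" "b \<in> carrier G"
  shows "conjg t (a \<otimes> b) = conjg t a \<otimes> conjg t b"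
proof -
  have "conjg t a \<otimes> conjg t b = t \<otimes> a \<otimes> (inv t \<otimes> t) \<otimes> b \<otimes> inv t"
    unfolding conjg_def using assms by (simp only: grp.m_assoc grp.inv_closed grp.m_closed)
  then show ?thesis using assms by (simp add: conjg_def grp.m_assoc)
qed

lemma conjg_one [simp]: "t \<in> carrier G \<Longrightarrow> conjg t \<one> = \<one>"
  by (simp add: conjg_def)

lemma conjg_inv: "t \<in> carrier G \<Longrightarrow> a \<in> carrier G \<Longrightarrow> conjg t (inv a) = inv (conjg t a)"
  using conjg_mult[of t "inv a" a] by (intro grp.inv_equality[symmetric]) auto

lemma conjg_conjg: "s \<in> carrier G \<Longrightarrow> t \<in> carrier G \<Longrightarrow> a \<in> carrier G \<Longrightarrow> conjg s (conjg t a) = conjg (s \<otimes> t) a"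
  by (simp add: conjg_def grp.m_assoc grp.inv_mult_group)

lemma conjg_inv_conjg [simp]: "t \<in> carrier G \<Longrightarrow> a \<in> carrier G \<Longrightarrow> conjg (inv t) (conjg t a) = a"
  by (simp add: conjg_conjg) (simp add: conjg_def)

lemma act_conjg: "t \<in> carrier G \<Longrightarrow> a \<in> carrier G \<Longrightarrow> x \<in> X \<Longrightarrow> \<phi> (conjg t a) x = \<phi> t (\<phi> a (\<phi> (inv t) x))"
  by (simp add: conjg_def act_mult)

lemma fixed_conjg:
  assumes "t \<in> carrier G" "A \<subseteq> carrier G" "x \<in> X"
  shows "x \<in> fixed (conjg t ` A) \<longleftrightarrow> \<phi> (inv t) x \<in> fixed A"
proof -
  have "\<phi> (conjg t a) x = x \<longleftrightarrow> \<phi> a (\<phi> (inv t) x) = \<phi> (inv t) x" if "a \<in> A" for a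
  proof -
    have a: "a \<in> carrier G" using that assms by auto
    show ?thesis using act_inv assms a by (metis act_conjg act_in grp.inv_closed)
  qed
  then show ?thesis using assms by (auto simp: fixed_def)
qed

lemma fixed_conjg_nonempty:
  assumes "t \<in> carrier G" "A \<subseteq> carrier G" "fixed A \<noteq> {}"
  shows "fixed (conjg t ` A) \<noteq> {}"
proof -
  obtain x where "x \<in> fixed A" using assms by auto
  then have "\<phi> t x \<in> fixed (conjg t ` A)"
    using fixed_conjg[of t A "\<phi> t x"] assms fixed_subset by (auto simp: subset_iff)
  then show ?thesis by auto
qed

text \<open>Only different copies of \<open>E\<close> have to commute with each other; elements of
  the same copy need not. There are as many copies as \<open>disjoint_pairs\<close> requires pairs
  in dimension \<open>k\<close>.\<close>

definition displaceable :: "'b set \<Rightarrow> bool" where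
  "displaceable E \<longleftrightarrow> (\<exists>t::nat \<Rightarrow> 'b. (\<forall>i\<le>k. t i \<in> carrier G) \<and>
     (\<forall>i\<le>k. \<forall>j\<le>k. i \<noteq> j \<longrightarrow> (\<forall>a\<in>E. \<forall>b\<in>E. conjg (t i) a \<otimes> conjg (t j) b = conjg (t j) b \<otimes> conjg (t i) a)))"

lemma displaceableE:
  assumes "displaceable E"
  obtains t where "\<And>i. i \<le> k \<Longrightarrow> t i \<in> carrier G"
    "\<And>i j a b. i \<le> k \<Longrightarrow> j \<le> k \<Longrightarrow> i \<noteq> j \<Longrightarrow> a \<in> E \<Longrightarrow> b \<in> E \<Longrightarrow>
      conjg (t i) a \<otimes> conjg (t j) b = conjg (t j) b \<otimes> conjg (t i) a"
proof -
  obtain t where t: "\<forall>i\<le>k. t i \<in> carrier G"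
    "\<forall>i\<le>k. \<forall>j\<le>k. i \<noteq> j \<longrightarrow> (\<forall>a\<in>E. \<forall>b\<in>E. conjg (t i) a \<otimes> conjg (t j) b = conjg (t j) b \<otimes> conjg (t i) a)"
    using assms unfolding displaceable_def by (elim exE conjE)
  show ?thesis by (rule that[of t]) (rule t[rule_format], assumption+)+
qed

lemma fixed_commute:
  assumes "A \<subseteq> carrier G" "b \<in> carrier G" "\<And>a. a \<in> A \<Longrightarrow> a \<otimes> b = b \<otimes> a" "x \<in> fixed A"
  shows "\<phi> b x \<in> fixed A"
proof -
  have x: "x \<in> X" using assms fixed_subset by auto
  have "\<phi> a (\<phi> b x) = \<phi> b x" if "a \<in> A" for a
  proof -
    have "\<phi> a (\<phi> b x) = \<phi> b (\<phi> a x)"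
      using assms(1-3) that x by (metis act_mult subsetD)
    then show ?thesis using assms(4) that by (simp add: fixed_def)
  qed
  then show ?thesis using x assms(2) by (simp add: fixed_def)
qed

text \<open>The pairs are the fixed point sets of the copies of \<open>A\<close> and of
  \<open>B\<close>. Every choice of one of the two for each copy has a common fixed point, because
  the fixed point set of the earlier copies is invariant under the next one and so contains a fixed
  point of it. Thus the two sets of some pair meet, and conjugating back gives the claim.\<close>

lemma fixed_Un_displaceable:
  assumes AB: "A \<subseteq> carrier G" "B \<subseteq> carrier G" and disp: "displaceable (A \<union> B)"
    and ne: "fixed A \<noteq> {}" "fixed B \<noteq> {}"
  shows "fixed (A \<union> B) \<noteq> {}"
proof
  assume empty: "fixed (A \<union> B) = {}"
  obtain t where t: "\<And>i. i \<le> k \<Longrightarrow> t i \<in> carrier G"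
    and comm: "\<And>i j a b. i \<le> k \<Longrightarrow> j \<le> k \<Longrightarrow> i \<noteq> j \<Longrightarrow> a \<in> A \<union> B \<Longrightarrow> b \<in> A \<union> B \<Longrightarrow>
      conjg (t i) a \<otimes> conjg (t j) b = conjg (t j) b \<otimes> conjg (t i) a"
    by (rule displaceableE[OF disp]) (rule that)
  have sub: "conjg (t i) ` A \<subseteq> carrier G" "conjg (t i) ` B \<subseteq> carrier G" if "i \<le> k" for i
    using AB t[OF that] by auto
  show False
  proof (rule disjoint_pairs[OF dim, of "Suc k" "\<lambda>i. fixed (conjg (t i) ` A)" "\<lambda>i. fixed (conjg (t i) ` B)"])
    fix i assume i: "i < Suc k"
    then have i: "i \<le> k" by simp
    show "closedin mtopology (fixed (conjg (t i) ` A)) \<and> closedin mtopology (fixed (conjg (t i) ` B))"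
      using closedin_fixed sub[OF i] by blast
    show "gconvex (fixed (conjg (t i) ` A)) \<and> gconvex (fixed (conjg (t i) ` B))"
      using gconvex_fixed sub[OF i] by blast
    show "fixed (conjg (t i) ` A) \<inter> fixed (conjg (t i) ` B) = {}"
    proof (rule ccontr)
      assume "fixed (conjg (t i) ` A) \<inter> fixed (conjg (t i) ` B) \<noteq> {}"
      then obtain x where x: "x \<in> fixed (conjg (t i) ` A)" "x \<in> fixed (conjg (t i) ` B)" by blast
      then have "x \<in> X" using fixed_subset by blast
      then have "\<phi> (inv (t i)) x \<in> fixed (A \<union> B)"
        using x fixed_conjg t[OF i] AB unfolding fixed_Un by blast
      then show False using empty by blast
    qed
  next
    fix S :: "nat set"
    define E where "E i = (if i \<in> S then B else A)" for i
    have E: "E i \<subseteq> carrier G" "E i \<subseteq> A \<union> B" "fixed (E i) \<noteq> {}" for i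
      using AB ne by (auto simp: E_def)
    have "fixed (\<Union>i<m. conjg (t i) ` E i) \<noteq> {}" if "m \<le> Suc k" for m
      using that
    proof (induction m)
      case 0
      then show ?case using nonempty by (auto simp: fixed_def)
    next
      case (Suc m)
      let ?U = "\<Union>i<m. conjg (t i) ` E i"
      have U: "?U \<subseteq> carrier G" using Suc.prems t E(1) by fastforce
      have m: "m \<le> k" using Suc.prems by simp
      have "\<exists>p\<in>fixed ?U. p \<in> fixed (conjg (t m) ` E m)"
      proof (rule fixed_point_in_invariant_convex[OF closedin_fixed[OF U] gconvex_fixed[OF U]])
        show "fixed ?U \<noteq> {}" using Suc by simp
        show "conjg (t m) ` E m \<subseteq> carrier G" using t[OF m] E(1)[of m] by auto
        show "fixed (conjg (t m) ` E m) \<noteq> {}" by (rule fixed_conjg_nonempty[OF t[OF m] E(1,3)])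
        fix b x assume b: "b \<in> conjg (t m) ` E m" and x: "x \<in> fixed ?U"
        obtain b' where b': "b' \<in> E m" "b = conjg (t m) b'" using b by auto
        show "\<phi> b x \<in> fixed ?U"
        proof (rule fixed_commute[OF U _ _ x])
          show "b \<in> carrier G" using b' t[OF m] E(1)[of m] by auto
          fix a assume "a \<in> ?U"
          then obtain i a' where i: "i < m" "a' \<in> E i" "a = conjg (t i) a'" by auto
          show "a \<otimes> b = b \<otimes> a" unfolding i(3) b'(2)
            by (rule comm) (use i m b' E(2)[of i] E(2)[of m] in auto)
        qed
      qed
      then show ?case unfolding lessThan_Suc UN_insert fixed_Un by blast
    qed
    from this[of "Suc k"] obtain x where x: "x \<in> fixed (\<Union>i<Suc k. conjg (t i) ` E i)" by auto
    have xX: "x \<in> X" using x fixed_subset by blast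
    have "x \<in> (if i \<in> S then fixed (conjg (t i) ` B) else fixed (conjg (t i) ` A))" if "i < Suc k" for i
    proof -
      have "x \<in> fixed (conjg (t i) ` E i)" using x that by (auto simp: fixed_def)
      then show ?thesis by (cases "i \<in> S") (simp_all add: E_def)
    qed
    then show "\<exists>x\<in>X. \<forall>i<Suc k. x \<in> (if i \<in> S then fixed (conjg (t i) ` B) else fixed (conjg (t i) ` A))"
      using xX by (intro bexI[of _ x]) simp_all
  qed simp
qed

lemma displaceable_subset:
  assumes "displaceable E" "E' \<subseteq> E"
  shows "displaceable E'"
proof (rule displaceableE[OF assms(1)])
  fix t :: "nat \<Rightarrow> 'b"
  assume t: "\<And>i. i \<le> k \<Longrightarrow> t i \<in> carrier G"
    "\<And>i j a b. i \<le> k \<Longrightarrow> j \<le> k \<Longrightarrow> i \<noteq> j \<Longrightarrow> a \<in> E \<Longrightarrow> b \<in> E \<Longrightarrow>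
      conjg (t i) a \<otimes> conjg (t j) b = conjg (t j) b \<otimes> conjg (t i) a"
  show ?thesis
    unfolding displaceable_def
  proof (intro exI[of _ t] conjI allI impI ballI)
    fix i j a b assume "i \<le> k" "j \<le> k" "i \<noteq> j" "a \<in> E'" "b \<in> E'"
    then show "conjg (t i) a \<otimes> conjg (t j) b = conjg (t j) b \<otimes> conjg (t i) a"
      using assms(2) by (intro t(2)) auto
  qed (rule t(1))
qed

lemma fixed_displaceable:
  assumes "finite E" "E \<subseteq> carrier G" "displaceable E" "\<And>a. a \<in> E \<Longrightarrow> fixed {a} \<noteq> {}"
  shows "fixed E \<noteq> {}"
  using assms
proof (induction E rule: finite_induct)
  case empty
  then show ?case using nonempty by (simp add: fixed_def)
next
  case (insert a E)
  have "fixed ({a} \<union> E) \<noteq> {}"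
  proof (rule fixed_Un_displaceable)
    show "fixed E \<noteq> {}" using insert displaceable_subset[of "insert a E" E] by auto
  qed (use insert in auto)
  then show ?case by simp
qed

theorem fixed_locally_displaceable:
  assumes fin: "finite S" and S: "S \<subseteq> carrier G" and ell: "\<And>a. a \<in> S \<Longrightarrow> fixed {a} \<noteq> {}"
    and disp: "\<And>E. E \<subseteq> S \<Longrightarrow> card E \<le> Suc k \<Longrightarrow> displaceable E"
  shows "fixed S \<noteq> {}"
proof -
  have "\<exists>x\<in>X. \<forall>a\<in>S. x \<in> fixed {a}"
  proof (rule helly[OF dim fin])
    fix a assume "a \<in> S"
    then have "{a} \<subseteq> carrier G" using S by auto
    then show "closedin mtopology (fixed {a})" "gconvex (fixed {a})"
      by (rule closedin_fixed, rule gconvex_fixed)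
  next
    fix E assume E: "E \<subseteq> S" "card E \<le> Suc k"
    have "fixed E \<noteq> {}"
      by (rule fixed_displaceable) (use E fin S ell disp finite_subset in auto)
    then show "\<exists>x\<in>X. \<forall>a\<in>E. x \<in> fixed {a}" by (auto simp: fixed_def)
  qed
  then show ?thesis by (auto simp: fixed_def)
qed

text \<open>The midpoint of \<open>x\<close> and \<open>\<phi> a x\<close> is fixed, since
  \<open>a\<close> exchanges the end points.\<close>

lemma fixed_involution:
  assumes a: "a \<in> carrier G" "a \<otimes> a = \<one>"
  shows "fixed {a} \<noteq> {}"
proof -
  obtain x where x: "x \<in> X" using nonempty by auto
  have h: "(1/2 :: real) \<in> {0..1}" by simp
  define y where "y = gpt x (\<phi> a x) (1/2)"
  have y: "y \<in> X" unfolding y_def using x a h by (intro gpt_in) auto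
  have "\<phi> a (\<phi> a x) = x" using act_mult[OF x a(1) a(1)] a x by simp
  then have "\<phi> a y = gpt (\<phi> a x) x (1/2)"
    unfolding y_def using act_gpt[OF a(1) x act_in[OF a(1) x] h] by simp
  also have "\<dots> = y" unfolding y_def using gpt_commute[OF x act_in[OF a(1) x] h] by simp
  finally show ?thesis using y by (auto simp: fixed_def)
qed

text \<open>The image of the midpoint \<open>?m\<close> between \<open>y\<close> and
  \<open>\<phi> g y\<close> is the midpoint of the next segment of the orbit. In the triangle with
  apex \<open>\<phi> g y\<close> the two midpoints are at most half as far apart as \<open>y\<close>
  and its second image.\<close>

lemma displacement_double:
  assumes g: "g \<in> carrier G" and l: "\<And>y. y \<in> X \<Longrightarrow> l \<le> d y (\<phi> g y)" and y: "y \<in> X"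
  shows "2 * l \<le> d y (\<phi> (g \<otimes> g) y)"
proof -
  have h: "(1/2 :: real) \<in> {0..1}" by simp
  let ?m = "gpt y (\<phi> g y) (1/2)"
  note gy = act_in[OF g y]
  note ggy = act_in[OF g gy]
  have "l \<le> d ?m (\<phi> g ?m)" by (rule l[OF gpt_in[OF y gy h]])
  also have "\<phi> g ?m = gpt (\<phi> g y) (\<phi> g (\<phi> g y)) (1/2)" by (rule act_gpt[OF g y gy h])
  also have "?m = gpt (\<phi> g y) y (1/2)" using gpt_commute[OF y gy h] by simp
  also have "d (gpt (\<phi> g y) y (1/2)) (gpt (\<phi> g y) (\<phi> g (\<phi> g y)) (1/2)) \<le> 1/2 * d y (\<phi> g (\<phi> g y))"
    by (rule gpt_convex_right[OF gy y ggy h])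
  finally show ?thesis using act_mult[OF y g g] by simp
qed

lemma displacement_power:
  assumes g: "g \<in> carrier G" and l: "\<And>y. y \<in> X \<Longrightarrow> l \<le> d y (\<phi> g y)"
  shows "y \<in> X \<Longrightarrow> 2 ^ j * l \<le> d y (\<phi> (g [^] (2 ^ j :: nat)) y)"
proof (induction j arbitrary: y)
  case 0
  then show ?case using l g by simp
next
  case (Suc j)
  have "2 * (2 ^ j * l) \<le> d y (\<phi> (g [^] (2 ^ j :: nat) \<otimes> g [^] (2 ^ j :: nat)) y)"
    by (rule displacement_double) (use Suc g in auto)
  also have "g [^] (2 ^ j :: nat) \<otimes> g [^] (2 ^ j :: nat) = g [^] (2 ^ Suc j :: nat)"
    using grp.nat_pow_mult[OF g, of "2 ^ j" "2 ^ j"] by (simp add: mult_2)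
  finally show ?case by simp
qed

lemma dist_orbit_le:
  assumes g: "g \<in> carrier G" and x: "x \<in> X"
  shows "d x (\<phi> (g [^] (m::nat)) x) \<le> real m * d x (\<phi> g x)"
proof (induction m)
  case (Suc m)
  have "d x (\<phi> (g [^] Suc m) x) \<le> d x (\<phi> (g [^] m) x) + d (\<phi> (g [^] m) x) (\<phi> (g [^] Suc m) x)"
    by (rule triangle) (use g x in \<open>auto simp del: nat_pow_Suc grp.nat_pow_Suc\<close>)
  also have "\<phi> (g [^] Suc m) x = \<phi> (g [^] m) (\<phi> g x)" using act_mult[OF x, of "g [^] m" g] g by simp
  also have "d (\<phi> (g [^] m) x) (\<phi> (g [^] m) (\<phi> g x)) = d x (\<phi> g x)"
    using g x by (intro isometry) auto
  finally show ?case using Suc.IH by (simp add: algebra_simps act_mult[OF x _ g] g)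
qed (use x in simp)

lemma act_pow_add: "g \<in> carrier G \<Longrightarrow> x \<in> X \<Longrightarrow> \<phi> (g [^] (m + n :: nat)) x = \<phi> (g [^] m) (\<phi> (g [^] n) x)"
  by (simp add: act_mult[symmetric] grp.nat_pow_mult)

text \<open>Semi-simplicity provides a point \<open>x\<close> of minimal displacement
  \<open>L\<close>. By \<open>displacement_power\<close> its orbit takes no shortcut at powers of
  two, hence none at all.\<close>

lemma hyperbolic_axis:
  assumes g: "g \<in> carrier G" and nofix: "fixed {g} = {}"
  obtains x L where "x \<in> X" "0 < L" "\<And>m::nat. d x (\<phi> (g [^] m) x) = real m * L"
proof -
  define L where "L = translation_length X d (\<phi> g)"
  obtain x where x: "x \<in> X" "d x (\<phi> g x) = L"
    using semisimple[OF g] unfolding semisimple_def L_def by auto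
  have le: "L \<le> d y (\<phi> g y)" if "y \<in> X" for y
    unfolding L_def translation_length_def
    by (rule cINF_lower[OF _ that]) (auto intro: bdd_belowI[of _ 0])
  have "x \<noteq> \<phi> g x" using nofix x(1) by (auto simp: fixed_def)
  then have L: "0 < L" using x g act_in mdist_pos_less by metis
  have "d x (\<phi> (g [^] m) x) = real m * L" for m :: nat
  proof (rule antisym)
    show "d x (\<phi> (g [^] m) x) \<le> real m * L" using dist_orbit_le[OF g x(1), of m] x(2) by simp
    \<comment> \<open>A power of two not below \<open>m\<close>: the steps from \<open>m\<close> to
      \<open>n\<close> cover at most \<open>(n - m) * L\<close>, so the first \<open>m\<close> steps
      must cover the rest.\<close>
    define n :: nat where "n = 2 ^ m"
    have mn: "m \<le> n" unfolding n_def by (simp add: less_imp_le)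
    have "real n * L \<le> d x (\<phi> (g [^] n) x)"
      using displacement_power[OF g le x(1), of m] by (simp add: n_def)
    also have "\<dots> \<le> d x (\<phi> (g [^] m) x) + d (\<phi> (g [^] m) x) (\<phi> (g [^] n) x)"
      by (rule triangle) (use g x in auto)
    also have "\<phi> (g [^] n) x = \<phi> (g [^] m) (\<phi> (g [^] (n - m)) x)"
      using act_pow_add[OF g x(1), of m "n - m"] mn by simp
    also have "d (\<phi> (g [^] m) x) (\<phi> (g [^] m) (\<phi> (g [^] (n - m)) x)) = d x (\<phi> (g [^] (n - m)) x)"
      using g x by (intro isometry) auto
    also have "\<dots> \<le> real (n - m) * L" using dist_orbit_le[OF g x(1), of "n - m"] x(2) by simp
    finally have "real n * L \<le> d x (\<phi> (g [^] m) x) + (real n - real m) * L"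
      using mn by (simp add: of_nat_diff)
    then show "real m * L \<le> d x (\<phi> (g [^] m) x)" by (simp add: algebra_simps)
  qed
  then show ?thesis using that x(1) L by blast
qed

definition orbit_ray :: "'b \<Rightarrow> 'a \<Rightarrow> nat \<Rightarrow> 'a" where
  "orbit_ray g x m = \<phi> (g [^] m) x"

lemma is_ray_orbit_ray:
  assumes g: "g \<in> carrier G" and x: "x \<in> X" "0 < L" "\<And>m::nat. d x (\<phi> (g [^] m) x) = real m * L"
  shows "is_ray L (orbit_ray g x)"
  unfolding is_ray_def orbit_ray_def
proof (intro conjI allI x(2))
  show "\<phi> (g [^] m) x \<in> X" for m :: nat using g x by simp
  show "d (\<phi> (g [^] m) x) (\<phi> (g [^] (m + n)) x) = real n * L" for m n :: nat
    unfolding act_pow_add[OF g x(1)] using isometry[of "g [^] m" x "\<phi> (g [^] n) x"] g x by simp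
qed

text \<open>Applying \<open>g\<close> shifts the ray by one step.\<close>

lemma busemann_axis_shift:
  assumes g: "g \<in> carrier G" and r: "is_ray L (orbit_ray g x)" and x: "x \<in> X" and y: "y \<in> X"
  shows "busemann L (orbit_ray g x) (\<phi> g y) = busemann L (orbit_ray g x) y - L"
proof (rule LIMSEQ_unique)
  show "(\<lambda>m. d (\<phi> g y) (orbit_ray g x (Suc m)) - real (Suc m) * L) \<longlonglongrightarrow> busemann L (orbit_ray g x) (\<phi> g y)"
    by (rule LIMSEQ_Suc[OF busemann_limit[OF r act_in[OF g y]]])
  have "d (\<phi> g y) (orbit_ray g x (Suc m)) = d y (orbit_ray g x m)" for m
    using act_pow_add[OF g x, of 1 m] isometry[OF g y, of "\<phi> (g [^] m) x"] g x by (simp add: orbit_ray_def)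
  then have "(\<lambda>m. d (\<phi> g y) (orbit_ray g x (Suc m)) - real (Suc m) * L) =
      (\<lambda>m. d y (orbit_ray g x m) - real m * L - L)"
    by (auto simp: algebra_simps)
  then show "(\<lambda>m. d (\<phi> g y) (orbit_ray g x (Suc m)) - real (Suc m) * L) \<longlonglongrightarrow> busemann L (orbit_ray g x) y - L"
    using tendsto_diff[OF busemann_limit[OF r y] tendsto_const[of L]] by simp
qed

text \<open>The element \<open>c\<close> maps the orbit ray of \<open>\<phi> (inv c) x\<close> to
  that of \<open>x\<close>. Both are orbits of \<open>g\<close>, hence at bounded distance, and the
  Busemann functions of such rays differ by a constant.\<close>

lemma busemann_centralizer:
  assumes g: "g \<in> carrier G" and c: "c \<in> carrier G" "c \<otimes> g = g \<otimes> c"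
    and r: "is_ray L (orbit_ray g x)" and x: "x \<in> X" and y: "y \<in> X" and z: "z \<in> X"
  shows "busemann L (orbit_ray g x) (\<phi> c y) - busemann L (orbit_ray g x) (\<phi> c z) =
    busemann L (orbit_ray g x) y - busemann L (orbit_ray g x) z"
proof -
  define x' where "x' = \<phi> (inv c) x"
  have x': "x' \<in> X" unfolding x'_def using c x by simp
  have comm: "c \<otimes> g [^] (m::nat) = g [^] m \<otimes> c" for m
    using grp.group_commutes_pow[OF c(2)[symmetric] g c(1), of m] by simp
  have img: "\<phi> c (orbit_ray g x' m) = orbit_ray g x m" for m
    unfolding orbit_ray_def using act_mult[OF x' c(1), of "g [^] m"] act_mult[OF x' _ c(1), of "g [^] m"] g c x comm[of m]
    by (simp add: x'_def)
  have iso: "d (\<phi> c p) (orbit_ray g x m) = d p (orbit_ray g x' m)" if "p \<in> X" for p m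
    unfolding img[symmetric] by (rule isometry[OF c(1) that]) (use g x' in \<open>simp add: orbit_ray_def\<close>)
  have r': "is_ray L (orbit_ray g x')"
    unfolding is_ray_def
  proof (intro conjI allI)
    show "0 < L" using r by (simp add: is_ray_def)
    show q: "orbit_ray g x' m \<in> X" for m using g x' by (simp add: orbit_ray_def)
    show "d (orbit_ray g x' m) (orbit_ray g x' (m + n)) = real n * L" for m n
      using iso[OF q, of m "m + n"] img r by (simp add: is_ray_def)
  qed
  have eq: "busemann L (orbit_ray g x) (\<phi> c p) = busemann L (orbit_ray g x') p" if "p \<in> X" for p
    unfolding busemann_def iso[OF that] ..
  have par: "d (orbit_ray g x' m) (orbit_ray g x m) \<le> d x' x" for m
    unfolding orbit_ray_def using isometry[of "g [^] m" x' x] g x x' by simp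
  show ?thesis
    unfolding eq[OF y] eq[OF z] by (rule busemann_parallel[OF r' r par y z])
qed

text \<open>By \<open>busemann_centralizer\<close> the change of the Busemann function is a
  homomorphism from the centraliser of \<open>g\<close> to the reals, and it vanishes on
  commutators.\<close>

lemma busemann_commutator:
  assumes g: "g \<in> carrier G" and u: "u \<in> carrier G" "u \<otimes> g = g \<otimes> u" and v: "v \<in> carrier G" "v \<otimes> g = g \<otimes> v"
    and r: "is_ray L (orbit_ray g x)" and x: "x \<in> X" and y: "y \<in> X"
  shows "busemann L (orbit_ray g x) (\<phi> (u \<otimes> v \<otimes> inv u \<otimes> inv v) y) = busemann L (orbit_ray g x) y"
proof -
  let ?b = "busemann L (orbit_ray g x)"
  define w where "w = \<phi> (inv v) y"
  define p where "p = \<phi> (inv u) w"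
  have X: "w \<in> X" "p \<in> X" "\<phi> v p \<in> X" unfolding w_def p_def using u v y by simp_all
  have uv: "\<phi> u p = w" "\<phi> v w = y" unfolding w_def p_def using u v y by simp_all
  have "\<phi> (u \<otimes> v \<otimes> inv u \<otimes> inv v) y = \<phi> u (\<phi> v p)"
    unfolding w_def p_def using u v y by (simp add: act_mult)
  moreover have "?b (\<phi> u (\<phi> v p)) - ?b (\<phi> u p) = ?b (\<phi> v p) - ?b p"
    by (rule busemann_centralizer[OF g u r x X(3,2)])
  moreover have "?b (\<phi> v p) - ?b (\<phi> v w) = ?b p - ?b w"
    by (rule busemann_centralizer[OF g v r x X(2,1)])
  ultimately show ?thesis using uv by simp
qed

end

lemma (in group) commute_inv:
  assumes "a \<in> carrier G" "c \<in> carrier G" "c \<otimes> a = a \<otimes> c"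
  shows "c \<otimes> inv a = inv a \<otimes> c"
proof -
  have "c \<otimes> inv a = inv a \<otimes> (a \<otimes> c) \<otimes> inv a" using assms(1,2) by (simp add: m_assoc[symmetric])
  also have "\<dots> = inv a \<otimes> c" unfolding assms(3)[symmetric] using assms(1,2) by (simp add: m_assoc)
  finally show ?thesis .
qed

lemma (in group) commute_mult:
  assumes "a \<in> carrier G" "b \<in> carrier G" "c \<in> carrier G" "c \<otimes> a = a \<otimes> c" "c \<otimes> b = b \<otimes> c"
  shows "c \<otimes> (a \<otimes> b) = a \<otimes> b \<otimes> c"
  using assms by (metis m_assoc)

context CAT0_semisimple_action
begin

lemma conjg_one_left: "a \<in> carrier G \<Longrightarrow> conjg \<one> a = a"
  by (simp add: conjg_def)

text \<open>Otherwise the displaced copies of the commutator are commuting hyperbolic isometries. Being a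
  commutator of elements centralising the other copies, each of them leaves the Busemann functions
  of the other axes invariant, so that the horoballs of the two ends of these axes contradict
  \<open>disjoint_pairs\<close>.\<close>

lemma fixed_commutator:
  assumes u: "u \<in> carrier G" and v: "v \<in> carrier G" and disp: "displaceable {u, v}"
  shows "fixed {u \<otimes> v \<otimes> inv u \<otimes> inv v} \<noteq> {}"
proof
  define h where "h = u \<otimes> v \<otimes> inv u \<otimes> inv v"
  assume "fixed {u \<otimes> v \<otimes> inv u \<otimes> inv v} = {}"
  then have nofix: "fixed {h} = {}" by (simp add: h_def)
  have h: "h \<in> carrier G" using u v by (simp add: h_def)
  obtain x L where x: "x \<in> X" and L: "0 < L" and ax: "\<And>m::nat. d x (\<phi> (h [^] m) x) = real m * L"
    by (rule hyperbolic_axis[OF h nofix]) (rule that)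
  have pow_inv: "\<phi> (inv h [^] m) x = \<phi> (inv (h [^] m)) x" for m :: nat
    using grp.nat_pow_inv[OF h] by simp
  have ax': "d x (\<phi> (inv h [^] m) x) = real m * L" for m :: nat
    unfolding pow_inv ax[symmetric]
    using isometry[of "h [^] m" x "\<phi> (inv (h [^] m)) x"] h x commute by simp
  have ray: "is_ray L (orbit_ray h x)" by (rule is_ray_orbit_ray[OF h x L ax])
  have ray': "is_ray L (orbit_ray (inv h) x)" by (rule is_ray_orbit_ray[OF _ x L ax']) (simp add: h)
  have opp: "d (orbit_ray h x m) (orbit_ray (inv h) x m) = 2 * real m * L" for m
  proof -
    have "d (\<phi> (h [^] m) x) (\<phi> (inv (h [^] m)) x) = d (\<phi> (h [^] m) (\<phi> (h [^] m) x)) x"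
      using isometry[of "h [^] m" "\<phi> (h [^] m) x" "\<phi> (inv (h [^] m)) x"] h x by simp
    also have "\<dots> = d x (\<phi> (h [^] (m + m)) x)" using act_pow_add[OF h x, of m m] commute by simp
    finally show ?thesis unfolding orbit_ray_def pow_inv ax by simp
  qed
  \<comment> \<open>Both ends of each axis are needed; the orbit of the inverse runs to the other
    end.\<close>
  define H where "H = {h, inv h}"
  have HG: "e \<in> carrier G" if "e \<in> H" for e using that h by (auto simp: H_def)
  have rayH: "is_ray L (orbit_ray e x)" if "e \<in> H" for e using that ray ray' by (auto simp: H_def)
  define b where "b e = busemann L (orbit_ray e x)" for e
  obtain t where t: "\<And>i. i \<le> k \<Longrightarrow> t i \<in> carrier G"
    and comm: "\<And>i j a b. i \<le> k \<Longrightarrow> j \<le> k \<Longrightarrow> i \<noteq> j \<Longrightarrow> a \<in> {u, v} \<Longrightarrow> b \<in> {u, v} \<Longrightarrow>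
      conjg (t i) a \<otimes> conjg (t j) b = conjg (t j) b \<otimes> conjg (t i) a"
    by (rule displaceableE[OF disp]) (rule that)
  have other_h: "b e (\<phi> (inv (t i)) (\<phi> (conjg (t m) h) y)) = b e (\<phi> (inv (t i)) y)"
    if im: "i \<le> k" "m \<le> k" "i \<noteq> m" and e: "e \<in> H" and y: "y \<in> X" for i m e y
  proof -
    \<comment> \<open>Conjugation by \<open>inv (t i)\<close> turns copy \<open>i\<close> into the
      original and copy \<open>m\<close> into the conjugate by \<open>s\<close>, whose elements
      commute with \<open>u\<close> and \<open>v\<close> and hence with \<open>h\<close>. The copy
      of \<open>h\<close> is thus a commutator in the centraliser of \<open>h\<close>.\<close>
    define s where "s = inv (t i) \<otimes> t m"
    have s: "s \<in> carrier G" using t im by (simp add: s_def)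
    have cs: "conjg s a \<otimes> e = e \<otimes> conjg s a" if a: "a \<in> {u, v}" for a
    proof -
      have aG: "a \<in> carrier G" using a u v by auto
      have *: "conjg s a \<otimes> c = c \<otimes> conjg s a" if c: "c \<in> {u, v}" for c
      proof -
        have cG: "c \<in> carrier G" using c u v by auto
        have "conjg (inv (t i)) (conjg (t m) a \<otimes> conjg (t i) c) = conjg (inv (t i)) (conjg (t i) c \<otimes> conjg (t m) a)"
          using comm[OF im(2,1) im(3)[symmetric] a c] by simp
        then show ?thesis using t im aG cG by (simp add: conjg_mult conjg_conjg conjg_one_left s_def)
      qed
      have uu: "conjg s a \<otimes> u = u \<otimes> conjg s a" and vv: "conjg s a \<otimes> v = v \<otimes> conjg s a"
        using * by simp_all
      have sa: "conjg s a \<in> carrier G" using s aG by simp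
      have "conjg s a \<otimes> h = h \<otimes> conjg s a"
        unfolding h_def
        by (intro grp.commute_mult grp.commute_inv) (use sa u v uu vv in auto)
      then show ?thesis
        using e grp.commute_inv[OF h sa] by (auto simp: H_def)
    qed
    have "\<phi> (inv (t i)) (\<phi> (conjg (t m) h) y) = \<phi> (conjg (inv (t i)) (conjg (t m) h)) (\<phi> (inv (t i)) y)"
      using t im h y act_conjg[of "inv (t i)" "conjg (t m) h" "\<phi> (inv (t i)) y"] by simp
    also have "conjg (inv (t i)) (conjg (t m) h) = conjg s u \<otimes> conjg s v \<otimes> inv (conjg s u) \<otimes> inv (conjg s v)"
      using t im u v h s by (simp add: conjg_conjg s_def[symmetric] h_def conjg_mult conjg_inv)
    finally show ?thesis
      unfolding b_def
      using busemann_commutator[OF HG[OF e] _ cs[of u] _ cs[of v] rayH[OF e] x, of "\<phi> (inv (t i)) y"] s u v t im y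
      by simp
  qed
  have other: "b e (\<phi> (inv (t i)) (\<phi> (conjg (t m) f) y)) = b e (\<phi> (inv (t i)) y)"
    if im: "i \<le> k" "m \<le> k" "i \<noteq> m" and e: "e \<in> H" "f \<in> H" and y: "y \<in> X" for i m e f y
  proof (cases "f = h")
    case True
    then show ?thesis using other_h[OF im e(1) y] by simp
  next
    case False
    then have f: "conjg (t m) f = inv (conjg (t m) h)" using e t im h by (simp add: H_def conjg_inv)
    have cG: "conjg (t m) h \<in> carrier G" using t im h by simp
    have "\<phi> (inv (conjg (t m) h)) y \<in> X" using cG y by simp
    from other_h[OF im e(1) this] show ?thesis unfolding f using cG y by simp
  qed
  have own: "b e (\<phi> (inv (t m)) (\<phi> (conjg (t m) e) y)) = b e (\<phi> (inv (t m)) y) - L"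
    if m: "m \<le> k" and e: "e \<in> H" and y: "y \<in> X" for m e y
  proof -
    have "\<phi> (inv (t m)) (\<phi> (conjg (t m) e) y) = \<phi> e (\<phi> (inv (t m)) y)"
      using act_conjg[OF t[OF m] HG[OF e] y] t[OF m] HG[OF e] y by simp
    then show ?thesis unfolding b_def
      using busemann_axis_shift[OF HG[OF e] rayH[OF e] x, of "\<phi> (inv (t m)) y"] t[OF m] y by simp
  qed
  \<comment> \<open>Each application of the copy of \<open>e\<close> lowers the \<open>m\<close>-th
    value by \<open>L\<close> and keeps the values at all other axes, so that the chosen horoballs
    can be reached one axis at a time.\<close>
  have push: "\<exists>y'\<in>X. (\<forall>i\<le>k. i \<noteq> m \<longrightarrow> (\<forall>f\<in>H. b f (\<phi> (inv (t i)) y') = b f (\<phi> (inv (t i)) y))) \<and>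
      b e (\<phi> (inv (t m)) y') = b e (\<phi> (inv (t m)) y) - real N * L"
    if m: "m \<le> k" and e: "e \<in> H" and y: "y \<in> X" for m e y and N :: nat
  proof (induction N)
    case 0
    then show ?case using y by auto
  next
    case (Suc N)
    then obtain y' where y': "y' \<in> X"
      "\<forall>i\<le>k. i \<noteq> m \<longrightarrow> (\<forall>f\<in>H. b f (\<phi> (inv (t i)) y') = b f (\<phi> (inv (t i)) y))"
      "b e (\<phi> (inv (t m)) y') = b e (\<phi> (inv (t m)) y) - real N * L" by blast
    show ?case
    proof (intro bexI[of _ "\<phi> (conjg (t m) e) y'"] conjI allI impI ballI)
      fix i f assume i: "i \<le> k" "i \<noteq> m" "f \<in> H"
      then show "b f (\<phi> (inv (t i)) (\<phi> (conjg (t m) e) y')) = b f (\<phi> (inv (t i)) y)"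
        using other[OF i(1) m i(2) i(3) e y'(1)] y'(2) by simp
    next
      show "b e (\<phi> (inv (t m)) (\<phi> (conjg (t m) e) y')) = b e (\<phi> (inv (t m)) y) - real (Suc N) * L"
        using own[OF m e y'(1)] y'(3) by (simp add: algebra_simps)
    qed (use y' t[OF m] HG[OF e] in auto)
  qed
  have lip: "b e (\<phi> (inv (t i)) p) \<le> b e (\<phi> (inv (t i)) q) + 1 * d p q"
    if "i \<le> k" "e \<in> H" "p \<in> X" "q \<in> X" for i e p q
    using busemann_lipschitz[OF rayH[OF that(2)], of "\<phi> (inv (t i)) p" "\<phi> (inv (t i)) q"] t that
      isometry[of "inv (t i)" p q] by (simp add: b_def)
  have conv: "b e (\<phi> (inv (t i)) (gpt p q s)) \<le> (1 - s) * b e (\<phi> (inv (t i)) p) + s * b e (\<phi> (inv (t i)) q)"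
    if "i \<le> k" "e \<in> H" "p \<in> X" "q \<in> X" "s \<in> {0..1}" for i e p q s
    using busemann_convex[OF rayH[OF that(2)], of "\<phi> (inv (t i)) p" "\<phi> (inv (t i)) q" s] t that
      act_gpt[of "inv (t i)" p q s] by (simp add: b_def)
  have hH: "h \<in> H" "inv h \<in> H" by (simp_all add: H_def)
  show False
  \<comment> \<open>The level -1 is negative, which makes the horoballs at the two ends of one axis
    disjoint by \<open>busemann_opposite\<close>.\<close>
  proof (rule disjoint_pairs[OF dim, of "Suc k" "\<lambda>i. {y\<in>X. b h (\<phi> (inv (t i)) y) \<le> -1}"
        "\<lambda>i. {y\<in>X. b (inv h) (\<phi> (inv (t i)) y) \<le> -1}"])
    fix i assume "i < Suc k"
    then have i: "i \<le> k" by simp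
    show "closedin mtopology {y\<in>X. b h (\<phi> (inv (t i)) y) \<le> -1} \<and>
        closedin mtopology {y\<in>X. b (inv h) (\<phi> (inv (t i)) y) \<le> -1}"
      by (intro conjI closedin_lipschitz_sublevel[of 1] lip[OF i] hH) auto
    show "gconvex {y\<in>X. b h (\<phi> (inv (t i)) y) \<le> -1} \<and> gconvex {y\<in>X. b (inv h) (\<phi> (inv (t i)) y) \<le> -1}"
      by (intro conjI gconvex_sublevel conv[OF i] hH)
    have "0 \<le> b h (\<phi> (inv (t i)) y) + b (inv h) (\<phi> (inv (t i)) y)" if "y \<in> X" for y
      unfolding b_def by (rule busemann_opposite[OF ray ray' opp]) (use t i that in simp)
    then show "{y\<in>X. b h (\<phi> (inv (t i)) y) \<le> -1} \<inter> {y\<in>X. b (inv h) (\<phi> (inv (t i)) y) \<le> -1} = {}"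
      by force
  next
    fix S :: "nat set"
    define e where "e i = (if i \<in> S then inv h else h)" for i
    have e: "e i \<in> H" for i by (simp add: e_def H_def)
    have "\<exists>y\<in>X. \<forall>i<m. b (e i) (\<phi> (inv (t i)) y) \<le> -1" if "m \<le> Suc k" for m
      using that
    proof (induction m)
      case 0
      then show ?case using x by auto
    next
      case (Suc m)
      then obtain y where y: "y \<in> X" "\<forall>i<m. b (e i) (\<phi> (inv (t i)) y) \<le> -1" by auto
      obtain N :: nat where N: "(b (e m) (\<phi> (inv (t m)) y) + 1) / L \<le> real N"
        using real_arch_simple by blast
      have m: "m \<le> k" using Suc.prems by simp
      from push[OF m e[of m] y(1), of N] obtain y' where y': "y' \<in> X"
        "\<forall>i\<le>k. i \<noteq> m \<longrightarrow> (\<forall>f\<in>H. b f (\<phi> (inv (t i)) y') = b f (\<phi> (inv (t i)) y))"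
        "b (e m) (\<phi> (inv (t m)) y') = b (e m) (\<phi> (inv (t m)) y) - real N * L" by blast
      have "b (e i) (\<phi> (inv (t i)) y') \<le> -1" if i: "i < Suc m" for i
      proof (cases "i = m")
        case True
        have "b (e m) (\<phi> (inv (t m)) y) + 1 \<le> real N * L" using N L by (simp add: pos_divide_le_eq)
        then show ?thesis using y'(3) True by simp
      next
        case False
        then show ?thesis using y'(2) y(2) e i m by auto
      qed
      then show ?case using y'(1) by blast
    qed
    from this[of "Suc k"] obtain y where y: "y \<in> X" "\<forall>i<Suc k. b (e i) (\<phi> (inv (t i)) y) \<le> -1" by auto
    show "\<exists>y\<in>X. \<forall>i<Suc k. y \<in> (if i \<in> S then {y\<in>X. b (inv h) (\<phi> (inv (t i)) y) \<le> -1}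
        else {y\<in>X. b h (\<phi> (inv (t i)) y) \<le> -1})"
    proof (intro bexI[of _ y] allI impI)
      fix i assume "i < Suc k"
      then have "b (e i) (\<phi> (inv (t i)) y) \<le> -1" using y(2) by blast
      then show "y \<in> (if i \<in> S then {y\<in>X. b (inv h) (\<phi> (inv (t i)) y) \<le> -1}
        else {y\<in>X. b h (\<phi> (inv (t i)) y) \<le> -1})"
        using y(1) by (cases "i \<in> S") (simp_all add: e_def)
    qed (rule y(1))
  qed simp
qed

end

section \<open>Cells and piecewise affine maps\<close>

definition cell :: "nat \<Rightarrow> nat \<Rightarrow> real set" where
  "cell a b = {real a / 2 ^ b ..< (real a + 1) / 2 ^ b}"

lemma in_cell_iff: "0 \<le> x \<Longrightarrow> x \<in> cell a b \<longleftrightarrow> nat \<lfloor>x * 2 ^ b\<rfloor> = a"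
proof -
  assume x: "0 \<le> x"
  have "x \<in> cell a b \<longleftrightarrow> real a \<le> x * 2 ^ b \<and> x * 2 ^ b < real a + 1"
    unfolding cell_def by (simp add: pos_divide_le_eq pos_less_divide_eq)
  also have "\<dots> \<longleftrightarrow> \<lfloor>x * 2 ^ b\<rfloor> = int a" by (simp add: floor_eq_iff)
  also have "\<dots> \<longleftrightarrow> nat \<lfloor>x * 2 ^ b\<rfloor> = a" using x by (simp add: nat_eq_iff)
  finally show ?thesis .
qed

lemma cell_nonneg: "x \<in> cell a b \<Longrightarrow> 0 \<le> x"
proof -
  assume "x \<in> cell a b"
  then have "real a / 2 ^ b \<le> x" by (simp add: cell_def)
  moreover have "0 \<le> real a / 2 ^ b" by simp
  ultimately show ?thesis by linarith
qed

lemma floor_power_less: "0 \<le> x \<Longrightarrow> x < 1 \<Longrightarrow> nat \<lfloor>x * 2 ^ b\<rfloor> < 2 ^ b"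
proof -
  assume x: "0 \<le> x" "x < 1"
  have "x * 2 ^ b < 1 * 2 ^ b" using x by (intro mult_strict_right_mono) auto
  then have "\<lfloor>x * 2 ^ b\<rfloor> < 2 ^ b" by (simp add: floor_less_iff)
  then show ?thesis by (simp add: nat_less_iff x)
qed

lemma cell_subset: "a < 2 ^ b \<Longrightarrow> cell a b \<subseteq> {0..<1}"
proof
  fix x assume a: "a < 2 ^ b" and x: "x \<in> cell a b"
  have "real (Suc a) \<le> 2 ^ b" using a by (metis Suc_leI of_nat_le_iff of_nat_numeral of_nat_power)
  then have "(real a + 1) / 2 ^ b \<le> 1" by (simp add: divide_le_eq_1)
  moreover have "x < (real a + 1) / 2 ^ b" using x by (simp add: cell_def)
  ultimately have "x < 1" by linarith
  with cell_nonneg[OF x] show "x \<in> {0..<1}" by simp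
qed

lemma left_end_in_cell: "real a / 2 ^ b \<in> cell a b"
  by (simp add: cell_def divide_strict_right_mono)

lemma left_end_in_cell_iff:
  assumes "e \<le> b"
  shows "real a / 2 ^ b \<in> cell c e \<longleftrightarrow> a div 2 ^ (b - e) = c"
proof -
  have p: "(2::real) ^ b = 2 ^ (b - e) * 2 ^ e" using assms by (simp add: power_add[symmetric])
  have "real a / 2 ^ b * 2 ^ e = real a / real (2 ^ (b - e))" unfolding p by simp
  then show ?thesis by (simp add: in_cell_iff floor_divide_of_nat_eq del: of_nat_power)
qed

text \<open>An affine piece is recorded by the end points of its domain and range, not by slope and
  constant term, so that compositions and halvings merely track end points.\<close>

definition aff :: "(real \<Rightarrow> real) \<Rightarrow> real \<Rightarrow> real \<Rightarrow> real \<Rightarrow> real \<Rightarrow> bool" where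
  "aff f l u l' u' \<longleftrightarrow> (\<forall>x. l \<le> x \<and> x < u \<longrightarrow> f x = l' + (x - l) * ((u' - l') / (u - l)))"

lemma aff_range:
  assumes f: "aff f l u l' u'" and lu: "l < u" "l' < u'" and x: "l \<le> x" "x < u"
  shows "l' \<le> f x" "f x < u'"
proof -
  have fx: "f x = l' + (x - l) * ((u' - l') / (u - l))" using f x by (simp add: aff_def)
  show "l' \<le> f x" unfolding fx using lu x by simp
  have "(x - l) * ((u' - l') / (u - l)) < (u - l) * ((u' - l') / (u - l))"
    using lu x by (intro mult_strict_right_mono) auto
  also have "\<dots> = u' - l'" using lu by simp
  finally show "f x < u'" unfolding fx by simp
qed

lemma aff_left: "aff f l u l' u' \<Longrightarrow> l < u \<Longrightarrow> f l = l'"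
  by (simp add: aff_def)

lemma aff_compose:
  assumes f: "aff f l u l' u'" and g: "aff g l' u' l'' u''" and lu: "l < u" "l' < u'"
  shows "aff (\<lambda>x. g (f x)) l u l'' u''"
  unfolding aff_def
proof (intro allI impI)
  fix x assume x: "l \<le> x \<and> x < u"
  have r: "l' \<le> f x \<and> f x < u'" using aff_range[OF f lu] x by simp
  have fx: "f x = l' + (x - l) * ((u' - l') / (u - l))" using f x by (simp add: aff_def)
  have slope: "(u' - l') / (u - l) * ((u'' - l'') / (u' - l')) = (u'' - l'') / (u - l)" using lu by simp
  have "g (f x) = l'' + (f x - l') * ((u'' - l'') / (u' - l'))" using g r by (simp add: aff_def)
  also have "f x - l' = (x - l) * ((u' - l') / (u - l))" using fx by simp
  finally show "g (f x) = l'' + (x - l) * ((u'' - l'') / (u - l))" unfolding mult.assoc slope .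
qed

lemma aff_inverse:
  assumes f: "aff f l u l' u'" and lu: "l < u" "l' < u'" and g: "\<And>x. l \<le> x \<Longrightarrow> x < u \<Longrightarrow> g (f x) = x"
  shows "aff g l' u' l u"
  unfolding aff_def
proof (intro allI impI)
  fix y assume y: "l' \<le> y \<and> y < u'"
  define x where "x = l + (y - l') * ((u - l) / (u' - l'))"
  have "aff (\<lambda>y. l + (y - l') * ((u - l) / (u' - l'))) l' u' l u" by (simp add: aff_def)
  from aff_range[OF this lu(2,1)] y have x: "l \<le> x" "x < u" by (simp_all add: x_def)
  have "f x = l' + (x - l) * ((u' - l') / (u - l))" using f x by (simp add: aff_def)
  also have "\<dots> = y" unfolding x_def using lu by simp
  finally show "g y = l + (y - l') * ((u - l) / (u' - l'))" using g[OF x] unfolding x_def by simp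
qed

lemma aff_sub:
  assumes f: "aff f l u l' u'" and s: "l \<le> s" "s < t" "t \<le> u"
  shows "aff f s t (l' + (s - l) * ((u' - l') / (u - l))) (l' + (t - l) * ((u' - l') / (u - l)))"
  unfolding aff_def
proof (intro allI impI)
  fix x assume x: "s \<le> x \<and> x < t"
  define k where "k = (u' - l') / (u - l)"
  have fx: "f x = l' + (x - l) * k" using f x s by (simp add: aff_def k_def)
  have "(l' + (t - l) * k - (l' + (s - l) * k)) = (t - s) * k" by (simp add: algebra_simps)
  then have slope: "(l' + (t - l) * k - (l' + (s - l) * k)) / (t - s) = k" using s by simp
  show "f x = l' + (s - l) * ((u' - l') / (u - l)) + (x - s) *
      ((l' + (t - l) * ((u' - l') / (u - l)) - (l' + (s - l) * ((u' - l') / (u - l)))) / (t - s))"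
    unfolding k_def[symmetric] slope fx by (simp add: algebra_simps)
qed

lemma aff_halves:
  assumes f: "aff f l u l' u'" and lu: "l < u"
  shows "aff f l ((l + u) / 2) l' ((l' + u') / 2)" "aff f ((l + u) / 2) u ((l' + u') / 2) u'"
proof -
  define k where "k = (u' - l') / (u - l)"
  have k: "(u - l) * k = u' - l'" using lu by (simp add: k_def)
  have m: "l' + ((l + u) / 2 - l) * k = (l' + u') / 2"
  proof -
    have "((l + u) / 2 - l) * k = (u - l) * k / 2" by (simp add: field_simps)
    then show ?thesis unfolding k by (simp add: field_simps)
  qed
  show "aff f l ((l + u) / 2) l' ((l' + u') / 2)"
    using aff_sub[OF f, of l "(l + u) / 2", folded k_def, unfolded m] lu by simp
  have u: "l' + (u - l) * k = u'" unfolding k by simp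
  show "aff f ((l + u) / 2) u ((l' + u') / 2) u'"
    using aff_sub[OF f, of "(l + u) / 2" u, folded k_def, unfolded m u] lu by simp
qed

lemma aff_image:
  assumes f: "aff f l u l' u'" and lu: "l < u" "l' < u'"
  shows "f ` {l..<u} = {l'..<u'}"
proof (rule subset_antisym)
  show "f ` {l..<u} \<subseteq> {l'..<u'}" using aff_range[OF f lu] by auto
  show "{l'..<u'} \<subseteq> f ` {l..<u}"
  proof
    fix y assume y: "y \<in> {l'..<u'}"
    define x where "x = l + (y - l') * ((u - l) / (u' - l'))"
    have "aff (\<lambda>y. l + (y - l') * ((u - l) / (u' - l'))) l' u' l u" by (simp add: aff_def)
    from aff_range[OF this lu(2,1)] y have x: "l \<le> x" "x < u" by (simp_all add: x_def)
    have "f x = l' + (x - l) * ((u' - l') / (u - l))" using f x by (simp add: aff_def)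
    also have "\<dots> = y" unfolding x_def using lu by simp
    finally show "y \<in> f ` {l..<u}" using x by force
  qed
qed

lemma aff_imp_increasing_affine_onto:
  assumes f: "aff f l u l' u'" and lu: "l < u" "l' < u'"
  shows "increasing_affine_onto f {l..<u} {l'..<u'}"
  unfolding increasing_affine_onto_def
proof (intro conjI exI ballI)
  define k where "k = (u' - l') / (u - l)"
  show "0 < k" using lu by (simp add: k_def)
  show "f x = k * x + (l' - l * k)" if "x \<in> {l..<u}" for x
    using f that unfolding aff_def k_def[symmetric] by (simp add: algebra_simps)
qed (rule aff_image[OF assms])

lemma increasing_affine_onto_imp_aff:
  assumes f: "increasing_affine_onto f {l..<u} {l'..<u'}" and lu: "l < u" "l' < u'"
  shows "aff f l u l' u'"
proof -
  obtain m c where m: "m > 0" and fm: "\<And>x. x \<in> {l..<u} \<Longrightarrow> f x = m * x + c" and im: "f ` {l..<u} = {l'..<u'}"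
    using f unfolding increasing_affine_onto_def by auto
  define k where "k = m * (u - l)"
  have slope: "(m * l + c + k - (m * l + c)) / (u - l) = m" unfolding k_def using lu by simp
  have a: "aff f l u (m * l + c) (m * l + c + k)"
    unfolding aff_def slope using fm by (auto simp: algebra_simps)
  have k: "0 < k" unfolding k_def using m lu by simp
  have "f ` {l..<u} = {m * l + c..<m * l + c + k}" by (rule aff_image[OF a lu(1)]) (use k in simp)
  then have "l' = m * l + c" "u' = m * l + c + k"
    using im lu(2) k by (auto simp: atLeastLessThan_eq_iff)
  then show ?thesis using a by simp
qed

section \<open>Piecewise affine maps on uniform divisions\<close>

lemma uniform_division: "dyadic_division ((\<lambda>a. cell a b) ` {..<2 ^ b})"
  unfolding dyadic_division_def
proof (intro conjI ballI)
  show "partition_on {0..<1} ((\<lambda>a. cell a b) ` {..<2 ^ b})"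
  proof (rule partition_onI)
    show "\<Union>((\<lambda>a. cell a b) ` {..<2 ^ b}) = {0..<1}"
    proof (intro equalityI subsetI)
      fix x assume "x \<in> {0..<1::real}"
      then have "nat \<lfloor>x * 2 ^ b\<rfloor> < 2 ^ b" "x \<in> cell (nat \<lfloor>x * 2 ^ b\<rfloor>) b"
        using floor_power_less[of x b] in_cell_iff[of x "nat \<lfloor>x * 2 ^ b\<rfloor>" b] by simp_all
      then show "x \<in> \<Union>((\<lambda>a. cell a b) ` {..<2 ^ b})" by blast
    qed (use cell_subset in blast)
    fix p q assume "p \<in> (\<lambda>a. cell a b) ` {..<2 ^ b}" "q \<in> (\<lambda>a. cell a b) ` {..<2 ^ b}" "p \<noteq> q"
    then obtain a c where "p = cell a b" "q = cell c b" "a \<noteq> c" by auto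
    then show "disjnt p q" unfolding disjnt_iff using in_cell_iff cell_nonneg by metis
  qed (use left_end_in_cell in blast)
  fix I assume "I \<in> (\<lambda>a. cell a b) ` {..<2 ^ b}"
  then show "dyadic_piece I" unfolding dyadic_piece_def cell_def by auto
qed simp

lemma cell_lt: "real a / 2 ^ b < (real a + 1) / 2 ^ b"
  by (simp add: divide_strict_right_mono)

text \<open>The images of the cells of one level again form a division, so it is enough to describe
  \<open>f\<close> cell by cell.\<close>

lemma V_mapI:
  assumes f: "f \<in> Bij {0..<1}"
    and a: "\<And>a. a < 2 ^ b \<Longrightarrow>
      \<exists>c e. c < 2 ^ e \<and> aff f (real a / 2 ^ b) ((real a + 1) / 2 ^ b) (real c / 2 ^ e) ((real c + 1) / 2 ^ e)"
  shows "V_map f"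
proof -
  define P where "P = (\<lambda>a. cell a b) ` {..<2 ^ b}"
  have P: "dyadic_division P" unfolding P_def by (rule uniform_division)
  have bij: "inj_on f {0..<1}" "f ` {0..<1} = {0..<1}"
    using f by (auto simp: Bij_def bij_betw_def)
  have PW: "I \<subseteq> {0..<1}" "I \<noteq> {}" if "I \<in> P" for I
    using P that by (auto simp: dyadic_division_def partition_on_def)
  have inj: "inj_on ((`) f) P"
    using bij(1) PW(1) by (intro inj_onI) (metis inj_on_image_eq_iff)
  have img: "\<exists>c e. c < 2 ^ e \<and> f ` I = {real c / 2 ^ e..<(real c + 1) / 2 ^ e} \<and> increasing_affine_onto f I (f ` I)"
    if I: "I \<in> P" for I
  proof -
    obtain x where x: "x < 2 ^ b" "I = cell x b" using I by (auto simp: P_def)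
    from a[OF x(1)] obtain c e where c: "c < 2 ^ e"
      "aff f (real x / 2 ^ b) ((real x + 1) / 2 ^ b) (real c / 2 ^ e) ((real c + 1) / 2 ^ e)" by blast
    have "f ` I = {real c / 2 ^ e..<(real c + 1) / 2 ^ e}"
      using aff_image[OF c(2) cell_lt cell_lt] by (simp add: x(2) cell_def)
    then show ?thesis
      using aff_imp_increasing_affine_onto[OF c(2) cell_lt cell_lt] c(1) by (auto simp: x(2) cell_def)
  qed
  have "dyadic_division ((`) f ` P)"
    unfolding dyadic_division_def
  proof (intro conjI ballI)
    show "finite ((`) f ` P)" using P by (simp add: dyadic_division_def)
    show "partition_on {0..<1} ((`) f ` P)"
    proof (rule partition_onI)
      show "\<Union>((`) f ` P) = {0..<1}"
      proof -
        have "\<Union>((`) f ` P) = f ` \<Union>P" by blast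
        also have "\<Union>P = {0..<1}" using P by (simp add: dyadic_division_def partition_on_def)
        finally show ?thesis using bij(2) by simp
      qed
      fix p q assume "p \<in> (`) f ` P" "q \<in> (`) f ` P" "p \<noteq> q"
      then obtain I J where IJ: "I \<in> P" "J \<in> P" "p = f ` I" "q = f ` J" "I \<noteq> J" by auto
      then have "I \<inter> J = {}" using P by (auto simp: dyadic_division_def partition_on_def disjoint_def)
      then have "f ` I \<inter> f ` J = {}"
        using inj_on_image_Int[OF bij(1), of I J] PW IJ by simp
      then show "disjnt p q" by (simp add: IJ disjnt_def)
    qed (use PW(2) in auto)
    show "dyadic_piece I" if "I \<in> (`) f ` P" for I
      using that img unfolding dyadic_piece_def by fastforce
  qed
  moreover have "bij_betw ((`) f) P ((`) f ` P)" using inj by (simp add: bij_betw_def)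
  ultimately show ?thesis
    unfolding V_map_def using f P img by blast
qed

lemma aff_subcell:
  assumes f: "aff f (real c / 2 ^ e) ((real c + 1) / 2 ^ e) (real c' / 2 ^ e') ((real c' + 1) / 2 ^ e')"
    and a: "a div 2 ^ s = c"
  shows "aff f (real a / 2 ^ (e + s)) ((real a + 1) / 2 ^ (e + s))
    (real (c' * 2 ^ s + a mod 2 ^ s) / 2 ^ (e' + s)) ((real (c' * 2 ^ s + a mod 2 ^ s) + 1) / 2 ^ (e' + s))"
proof -
  define \<rho> where "\<rho> = a mod 2 ^ s"
  have \<rho>: "\<rho> < 2 ^ s" by (simp add: \<rho>_def)
  have "a = c * 2 ^ s + \<rho>" unfolding \<rho>_def a[symmetric] by (rule div_mult_mod_eq[symmetric])
  then have ra: "real a = real c * 2 ^ s + real \<rho>" by simp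
  have r1: "real \<rho> + 1 \<le> 2 ^ s" using \<rho> by (metis Suc_leI of_nat_Suc of_nat_le_iff of_nat_numeral of_nat_power add.commute)
  define A where "A = (2::real) ^ e" define S where "S = (2::real) ^ s" define B where "B = (2::real) ^ e'"
  have pos: "0 < A" "0 < S" "0 < B" by (simp_all add: A_def S_def B_def)
  have slope: "((real c' + 1) / B - real c' / B) / ((real c + 1) / A - real c / A) = A / B"
    using pos by (simp add: field_simps)
  have f': "aff f (real c / A) ((real c + 1) / A) (real c' / B) ((real c' + 1) / B)"
    using f by (simp add: A_def B_def)
  have 1: "real c / A \<le> real a / (A * S)" unfolding ra using pos by (simp add: S_def[symmetric] field_simps)
  have 2: "(real a + 1) / (A * S) \<le> (real c + 1) / A"
  proof -
    have "(real a + 1) / (A * S) \<le> ((real c + 1) * S) / (A * S)"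
      unfolding ra using pos r1 by (intro divide_right_mono) (simp_all add: S_def[symmetric] algebra_simps)
    then show ?thesis using pos by simp
  qed
  have 3: "real c' / B + (real a / (A * S) - real c / A) * (A / B) = (real c' * S + real \<rho>) / (B * S)"
    and 4: "real c' / B + ((real a + 1) / (A * S) - real c / A) * (A / B) = (real c' * S + real \<rho> + 1) / (B * S)"
    unfolding ra using pos by (simp_all add: S_def[symmetric] field_simps)
  have "aff f (real a / (A * S)) ((real a + 1) / (A * S)) ((real c' * S + real \<rho>) / (B * S)) ((real c' * S + real \<rho> + 1) / (B * S))"
    using aff_sub[OF f' 1 _ 2] pos unfolding slope 3 4 by (simp add: divide_strict_right_mono)
  then show ?thesis by (simp add: A_def B_def S_def \<rho>_def power_add)
qed

text \<open>Every division is refined by a uniform one. Going \<open>m\<close> levels beyond the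
  deepest piece also forces all image cells to level at least \<open>m\<close>, the coarsest level
  that \<open>is_division\<close> admits.\<close>

lemma V_mapD:
  assumes f: "V_map f"
  obtains L where "m \<le> L" "\<And>a. a < 2 ^ L \<Longrightarrow>
      \<exists>c e. c < 2 ^ e \<and> m \<le> e \<and> aff f (real a / 2 ^ L) ((real a + 1) / 2 ^ L) (real c / 2 ^ e) ((real c + 1) / 2 ^ e)"
proof -
  from f obtain P Q \<sigma> where P: "dyadic_division P" and Q: "dyadic_division Q" and \<sigma>: "bij_betw \<sigma> P Q"
    and aff: "\<And>I. I \<in> P \<Longrightarrow> increasing_affine_onto f I (\<sigma> I)"
    unfolding V_map_def by blast
  have "\<forall>I\<in>P. \<exists>a b. a < 2 ^ b \<and> I = cell a b"
    using P by (auto simp: dyadic_division_def dyadic_piece_def cell_def)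
  then obtain \<alpha> \<beta> where \<alpha>: "\<And>I. I \<in> P \<Longrightarrow> \<alpha> I < 2 ^ \<beta> I \<and> I = cell (\<alpha> I) (\<beta> I)" by metis
  have fin: "finite (\<beta> ` P)" using P by (simp add: dyadic_division_def)
  define B where "B = Max (insert 0 (\<beta> ` P))"
  have B: "\<beta> I \<le> B" if "I \<in> P" for I unfolding B_def by (rule Max_ge) (use fin that in auto)
  show ?thesis
  proof (rule that[of "B + m"])
    show "m \<le> B + m" by simp
    fix a :: nat assume a: "a < 2 ^ (B + m)"
    have "real a / 2 ^ (B + m) \<in> {0..<1}" using cell_subset[OF a] left_end_in_cell by blast
    then obtain I where I: "I \<in> P" "real a / 2 ^ (B + m) \<in> I"
      using P unfolding dyadic_division_def partition_on_def by blast
    define s where "s = B + m - \<beta> I"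
    have s: "B + m = \<beta> I + s" "m \<le> s" using B[OF I(1)] by (auto simp: s_def)
    have "real a / 2 ^ (B + m) \<in> cell (\<alpha> I) (\<beta> I)" using I \<alpha>[OF I(1)] by simp
    then have div: "a div 2 ^ s = \<alpha> I"
      unfolding s_def using B[OF I(1)] by (subst (asm) left_end_in_cell_iff) auto
    have "\<sigma> I \<in> Q" using \<sigma> I(1) by (auto simp: bij_betw_def)
    then obtain c e where c: "c < 2 ^ e" "\<sigma> I = cell c e"
      using Q by (auto simp: dyadic_division_def dyadic_piece_def cell_def)
    have "increasing_affine_onto f {real (\<alpha> I) / 2 ^ \<beta> I ..< (real (\<alpha> I) + 1) / 2 ^ \<beta> I} {real c / 2 ^ e ..< (real c + 1) / 2 ^ e}"
      using aff[OF I(1)] \<alpha>[OF I(1)] c by (simp add: cell_def)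
    from aff_subcell[OF increasing_affine_onto_imp_aff[OF this cell_lt cell_lt] div]
    have "aff f (real a / 2 ^ (B + m)) ((real a + 1) / 2 ^ (B + m))
      (real (c * 2 ^ s + a mod 2 ^ s) / 2 ^ (e + s)) ((real (c * 2 ^ s + a mod 2 ^ s) + 1) / 2 ^ (e + s))"
      using s by simp
    moreover have "c * 2 ^ s + a mod 2 ^ s < 2 ^ (e + s)"
    proof -
      have "c * 2 ^ s + a mod 2 ^ s < c * 2 ^ s + 2 ^ s" by simp
      also have "\<dots> = (c + 1) * 2 ^ s" by simp
      also have "\<dots> \<le> 2 ^ e * 2 ^ s" using c(1) by (intro mult_right_mono) auto
      finally show ?thesis by (simp add: power_add)
    qed
    moreover have "m \<le> e + s" using s by simp
    ultimately show "\<exists>c e. c < 2 ^ e \<and> m \<le> e \<and>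
        aff f (real a / 2 ^ (B + m)) ((real a + 1) / 2 ^ (B + m)) (real c / 2 ^ e) ((real c + 1) / 2 ^ e)"
      by blast
  qed
qed

section \<open>The topology of the circle\<close>

lemma continuous_map_frac: "continuous_map euclideanreal circle_topology frac"
  unfolding continuous_map_def
proof (intro conjI allI impI)
  show "frac \<in> topspace euclideanreal \<rightarrow> topspace circle_topology"
    by (simp add: topspace_circle_topology frac_lt_1)
  fix U assume "openin circle_topology U"
  then obtain O' where O': "open O'" "{x \<in> {0..1}. circle_proj x \<in> U} = {0..1} \<inter> O'"
    unfolding openin_circle_topology openin_open by auto
  have "\<exists>e>0. \<forall>x. dist x x0 < e \<longrightarrow> frac x \<in> U" if x0: "frac x0 \<in> U" for x0
  proof -
    define n where "n = real_of_int \<lfloor>x0\<rfloor>"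
    have n: "n \<in> \<int>" by (simp add: n_def)
    have z: "frac x0 = x0 - n" "0 \<le> x0 - n" "x0 - n < 1" unfolding n_def by (simp_all add: frac_def) linarith+
    have O'U: "circle_proj y \<in> U" if "y \<in> O'" "0 \<le> y" "y \<le> 1" for y
    proof -
      have "y \<in> {x \<in> {0..1}. circle_proj x \<in> U}" unfolding O'(2) using that by simp
      then show ?thesis by simp
    qed
    have UO': "y \<in> O'" if "0 \<le> y" "y \<le> 1" "circle_proj y \<in> U" for y
    proof -
      have "y \<in> {x \<in> {0..1}. circle_proj x \<in> U}" using that by simp
      then show ?thesis unfolding O'(2) by simp
    qed
    have "x0 - n \<in> O'" using UO'[of "x0 - n"] z x0 by (simp add: circle_proj_def)
    then obtain e1 where e1: "e1 > 0" "\<And>y. dist y (x0 - n) < e1 \<Longrightarrow> y \<in> O'"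
      using O'(1) unfolding open_dist by blast
    show ?thesis
    proof (cases "x0 - n = 0")
      case False
      show ?thesis
      proof (intro exI[of _ "min e1 (min (x0 - n) (1 - (x0 - n)))"] conjI allI impI)
        show "0 < min e1 (min (x0 - n) (1 - (x0 - n)))" using e1 z False by simp
        fix x assume x: "dist x x0 < min e1 (min (x0 - n) (1 - (x0 - n)))"
        then have b: "0 < x - n" "x - n < 1" by (auto simp: dist_real_def)
        have "frac x = x - n" using n b by (simp add: frac_unique_iff)
        moreover have "x - n \<in> O'" by (rule e1(2)) (use x in \<open>simp add: dist_real_def\<close>)
        ultimately show "frac x \<in> U" using O'U[of "x - n"] b by (simp add: circle_proj_def)
      qed
    next
      \<comment> \<open>Near an integer, points on the right have small fractional part and points
        on the left one close to 1. As \<open>circle_proj\<close> identifies 0 and 1,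
        \<open>O'\<close> contains neighbourhoods of both.\<close>
      case True
      have "frac x0 = 0" using z(1) True by simp
      with x0 have "0 \<in> U" by simp
      then have "1 \<in> O'" using UO'[of 1] by (simp add: circle_proj_def)
      then obtain e2 where e2: "e2 > 0" "\<And>y. dist y 1 < e2 \<Longrightarrow> y \<in> O'"
        using O'(1) unfolding open_dist by blast
      show ?thesis
      proof (intro exI[of _ "min e1 (min e2 1)"] conjI allI impI)
        show "0 < min e1 (min e2 1)" using e1 e2 by simp
        fix x assume x: "dist x x0 < min e1 (min e2 1)"
        show "frac x \<in> U"
        proof (cases "x < x0")
          case False
          have b: "0 \<le> x - n" "x - n < 1" using x False True by (auto simp: dist_real_def)
          have "frac x = x - n" using n b by (simp add: frac_unique_iff)
          moreover have "x - n \<in> O'" by (rule e1(2)) (use x in \<open>simp add: dist_real_def\<close>)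
          ultimately show "frac x \<in> U" using O'U[of "x - n"] b by (simp add: circle_proj_def)
        next
          case lt: True
          have b: "0 \<le> x - n + 1" "x - n + 1 < 1" using x lt True by (auto simp: dist_real_def)
          have "x - (x - n + 1) \<in> \<int>" using n by simp
          then have "frac x = x - n + 1" using b by (simp only: frac_unique_iff)
          moreover have "x - n + 1 \<in> O'" by (rule e2(2)) (use x True in \<open>simp add: dist_real_def\<close>)
          ultimately show "frac x \<in> U" using O'U[of "x - n + 1"] b by (simp add: circle_proj_def)
        qed
      qed
    qed
  qed
  then show "openin euclideanreal {x \<in> topspace euclideanreal. frac x \<in> U}"
    by (simp add: open_dist)
qed

text \<open>Continuity on the quotient is checked on [0, 1] through a lift \<open>F\<close> to the
  real line.\<close>

lemma circle_continuousI:
  assumes F: "continuous_on {0..1} F" and f: "\<And>x. x \<in> {0..1} \<Longrightarrow> f (circle_proj x) = frac (F x)"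
  shows "continuous_map circle_topology circle_topology f"
proof (rule continuous_compose_quotient_map[OF quotient_map_circle_proj])
  have "continuous_map (top_of_set {0..1}) circle_topology (frac \<circ> F)"
    by (rule continuous_map_compose[OF _ continuous_map_frac]) (simp add: F)
  then show "continuous_map (top_of_set {0..1}) circle_topology (f \<circ> circle_proj)"
    by (rule continuous_map_eq) (simp add: f)
qed

lemma circle_homeomorphicI:
  assumes "continuous_map circle_topology circle_topology f" "continuous_map circle_topology circle_topology g"
    "\<And>x. x \<in> {0..<1} \<Longrightarrow> g (f x) = x" "\<And>x. x \<in> {0..<1} \<Longrightarrow> f (g x) = x"
  shows "homeomorphic_map circle_topology circle_topology f"
  by (rule homeomorphic_maps_imp_map[of _ _ _ g])
     (use assms in \<open>simp add: homeomorphic_maps_def topspace_circle_topology\<close>)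

lemma continuous_map_circle_cis: "continuous_map circle_topology euclidean (\<lambda>x. cis (2 * pi * x))"
proof (rule continuous_compose_quotient_map[OF quotient_map_circle_proj])
  have "continuous_map (top_of_set {0..1}) euclidean (\<lambda>x::real. cis (2 * pi * x))"
    by (simp, intro continuous_intros)
  then show "continuous_map (top_of_set {0..1}) euclidean ((\<lambda>x. cis (2 * pi * x)) \<circ> circle_proj)"
    by (rule continuous_map_eq) (auto simp: circle_proj_def)
qed

text \<open>This is how elements of T are seen to respect neighbouring pieces. Through
  \<open>cis\<close> the circle is mapped to a Hausdorff space, where a continuous function
  vanishing on [l, u) also vanishes at \<open>u\<close>; the remaining integer \<open>n\<close> is
  absorbed by \<open>circle_proj\<close>.\<close>

lemma circle_left_limit:
  assumes cont: "continuous_map circle_topology circle_topology f" and f: "aff f l u l' u'"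
    and lu: "0 \<le> l" "l < u" "u \<le> 1" and lu': "0 \<le> l'" "l' < u'" "u' \<le> 1"
  shows "f (circle_proj u) = circle_proj u'"
proof -
  define k where "k = (u' - l') / (u - l)"
  define h where "h x = cis (2 * pi * f (circle_proj x)) - cis (2 * pi * (l' + (x - l) * k))" for x
  have "continuous_map (top_of_set {0..1}) euclidean ((\<lambda>x. cis (2 * pi * x)) \<circ> (f \<circ> circle_proj))"
    by (intro continuous_map_compose[OF _ continuous_map_circle_cis] continuous_map_compose[OF _ cont]
        quotient_imp_continuous_map quotient_map_circle_proj)
  then have "continuous_on {0..1} (\<lambda>x. cis (2 * pi * f (circle_proj x)))" by (simp add: o_def)
  then have *: "continuous_on {l..u} (\<lambda>x. cis (2 * pi * f (circle_proj x)))"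
    by (rule continuous_on_subset) (use lu in auto)
  have "continuous_on {l..u} h"
    unfolding h_def by (rule continuous_on_diff[OF *]) (intro continuous_intros)
  then have "continuous_on (closure {l..<u}) h" using lu by simp
  moreover have "h x = 0" if "x \<in> {l..<u}" for x
    using f that lu unfolding h_def aff_def k_def by (simp add: circle_proj_def)
  ultimately have "h u = 0" by (rule continuous_constant_on_closure) (use lu in auto)
  moreover have "l' + (u - l) * k = u'" unfolding k_def using lu by simp
  ultimately have "cis (2 * pi * f (circle_proj u)) = cis (2 * pi * u')" by (simp add: h_def)
  then have "sin (2 * pi * f (circle_proj u)) = sin (2 * pi * u') \<and> cos (2 * pi * f (circle_proj u)) = cos (2 * pi * u')"
    by (simp add: complex_eq_iff)
  then obtain n :: int where "2 * pi * f (circle_proj u) = 2 * pi * u' + 2 * pi * of_int n"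
    using sin_cos_eq_iff[of "2 * pi * f (circle_proj u)" "2 * pi * u'"] by (auto simp: algebra_simps)
  then have "2 * pi * f (circle_proj u) = 2 * pi * (u' + of_int n)" by (simp add: algebra_simps)
  then have n: "f (circle_proj u) = u' + of_int n" by simp
  have "circle_proj u \<in> {0..<1}" using lu by (auto simp: circle_proj_def)
  then have "f (circle_proj u) \<in> {0..<1}"
    using continuous_map_image_subset_topspace[OF cont] unfolding topspace_circle_topology by blast
  then have "n = 0 \<and> u' < 1 \<or> n = -1 \<and> u' = 1" using n lu' by auto
  then show ?thesis using n by (auto simp: circle_proj_def)
qed

section \<open>Rotations and bumps\<close>

definition rot :: "real \<Rightarrow> real \<Rightarrow> real" where
  "rot w x = (if x < 1 - w then x + w else x + w - 1)"

text \<open>For adjacent intervals \<open>A = [a, a + c)\<close> and \<open>B = [a + c, a + 2c)\<close>, this maps \<open>A\<close> to its left half,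
  the left half of \<open>B\<close> to the right half of \<open>A\<close>, and the right half of \<open>B\<close> to \<open>B\<close>.\<close>

definition bump :: "real \<Rightarrow> real \<Rightarrow> real \<Rightarrow> real" where
  "bump a c x = (if x < a then x else if x < a + c then a + (x - a) / 2
     else if x < a + 3 * c / 2 then x - c / 2 else if x < a + 2 * c then 2 * x - a - 2 * c else x)"

definition bump_inv :: "real \<Rightarrow> real \<Rightarrow> real \<Rightarrow> real" where
  "bump_inv a c x = (if x < a then x else if x < a + c / 2 then 2 * x - a
     else if x < a + c then x + c / 2 else if x < a + 2 * c then x / 2 + a / 2 + c else x)"

lemma bump_inverse: "0 < c \<Longrightarrow> bump_inv a c (bump a c x) = x" "0 < c \<Longrightarrow> bump a c (bump_inv a c x) = x"
  by (auto simp: bump_def bump_inv_def field_simps)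

text \<open>Written with \<open>min\<close> and \<open>max\<close> the map is visibly
  continuous.\<close>

lemma bump_alt: "0 < c \<Longrightarrow> bump a c x = max (min x (max (a / 2 + x / 2) (x - c / 2))) (min x (2 * x - a - 2 * c))"
  by (auto simp: bump_def max_def min_def field_simps)

lemma bump_inv_alt: "0 < c \<Longrightarrow> bump_inv a c x = min (max x (min (2 * x - a) (x + c / 2))) (max x (x / 2 + a / 2 + c))"
  by (auto simp: bump_inv_def max_def min_def field_simps)

lemma bump_in: "0 < c \<Longrightarrow> 0 \<le> a \<Longrightarrow> a + 2 * c \<le> 1 \<Longrightarrow> x \<in> {0..<1} \<Longrightarrow> bump a c x \<in> {0..<1}"
  "0 < c \<Longrightarrow> 0 \<le> a \<Longrightarrow> a + 2 * c \<le> 1 \<Longrightarrow> x \<in> {0..<1} \<Longrightarrow> bump_inv a c x \<in> {0..<1}"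
  by (auto simp: bump_def bump_inv_def field_simps)

section \<open>Bumps and rotations as elements of the groups\<close>

lemma restrict_BijI:
  assumes "\<And>x. x \<in> S \<Longrightarrow> f x \<in> S" "\<And>x. x \<in> S \<Longrightarrow> g x \<in> S" "\<And>x. x \<in> S \<Longrightarrow> g (f x) = x" "\<And>x. x \<in> S \<Longrightarrow> f (g x) = x"
  shows "restrict f S \<in> Bij S"
proof -
  have "bij_betw (restrict f S) S S"
    by (rule bij_betw_byWitness[of _ g]) (use assms in auto)
  then show ?thesis by (simp add: Bij_def)
qed

lemma homeomorphic_bump:
  assumes c: "0 < c" "0 \<le> a" "a + 2 * c \<le> 1"
  shows "homeomorphic_map circle_topology circle_topology (restrict (bump a c) {0..<1})"
proof (rule circle_homeomorphicI)
  have f: "frac y = y" if "y \<in> {0..<1}" for y :: real using that by (simp add: frac_eq)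
  show "continuous_map circle_topology circle_topology (restrict (bump a c) {0..<1})"
  proof (rule circle_continuousI[of "bump a c"])
    show "continuous_on {0..1} (bump a c)"
      unfolding bump_alt[OF c(1)] by (intro continuous_intros) simp_all
    show "restrict (bump a c) {0..<1} (circle_proj x) = frac (bump a c x)" if "x \<in> {0..1}" for x
    proof (cases "x = 1")
      case True
      then show ?thesis using c by (simp add: circle_proj_def bump_def)
    next
      case False
      then show ?thesis using that f[OF bump_in(1)[OF c, of x]] by (simp add: circle_proj_def)
    qed
  qed
  show "continuous_map circle_topology circle_topology (restrict (bump_inv a c) {0..<1})"
  proof (rule circle_continuousI[of "bump_inv a c"])
    show "continuous_on {0..1} (bump_inv a c)"
      unfolding bump_inv_alt[OF c(1)] by (intro continuous_intros) simp_all
    show "restrict (bump_inv a c) {0..<1} (circle_proj x) = frac (bump_inv a c x)" if "x \<in> {0..1}" for x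
    proof (cases "x = 1")
      case True
      then show ?thesis using c by (simp add: circle_proj_def bump_inv_def)
    next
      case False
      then show ?thesis using that f[OF bump_in(2)[OF c, of x]] by (simp add: circle_proj_def)
    qed
  qed
qed (use bump_in[OF c] bump_inverse[OF c(1)] in simp_all)

lemma rot_frac: "0 < w \<Longrightarrow> w < 1 \<Longrightarrow> x \<in> {0..<1} \<Longrightarrow> rot w x = frac (x + w)"
proof -
  assume w: "0 < w" "w < 1" "x \<in> {0..<1}"
  show ?thesis
  proof (cases "x < 1 - w")
    case False
    have "frac (x + w) = x + w - 1" using w False by (subst frac_unique_iff) auto
    then show ?thesis using False by (simp add: rot_def)
  qed (use w in \<open>simp add: rot_def frac_eq\<close>)
qed

lemma rot_inverse: "0 < w \<Longrightarrow> w < 1 \<Longrightarrow> x \<in> {0..<1} \<Longrightarrow> rot (1 - w) (rot w x) = x"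
  by (auto simp: rot_def)

lemma rot_in: "0 < w \<Longrightarrow> w < 1 \<Longrightarrow> x \<in> {0..<1} \<Longrightarrow> rot w x \<in> {0..<1}"
  by (auto simp: rot_def)

lemma continuous_rot:
  assumes w: "0 < w" "w < 1"
  shows "continuous_map circle_topology circle_topology (restrict (rot w) {0..<1})"
proof (rule circle_continuousI[of "\<lambda>x. x + w"])
  show "continuous_on {0..1} (\<lambda>x. x + w)" by (intro continuous_intros)
  show "restrict (rot w) {0..<1} (circle_proj x) = frac (x + w)" if "x \<in> {0..1}" for x
  proof (cases "x = 1")
    case True
    have "frac (1 + w) = w" using w by (subst frac_unique_iff) auto
    then show ?thesis using True w by (simp add: circle_proj_def rot_def)
  qed (use that rot_frac[OF w, of x] in \<open>simp add: circle_proj_def\<close>)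
qed

lemma homeomorphic_rot:
  assumes w: "0 < w" "w < 1"
  shows "homeomorphic_map circle_topology circle_topology (restrict (rot w) {0..<1})"
  by (rule circle_homeomorphicI[OF continuous_rot continuous_rot[of "1 - w"]])
     (use w rot_in[of w] rot_in[of "1 - w"] rot_inverse[of w] rot_inverse[of "1 - w"] in simp_all)

text \<open>At level \<open>m + 2\<close> the two moved intervals consist of four cells. The first
  two shrink to the cells 0 and 1 of level \<open>m + 3\<close>, the third moves to cell 1 of the
  same level, the fourth is stretched over cell 1 of level \<open>m + 1\<close>, and all others
  stay.\<close>

lemma V_map_bump: "V_map (restrict (bump 0 (1 / 2 ^ Suc m)) {0..<1})"
proof (rule V_mapI[of _ "m + 2"])
  define w :: real where "w = 1 / 2 ^ Suc m"
  have w: "0 < w" "0 + 2 * w \<le> 1" by (simp_all add: w_def)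
  show "restrict (bump 0 (1 / 2 ^ Suc m)) {0..<1} \<in> Bij {0..<1}"
    unfolding w_def[symmetric]
    by (rule restrict_BijI[of _ _ "bump_inv 0 w"]) (use bump_in[OF w(1) order_refl w(2)] bump_inverse[OF w(1)] in auto)
  fix a :: nat assume a: "a < 2 ^ (m + 2)"
  have p: "(2::real) ^ (m + 2) = 2 / w" "(2::real) ^ (m + 3) = 4 / w" "(2::real) ^ (m + 1) = 1 / w"
    by (simp_all add: w_def power_add)
  have W: "x \<in> {0..<1}" if "real a / 2 ^ (m + 2) \<le> x" "x < (real a + 1) / 2 ^ (m + 2)" for x
    by (rule subsetD[OF cell_subset[OF a]], unfold cell_def atLeastLessThan_iff) (intro conjI that)
  have fx: "restrict (bump 0 (1 / 2 ^ Suc m)) {0..<1} x = bump 0 w x"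
    if "real a / 2 ^ (m + 2) \<le> x" "x < (real a + 1) / 2 ^ (m + 2)" for x
    using W[OF that] by (simp add: w_def)
  have e: "real a / 2 ^ (m + 2) = real a * w / 2" "(real a + 1) / 2 ^ (m + 2) = real a * w / 2 + w / 2"
    unfolding p using w by (simp_all add: field_simps)
  have up: "(real c + 1) / 2 ^ b = real c / 2 ^ b + 1 / 2 ^ b" for b c by (simp add: add_divide_distrib)
  consider "a = 0" | "a = 1" | "a = 2" | "a = 3" | "4 \<le> a" by linarith
  then show "\<exists>c e. c < 2 ^ e \<and> aff (restrict (bump 0 (1 / 2 ^ Suc m)) {0..<1}) (real a / 2 ^ (m + 2))
      ((real a + 1) / 2 ^ (m + 2)) (real c / 2 ^ e) ((real c + 1) / 2 ^ e)"
  proof cases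
    case 1
    show ?thesis unfolding aff_def
    proof (intro exI conjI allI impI)
      fix x assume x: "real a / 2 ^ (m + 2) \<le> x \<and> x < (real a + 1) / 2 ^ (m + 2)"
      show "restrict (bump 0 (1 / 2 ^ Suc m)) {0..<1} x = real 0 / 2 ^ (m + 3) + (x - real a / 2 ^ (m + 2)) *
        (((real 0 + 1) / 2 ^ (m + 3) - real 0 / 2 ^ (m + 3)) / ((real a + 1) / 2 ^ (m + 2) - real a / 2 ^ (m + 2)))"
        using x w unfolding fx[OF conjunct1[OF x] conjunct2[OF x]] e up p 1 by (simp add: bump_def)
    qed simp
  next
    case 2
    show ?thesis unfolding aff_def
    proof (intro exI conjI allI impI)
      show "1 < (2::nat) ^ (m + 3)" by (rule one_less_power) auto
      fix x assume x: "real a / 2 ^ (m + 2) \<le> x \<and> x < (real a + 1) / 2 ^ (m + 2)"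
      show "restrict (bump 0 (1 / 2 ^ Suc m)) {0..<1} x = real 1 / 2 ^ (m + 3) + (x - real a / 2 ^ (m + 2)) *
        (((real 1 + 1) / 2 ^ (m + 3) - real 1 / 2 ^ (m + 3)) / ((real a + 1) / 2 ^ (m + 2) - real a / 2 ^ (m + 2)))"
        using x w unfolding fx[OF conjunct1[OF x] conjunct2[OF x]] e up p 2 by (auto simp: bump_def field_simps)
    qed
  next
    case 3
    show ?thesis unfolding aff_def
    proof (intro exI conjI allI impI)
      show "1 < (2::nat) ^ (m + 2)" by (rule one_less_power) auto
      fix x assume x: "real a / 2 ^ (m + 2) \<le> x \<and> x < (real a + 1) / 2 ^ (m + 2)"
      show "restrict (bump 0 (1 / 2 ^ Suc m)) {0..<1} x = real 1 / 2 ^ (m + 2) + (x - real a / 2 ^ (m + 2)) *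
        (((real 1 + 1) / 2 ^ (m + 2) - real 1 / 2 ^ (m + 2)) / ((real a + 1) / 2 ^ (m + 2) - real a / 2 ^ (m + 2)))"
        using x w unfolding fx[OF conjunct1[OF x] conjunct2[OF x]] e up p 3 by (simp add: bump_def)
    qed
  next
    case 4
    show ?thesis unfolding aff_def
    proof (intro exI conjI allI impI)
      show "1 < (2::nat) ^ (m + 1)" by (rule one_less_power) auto
      fix x assume x: "real a / 2 ^ (m + 2) \<le> x \<and> x < (real a + 1) / 2 ^ (m + 2)"
      show "restrict (bump 0 (1 / 2 ^ Suc m)) {0..<1} x = real 1 / 2 ^ (m + 1) + (x - real a / 2 ^ (m + 2)) *
        (((real 1 + 1) / 2 ^ (m + 1) - real 1 / 2 ^ (m + 1)) / ((real a + 1) / 2 ^ (m + 2) - real a / 2 ^ (m + 2)))"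
        using x w unfolding fx[OF conjunct1[OF x] conjunct2[OF x]] e up p 4 by (simp add: bump_def)
    qed
  next
    case 5
    show ?thesis unfolding aff_def
    proof (intro exI conjI allI impI)
      show "a < 2 ^ (m + 2)" by (rule a)
      fix x assume x: "real a / 2 ^ (m + 2) \<le> x \<and> x < (real a + 1) / 2 ^ (m + 2)"
      have "4 * w \<le> real a * w" using 5 w by (intro mult_right_mono) auto
      then have "2 * w \<le> x" using x unfolding e by linarith
      then show "restrict (bump 0 (1 / 2 ^ Suc m)) {0..<1} x = real a / 2 ^ (m + 2) + (x - real a / 2 ^ (m + 2)) *
        (((real a + 1) / 2 ^ (m + 2) - real a / 2 ^ (m + 2)) / ((real a + 1) / 2 ^ (m + 2) - real a / 2 ^ (m + 2)))"
        using w unfolding fx[OF conjunct1[OF x] conjunct2[OF x]] e by (simp add: bump_def)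
    qed
  qed
qed

lemma V_map_permute_cells:
  assumes f: "restrict f {0..<1} \<in> Bij {0..<1}"
    and \<sigma>: "\<And>a. a < 2 ^ m \<Longrightarrow> \<sigma> a < 2 ^ m"
    and f\<sigma>: "\<And>a x. a < 2 ^ m \<Longrightarrow> x \<in> cell a m \<Longrightarrow> f x = x + (real (\<sigma> a) - real a) / 2 ^ m"
  shows "V_map (restrict f {0..<1})"
proof (rule V_mapI[OF f])
  fix a :: nat assume a: "a < 2 ^ m"
  have "aff (restrict f {0..<1}) (real a / 2 ^ m) ((real a + 1) / 2 ^ m) (real (\<sigma> a) / 2 ^ m) ((real (\<sigma> a) + 1) / 2 ^ m)"
    unfolding aff_def
  proof (intro allI impI)
    fix x assume "real a / 2 ^ m \<le> x \<and> x < (real a + 1) / 2 ^ m"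
    then have x: "x \<in> cell a m" by (simp add: cell_def)
    have one: "((real (\<sigma> a) + 1) / 2 ^ m - real (\<sigma> a) / 2 ^ m) / ((real a + 1) / 2 ^ m - real a / 2 ^ m) = 1"
      by (simp add: diff_divide_distrib[symmetric])
    show "restrict f {0..<1} x = real (\<sigma> a) / 2 ^ m + (x - real a / 2 ^ m) *
      (((real (\<sigma> a) + 1) / 2 ^ m - real (\<sigma> a) / 2 ^ m) / ((real a + 1) / 2 ^ m - real a / 2 ^ m))"
      unfolding one using subsetD[OF cell_subset[OF a] x] f\<sigma>[OF a x] by (simp add: diff_divide_distrib)
  qed
  then show "\<exists>c e. c < 2 ^ e \<and> aff (restrict f {0..<1}) (real a / 2 ^ m) ((real a + 1) / 2 ^ m) (real c / 2 ^ e) ((real c + 1) / 2 ^ e)"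
    using \<sigma>[OF a] by blast
qed

section \<open>Cells and generators of T and V\<close>

locale thompson_group = group G for G :: "(real \<Rightarrow> real) monoid" (structure) +
  fixes m :: nat
  assumes thompson: "G = thompson_T \<or> G = thompson_V" and m2: "2 \<le> m"
begin

definition w :: real where "w = 1 / 2 ^ m"

definition M :: nat where "M = 2 ^ m"

lemma w_bounds: "0 < w" "4 * w \<le> 1"
proof -
  have "(2::real) ^ 2 \<le> 2 ^ m" using m2 by (intro power_increasing) auto
  then show "4 * w \<le> 1" by (simp add: w_def)
qed (simp add: w_def)

lemma M_w: "real M * w = 1"
  by (simp add: M_def w_def)

lemma M_ge: "4 \<le> M"
proof -
  have "(2::nat) ^ 2 \<le> 2 ^ m" using m2 by (intro power_increasing) auto
  then show ?thesis by (simp add: M_def)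
qed

lemma carrier_V_map: "g \<in> carrier G \<Longrightarrow> V_map g"
  using thompson by (auto simp: thompson_T_def thompson_V_def)

lemma carrier_Bij: "g \<in> carrier G \<Longrightarrow> g \<in> Bij {0..<1}"
  using carrier_V_map by (simp add: V_map_def)

lemma carrierI:
  "V_map g \<Longrightarrow> homeomorphic_map circle_topology circle_topology g \<Longrightarrow> g \<in> carrier G"
  using thompson by (auto simp: thompson_T_def thompson_V_def)

lemma mult_apply: "g \<in> carrier G \<Longrightarrow> h \<in> carrier G \<Longrightarrow> x \<in> {0..<1} \<Longrightarrow> (g \<otimes> h) x = g (h x)"
  using thompson carrier_Bij[of g] carrier_Bij[of h]
  by (auto simp: thompson_T_def thompson_V_def BijGroup_def compose_eq)

lemma one_apply: "x \<in> {0..<1} \<Longrightarrow> \<one> x = x"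
  using thompson by (auto simp: thompson_T_def thompson_V_def BijGroup_def)

lemma apply_in: "g \<in> carrier G \<Longrightarrow> x \<in> {0..<1} \<Longrightarrow> g x \<in> {0..<1}"
  by (rule funcset_mem[OF Bij_imp_funcset[OF carrier_Bij]])

lemma apply_eq_iff: "g \<in> carrier G \<Longrightarrow> x \<in> {0..<1} \<Longrightarrow> y \<in> {0..<1} \<Longrightarrow> g x = g y \<longleftrightarrow> x = y"
  using carrier_Bij[of g] unfolding Bij_def bij_betw_def by (auto dest: inj_onD)

lemma carrier_eqI:
  assumes "g \<in> carrier G" "h \<in> carrier G" "\<And>x. x \<in> {0..<1} \<Longrightarrow> g x = h x"
  shows "g = h"
  using extensionalityI[OF Bij_imp_extensional[OF carrier_Bij[OF assms(1)]] Bij_imp_extensional[OF carrier_Bij[OF assms(2)]]]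
    assms(3) by blast

lemma inv_apply:
  assumes "g \<in> carrier G" "x \<in> {0..<1}"
  shows "(inv g) (g x) = x" "g ((inv g) x) = x"
  using mult_apply[of "inv g" g x] mult_apply[of g "inv g" x] assms one_apply by simp_all

text \<open>Group elements are extensional functions on [0, 1), whereas formulas are total.
  Comparing them on [0, 1) only keeps calculations with formulas free of restrictions.\<close>

definition represents :: "(real \<Rightarrow> real) \<Rightarrow> (real \<Rightarrow> real) \<Rightarrow> bool" where
  "represents g f \<longleftrightarrow> g \<in> carrier G \<and> (\<forall>x\<in>{0..<1}. g x = f x)"

lemma representsD: "represents g f \<Longrightarrow> g \<in> carrier G" "represents g f \<Longrightarrow> x \<in> {0..<1} \<Longrightarrow> g x = f x"
  by (simp_all add: represents_def)

lemma represents_cong: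
  "represents g f \<Longrightarrow> (\<And>x. x \<in> {0..<1} \<Longrightarrow> f x = f' x) \<Longrightarrow> represents g f'"
  by (simp add: represents_def)

lemma represents_eqI: "represents g f \<Longrightarrow> represents h f \<Longrightarrow> g = h"
  by (rule carrier_eqI) (auto simp: represents_def)

lemma represents_mult:
  assumes g: "represents g f" and h: "represents h f'"
  shows "represents (g \<otimes> h) (\<lambda>x. f (f' x))"
  unfolding represents_def
proof (intro conjI ballI)
  fix x :: real assume x: "x \<in> {0..<1}"
  have "g (h x) = f (h x)" by (rule representsD(2)[OF g apply_in[OF representsD(1)[OF h] x]])
  then show "(g \<otimes> h) x = f (f' x)"
    using mult_apply[OF representsD(1)[OF g] representsD(1)[OF h] x] representsD(2)[OF h x] by simp
qed (use g h in \<open>simp add: represents_def\<close>)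

text \<open>The intertwining equation replaces any formula for the inverse of \<Gamma>.\<close>

lemma represents_conj:
  assumes g: "represents g \<Gamma>" and h: "represents h H" and K: "\<And>x. x \<in> {0..<1} \<Longrightarrow> K (\<Gamma> x) = \<Gamma> (H x)"
  shows "represents (g \<otimes> h \<otimes> inv g) K"
  unfolding represents_def
proof (intro conjI ballI)
  note gG = representsD(1)[OF g] and hG = representsD(1)[OF h]
  show "g \<otimes> h \<otimes> inv g \<in> carrier G" using gG hG by simp
  fix x :: real assume x: "x \<in> {0..<1}"
  define z where "z = (inv g) x"
  have z: "z \<in> {0..<1}" unfolding z_def by (rule apply_in[OF inv_closed[OF gG] x])
  have gz: "g z = x" unfolding z_def by (rule inv_apply(2)[OF gG x])
  have "(g \<otimes> h \<otimes> inv g) x = g (h z)" using gG hG x z by (simp add: mult_apply z_def)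
  also have "\<dots> = \<Gamma> (H z)" using representsD(2)[OF g apply_in[OF hG z]] representsD(2)[OF h z] by simp
  also have "\<dots> = K x" using K[OF z] representsD(2)[OF g z] gz by simp
  finally show "(g \<otimes> h \<otimes> inv g) x = K x" .
qed

lemma represents_conj_inv:
  assumes g: "represents g \<Gamma>" and h: "represents h H" and K: "\<And>x. x \<in> {0..<1} \<Longrightarrow> K x \<in> {0..<1}"
    "\<And>x. x \<in> {0..<1} \<Longrightarrow> \<Gamma> (K x) = H (\<Gamma> x)"
  shows "represents (inv g \<otimes> h \<otimes> g) K"
  unfolding represents_def
proof (intro conjI ballI)
  note gG = representsD(1)[OF g] and hG = representsD(1)[OF h]
  show "inv g \<otimes> h \<otimes> g \<in> carrier G" using gG hG by simp
  fix x :: real assume x: "x \<in> {0..<1}"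
  have "(inv g \<otimes> h \<otimes> g) x = (inv g) (h (g x))" using gG hG x apply_in by (simp add: mult_apply)
  also have "h (g x) = H (\<Gamma> x)" using representsD(2)[OF h apply_in[OF gG x]] representsD(2)[OF g x] by simp
  also have "\<dots> = g (K x)" using K[OF x] representsD(2)[OF g K(1)[OF x]] by simp
  also have "(inv g) (g (K x)) = K x" by (rule inv_apply(1)[OF gG K(1)[OF x]])
  finally show "(inv g \<otimes> h \<otimes> g) x = K x" .
qed

definition r :: "real \<Rightarrow> real" where "r = restrict (rot w) {0..<1}"

definition y :: "real \<Rightarrow> real" where "y = restrict (bump 0 w) {0..<1}"

lemma represents_y: "represents y (bump 0 w)"
proof -
  obtain n where n: "m = Suc n" using m2 by (cases m) auto
  have "y \<in> carrier G"
  proof (rule carrierI)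
    show "V_map y" using V_map_bump[of n] unfolding n[symmetric] y_def w_def .
    show "homeomorphic_map circle_topology circle_topology y"
      unfolding y_def by (rule homeomorphic_bump) (use w_bounds in auto)
  qed
  then show ?thesis by (simp add: represents_def y_def)
qed

lemma cell_m: "cell a m = {real a * w ..< real a * w + w}"
  by (simp add: cell_def w_def add_divide_distrib)

lemma represents_r: "represents r (rot w)"
proof -
  have w: "0 < w" "w < 1" using w_bounds by linarith+
  have "r \<in> carrier G"
  proof (rule carrierI)
    show "homeomorphic_map circle_topology circle_topology r"
      unfolding r_def by (rule homeomorphic_rot) (use w in auto)
    show "V_map r" unfolding r_def
    proof (rule V_map_permute_cells[where \<sigma> = "\<lambda>a. if Suc a = M then 0 else Suc a" and m = m])
      show "restrict (rot w) {0..<1} \<in> Bij {0..<1}"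
        by (rule restrict_BijI[of _ _ "rot (1 - w)"])
           (use w rot_in[of w] rot_in[of "1 - w"] rot_inverse[of w] rot_inverse[of "1 - w"] in auto)
      show "(if Suc a = M then 0 else Suc a) < 2 ^ m" if "a < 2 ^ m" for a using that by (auto simp: M_def)
      fix a x assume a: "a < 2 ^ m" and x: "x \<in> cell a m"
      have x: "real a * w \<le> x" "x < real a * w + w" using x by (auto simp: cell_m)
      have d: "(real b - real a) / 2 ^ m = real b * w - real a * w" for b by (simp add: w_def diff_divide_distrib)
      show "rot w x = x + (real (if Suc a = M then 0 else Suc a) - real a) / 2 ^ m"
      proof (cases "Suc a = M")
        case True
        have aw: "real a * w = 1 - w" using M_w unfolding True[symmetric] by (simp add: algebra_simps)
        then show ?thesis using True x unfolding d by (simp add: rot_def)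
      next
        case False
        then have "Suc (Suc a) \<le> M" using a by (simp add: M_def)
        then have "real (Suc (Suc a)) * w \<le> real M * w" using w by (intro mult_right_mono) auto
        then have "real a * w + 2 * w \<le> 1" using M_w by (simp add: algebra_simps)
        then show ?thesis using False x unfolding d by (simp add: rot_def algebra_simps)
      qed
    qed
  qed
  then show ?thesis by (simp add: represents_def r_def)
qed

lemma y_carrier [simp]: "y \<in> carrier G" and r_carrier [simp]: "r \<in> carrier G"
  using represents_y represents_r by (auto simp: represents_def)

text \<open>The bump on the cells \<open>i\<close> and \<open>i + 1\<close>, cyclically.\<close>

definition ys :: "nat \<Rightarrow> real \<Rightarrow> real" where "ys i = r [^] i \<otimes> y \<otimes> inv (r [^] i)"

lemma ys_carrier [simp]: "ys i \<in> carrier G"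
  by (simp add: ys_def)

lemma represents_ys1: "represents (ys 1) (bump w w)"
proof -
  have "represents (r \<otimes> y \<otimes> inv r) (bump w w)"
    by (rule represents_conj[OF represents_r represents_y])
       (use w_bounds in \<open>auto simp: rot_def bump_def field_simps\<close>)
  then show ?thesis by (simp add: ys_def)
qed

text \<open>With \<open>A = [0, w)\<close> and \<open>B = [w, 2w)\<close>, conjugating \<open>y\<close> first by \<open>ys 1\<close> and then by \<open>y\<close> turns the pair
  \<open>(A, B)\<close> into \<open>(A, B0)\<close> and then into \<open>(A0, A1)\<close>, where \<open>A0, A1\<close> are the halves of \<open>A\<close>. The rotation moves
  this to the halves of \<open>B\<close>, and the pentagon relation expresses the bump on these as a commutator.\<close>

lemma commutator_conjugate_y:
  obtains g where "g \<in> carrier G" "ys 1 \<otimes> inv y \<otimes> inv (ys 1) \<otimes> y = g \<otimes> y \<otimes> inv g"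
proof -
  define c where "c = ys 1 \<otimes> y \<otimes> inv (ys 1)"
  define C where "C x = (if x < w then x / 2 else if x < 5 * w / 4 then w / 2 + 2 * (x - w)
      else if x < 3 * w / 2 then w + 2 * (x - 5 * w / 4) else x)" for x
  have c: "represents c C" unfolding c_def
    by (rule represents_conj[OF represents_ys1 represents_y])
       (use w_bounds in \<open>auto simp: C_def bump_def field_simps\<close>)
  define a where "a = y \<otimes> c \<otimes> inv y"
  have a: "represents a (bump 0 (w / 2))" unfolding a_def
    by (rule represents_conj[OF represents_y c])
       (use w_bounds in \<open>auto simp: C_def bump_def field_simps\<close>)
  define b where "b = r \<otimes> a \<otimes> inv r"
  have b: "represents b (bump w (w / 2))" unfolding b_def
    by (rule represents_conj[OF represents_r a])
       (use w_bounds in \<open>auto simp: rot_def bump_def field_simps\<close>)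
  \<comment> \<open>The pentagon relation: \<open>b\<close>, acting on the two halves of B, followed
    by \<open>c\<close>, acting on A and B0, is the original bump. Hence \<open>b\<close> equals
    \<open>inv c \<otimes> y\<close>, a commutator of \<open>ys 1\<close> and
    \<open>inv y\<close>.\<close>
  have "represents (c \<otimes> b) (bump 0 w)"
    by (rule represents_cong[OF represents_mult[OF c b]])
       (use w_bounds in \<open>auto simp: C_def bump_def field_simps\<close>)
  then have "c \<otimes> b = y" using represents_y by (rule represents_eqI)
  moreover have cG: "c \<in> carrier G" "b \<in> carrier G" using b c by (auto simp: represents_def)
  ultimately have "inv c \<otimes> y = b" by (metis inv_solve_left y_carrier)
  moreover have "inv c = ys 1 \<otimes> inv y \<otimes> inv (ys 1)"
    unfolding c_def by (simp add: inv_mult_group m_assoc)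
  ultimately have eq: "ys 1 \<otimes> inv y \<otimes> inv (ys 1) \<otimes> y = b" by simp
  have "b = (r \<otimes> y \<otimes> ys 1) \<otimes> y \<otimes> inv (r \<otimes> y \<otimes> ys 1)"
    unfolding b_def a_def c_def by (simp add: inv_mult_group m_assoc)
  with eq show ?thesis by (intro that[of "r \<otimes> y \<otimes> ys 1"]) simp_all
qed

end

section \<open>Generation by bumps\<close>

lemma aff_cong: "aff f l u l' u' \<Longrightarrow> (\<And>x. l \<le> x \<Longrightarrow> x < u \<Longrightarrow> f x = g x) \<Longrightarrow> aff g l u l' u'"
  by (simp add: aff_def)

lemma aff_translation: "(\<And>x. l \<le> x \<Longrightarrow> x < u \<Longrightarrow> f x = x + k) \<Longrightarrow> l < u \<Longrightarrow> aff f l u (l + k) (u + k)"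
  by (simp add: aff_def)

lemma aff_eq: "aff f l u l' u' \<Longrightarrow> aff g l u l' u' \<Longrightarrow> l \<le> x \<Longrightarrow> x < u \<Longrightarrow> f x = g x"
  by (simp add: aff_def)

text \<open>The bump for the adjacent circle intervals \<open>[1 - w * s, 1)\<close> and
  \<open>[0, w)\<close>, which have different lengths when \<open>s < 1\<close> and meet at the
  point 0 = 1.\<close>

definition swing :: "real \<Rightarrow> real \<Rightarrow> real \<Rightarrow> real" where
  "swing w s x = (if x < w / 2 then 1 - w * s / 2 + x * s else if x < w then 2 * x - w
     else if x < 1 - w * s then x else (x + 1 - w * s) / 2)"

lemma swing_in:
  assumes w: "0 < w" "4 * w \<le> 1" and s: "0 < s" "s \<le> 1" and x: "x \<in> {0..<1}"
  shows "swing w s x \<in> {0..<1}"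
proof -
  define p where "p = w * s"
  have p: "0 < p" "p \<le> w" unfolding p_def using w s mult_left_mono[of s 1 w] by simp_all
  show ?thesis
  proof (cases "x < w / 2")
    case True
    have "x * s < w / 2 * s" using True s by (intro mult_strict_right_mono) auto
    then have "x * s < p / 2" by (simp add: p_def)
    moreover have "0 \<le> x * s" using x s by simp
    ultimately have "0 \<le> 1 - p / 2 + x * s" "1 - p / 2 + x * s < 1" using p w by linarith+
    then show ?thesis using True by (simp add: swing_def p_def)
  next
    case False
    then show ?thesis using x w p unfolding swing_def p_def[symmetric] by auto
  qed
qed

text \<open>On the right half of the last cell the bump on the last two cells is the doubling about
  1, and it fixes everything in \<open>[0, w)\<close>. Conjugation by it therefore only rescales the
  interval that ends at 1.\<close>

lemma bump_swing:
  assumes w: "0 < w" "4 * w \<le> 1" and s: "0 < s" "s \<le> 1" and x: "x \<in> {0..<1}"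
  shows "bump (1 - 2 * w) w (swing w (s / 2) x) = swing w s (bump (1 - 2 * w) w x)"
proof (cases "x < w / 2")
  case True
  have b: "bump (1 - 2 * w) w x = x" using True w by (simp add: bump_def)
  have 1: "x * s < w / 2 * s" using True s by (intro mult_strict_right_mono) auto
  have 2: "0 \<le> x * s" using x s by simp
  have 3: "w * s \<le> w * 1" using w s by (intro mult_left_mono) auto
  define q where "q = x * s" define p where "p = w * s"
  have f: "q < p / 2" "0 \<le> q" "p \<le> w" using 1 2 3 by (simp_all add: q_def p_def)
  have "swing w (s / 2) x = 1 - p / 4 + q / 2" using True by (simp add: swing_def q_def p_def)
  moreover have "swing w s x = 1 - p / 2 + q" using True by (simp add: swing_def q_def p_def)
  moreover have "bump (1 - 2 * w) w (1 - p / 4 + q / 2) = 1 - p / 2 + q"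
    unfolding bump_def using f w by (auto simp: field_simps)
  ultimately show ?thesis by (simp add: b)
next
  case False
  define p where "p = w * s"
  have "0 < p" using w s by (simp add: p_def)
  moreover have "p \<le> w" unfolding p_def using w s mult_left_mono[of s 1 w] by simp
  moreover have "w * (s / 2) = p / 2" by (simp add: p_def)
  ultimately show ?thesis using False x w
    unfolding swing_def p_def[symmetric] by (auto simp: bump_def field_simps)
qed

context thompson_group
begin

definition zeta :: "real \<Rightarrow> real" where "zeta = inv (r \<otimes> r) \<otimes> y \<otimes> (r \<otimes> r)"

lemma represents_zeta: "represents zeta (bump (1 - 2 * w) w)"
  unfolding zeta_def
  by (rule represents_conj_inv[OF represents_mult[OF represents_r represents_r] represents_y])
     (use w_bounds bump_in(1)[of w "1 - 2 * w"] in simp, use w_bounds in \<open>auto simp: rot_def bump_def field_simps\<close>)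

text \<open>Each conjugation by \<open>zeta\<close> halves the interval that ends at 1, so that
  arbitrarily small last pieces are handled by conjugates of \<open>y\<close>.\<close>

primrec yy :: "nat \<Rightarrow> real \<Rightarrow> real" where
  "yy 0 = inv r \<otimes> y \<otimes> r"
| "yy (Suc v) = inv zeta \<otimes> yy v \<otimes> zeta"

lemma represents_yy: "represents (yy v) (swing w (1 / 2 ^ v))"
proof (induction v)
  case 0
  show ?case unfolding yy.simps
    by (rule represents_conj_inv[OF represents_r represents_y])
       (use w_bounds swing_in[of w 1] in simp, use w_bounds in \<open>auto simp: rot_def bump_def swing_def field_simps\<close>)
next
  case (Suc v)
  have s: "0 < 1 / (2::real) ^ v" "1 / (2::real) ^ v \<le> 1" "0 < 1 / (2::real) ^ Suc v" "1 / (2::real) ^ Suc v \<le> 1"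
    "1 / (2::real) ^ v / 2 = 1 / 2 ^ Suc v"
    using one_le_power[of "2::real" v] one_le_power[of "2::real" "Suc v"] by (auto simp: divide_le_eq_1)
  show ?case unfolding yy.simps
  proof (rule represents_conj_inv[OF represents_zeta Suc.IH])
    fix x :: real assume x: "x \<in> {0..<1}"
    show "swing w (1 / 2 ^ Suc v) x \<in> {0..<1}" by (rule swing_in[OF w_bounds s(3,4) x])
    show "bump (1 - 2 * w) w (swing w (1 / 2 ^ Suc v) x) = swing w (1 / 2 ^ v) (bump (1 - 2 * w) w x)"
      using bump_swing[OF w_bounds s(1,2) x] unfolding s(5) .
  qed
qed

primrec rr :: "nat \<Rightarrow> real \<Rightarrow> real" where
  "rr 0 = r"
| "rr (Suc v) = yy v \<otimes> rr v"

lemma zeta_carrier [simp]: "zeta \<in> carrier G" and yy_carrier [simp]: "yy v \<in> carrier G"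
  using represents_zeta represents_yy by (auto simp: represents_def)

lemma rr_carrier [simp]: "rr v \<in> carrier G"
  by (induction v) auto

text \<open>The division \<open>R\<^sub>n\<close>: the cells of level \<open>m\<close>, of which the last one is repeatedly halved at its right end
  until there are \<open>n\<close> pieces \<open>[bp n j, bp n (j + 1))\<close>. The element \<open>rr v\<close> permutes the pieces of
  \<open>R\<^sub>n\<close>, \<open>n = M + v\<close>, cyclically.\<close>

definition bp :: "nat \<Rightarrow> nat \<Rightarrow> real" where
  "bp n j = (if n \<le> j then 1 else if j < M then real j * w else 1 - w / 2 ^ (j + 1 - M))"

lemma bp_0: "M \<le> n \<Longrightarrow> bp n 0 = 0"
  using M_ge by (simp add: bp_def)

lemma bp_end [simp]: "bp n n = 1"
  by (simp add: bp_def)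

lemma bp_last: "bp (M + v) (M + v - 1) = 1 - w / 2 ^ v"
proof (cases v)
  case 0
  have "real (M - 1) * w = real M * w - w" using M_ge by (simp add: of_nat_diff algebra_simps)
  then show ?thesis using 0 M_ge M_w by (simp add: bp_def)
qed (simp add: bp_def)

lemma bp_Suc: "j < n \<Longrightarrow> bp (Suc n) j = bp n j"
  by (simp add: bp_def)

lemma bp_Suc_last: "bp (Suc (M + v)) (M + v) = 1 - w / 2 ^ v / 2"
  using bp_last[of "Suc v"] by simp

lemma bp_less: "M \<le> n \<Longrightarrow> j < n \<Longrightarrow> bp n j < bp n (Suc j)"
proof (induction n rule: dec_induct)
  case base
  show ?case
  proof (cases "Suc j = M")
    case True
    then have j: "j = M - 1" by simp
    have "bp M j = 1 - w" using bp_last[of 0] j by simp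
    moreover have "bp M (Suc j) = 1" using True by simp
    ultimately show ?thesis using w_bounds by simp
  next
    case False
    then show ?thesis using base w_bounds by (simp add: bp_def)
  qed
next
  case (step n)
  obtain v where v: "n = M + v" using step.hyps(1) le_Suc_ex by blast
  consider "Suc j < n" | "Suc j = n" | "j = n" using step.prems by linarith
  then show ?case
  proof cases
    case 1
    then show ?thesis using step.IH by (simp add: bp_Suc)
  next
    case 2
    then have "j = M + v - 1" using v by simp
    then have "bp n j = 1 - w / 2 ^ v" using bp_last[of v] v by simp
    then have "bp (Suc n) j = 1 - w / 2 ^ v" using 2 by (simp add: bp_Suc)
    moreover have "bp (Suc n) (Suc j) = 1 - w / 2 ^ v / 2" using 2 bp_Suc_last[of v] v by simp
    moreover have "0 < q \<Longrightarrow> 1 - q < 1 - q / 2" for q :: real by simp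
    moreover have "0 < w / 2 ^ v" using w_bounds by simp
    ultimately show ?thesis by metis
  next
    case 3
    then show ?thesis using bp_Suc_last[of v] w_bounds v by simp
  qed
qed

lemma bp_mono:
  assumes "M \<le> n" "i \<le> j"
  shows "bp n i \<le> bp n j"
  using assms(2)
proof (induction j rule: dec_induct)
  case (step j)
  have "bp n j \<le> bp n (Suc j)" using bp_less[OF assms(1), of j] by (cases "j < n") (auto simp: bp_def)
  with step.IH show ?case by simp
qed simp

lemma bp_bounds: "M \<le> n \<Longrightarrow> 0 \<le> bp n j" "M \<le> n \<Longrightarrow> bp n j \<le> 1"
  using bp_mono[of n 0 j] bp_mono[of n j "max j n"] bp_0[of n] by (auto simp: bp_def)

lemma leaf_exists:
  assumes n: "M \<le> n" and x: "x \<in> {0..<1}"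
  obtains j where "j < n" "bp n j \<le> x" "x < bp n (Suc j)"
proof -
  define j where "j = (LEAST j. x < bp n (Suc j))"
  have ex: "x < bp n (Suc n)" using x by (simp add: bp_def)
  have 1: "x < bp n (Suc j)" unfolding j_def by (rule LeastI[of _ n]) (rule ex)
  have 2: "bp n j \<le> x"
  proof (cases j)
    case 0
    then show ?thesis using bp_0[OF n] x by simp
  next
    case (Suc i)
    then have "\<not> x < bp n (Suc i)" using not_less_Least[of i "\<lambda>j. x < bp n (Suc j)"] by (simp add: j_def)
    then show ?thesis using Suc by simp
  qed
  have "j < n"
  proof (rule ccontr)
    assume "\<not> j < n"
    then have "bp n j = 1" by (simp add: bp_def)
    then show False using 2 x by simp
  qed
  then show ?thesis using 1 2 that by blast
qed

lemma leaf_unique: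
  assumes n: "M \<le> n" and i: "bp n i \<le> x" "x < bp n (Suc i)" and j: "bp n j \<le> x" "x < bp n (Suc j)"
  shows "i = j"
proof (rule ccontr)
  assume "i \<noteq> j"
  then consider "Suc i \<le> j" | "Suc j \<le> i" by linarith
  then show False
  proof cases
    case 1
    then show False using bp_mono[OF n 1] i j by linarith
  next
    case 2
    then show False using bp_mono[OF n 2] i j by linarith
  qed
qed

definition leaf_map :: "(real \<Rightarrow> real) \<Rightarrow> nat \<Rightarrow> nat \<Rightarrow> nat \<Rightarrow> bool" where
  "leaf_map g n i j \<longleftrightarrow> aff g (bp n i) (bp n (Suc i)) (bp n j) (bp n (Suc j))"

lemma aff_mult:
  assumes g: "g \<in> carrier G" and h: "h \<in> carrier G" and lu: "0 \<le> l" "l < u" "u \<le> 1" "l' < u'"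
    and ah: "aff h l u l' u'" and ag: "aff g l' u' l'' u''"
  shows "aff (g \<otimes> h) l u l'' u''"
  by (rule aff_cong[OF aff_compose[OF ah ag lu(2,4)]]) (use g h lu in \<open>simp add: mult_apply\<close>)

lemma leaf_map_mult:
  assumes "g \<in> carrier G" "h \<in> carrier G" "M \<le> n" "i < n" "j < n" "leaf_map h n i j" "leaf_map g n j l"
  shows "leaf_map (g \<otimes> h) n i l"
  unfolding leaf_map_def
  by (rule aff_mult[where l' = "bp n j" and u' = "bp n (Suc j)"])
     (use assms bp_bounds bp_less in \<open>auto simp: leaf_map_def\<close>)

lemma leaf_map_eqI:
  assumes "g \<in> carrier G" "h \<in> carrier G" "M \<le> n" "\<And>i. i < n \<Longrightarrow> leaf_map g n i (\<sigma> i)" "\<And>i. i < n \<Longrightarrow> leaf_map h n i (\<sigma> i)"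
  shows "g = h"
proof (rule carrier_eqI[OF assms(1,2)])
  fix x :: real assume x: "x \<in> {0..<1}"
  obtain j where j: "j < n" "bp n j \<le> x" "x < bp n (Suc j)" by (rule leaf_exists[OF assms(3) x])
  show "g x = h x" by (rule aff_eq[OF _ _ j(2,3)]) (use assms(4,5)[OF j(1)] in \<open>simp_all add: leaf_map_def\<close>)
qed

lemma leaf_map_one: "M \<le> n \<Longrightarrow> i < n \<Longrightarrow> leaf_map \<one> n i i"
  unfolding leaf_map_def
  using aff_translation[of "bp n i" "bp n (Suc i)" \<one> 0] bp_bounds[of n i] bp_bounds[of n "Suc i"] bp_less[of n i]
  by (simp add: one_apply)

lemma yy_aff:
  shows "aff (yy v) (1 - w / 2 ^ v) 1 (1 - w / 2 ^ v) (1 - w / 2 ^ v / 2)"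
    and "aff (yy v) 0 (w / 2) (1 - w / 2 ^ v / 2) 1"
    and "aff (yy v) (w / 2) w 0 w"
    and "w \<le> l \<Longrightarrow> l < u \<Longrightarrow> u \<le> 1 - w / 2 ^ v \<Longrightarrow> aff (yy v) l u l u"
proof -
  define p where "p = w / 2 ^ v"
  have p: "0 < p" "p \<le> w" using w_bounds by (simp_all add: p_def divide_le_eq mult_le_cancel_left1)
  have yyx: "yy v x = (if x < w / 2 then 1 - p / 2 + x * (p / w) else if x < w then 2 * x - w
     else if x < 1 - p then x else (x + 1 - p) / 2)" if "0 \<le> x" "x < 1" for x
    using representsD(2)[OF represents_yy, of x v] that w_bounds by (simp add: swing_def p_def)
  show "aff (yy v) (1 - w / 2 ^ v) 1 (1 - w / 2 ^ v) (1 - w / 2 ^ v / 2)"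
    unfolding p_def[symmetric] aff_def using p w_bounds by (auto simp: yyx field_simps)
  show "aff (yy v) 0 (w / 2) (1 - w / 2 ^ v / 2) 1"
    unfolding p_def[symmetric] aff_def using p w_bounds by (auto simp: yyx field_simps)
  show "aff (yy v) (w / 2) w 0 w"
    unfolding p_def[symmetric] aff_def using p w_bounds by (auto simp: yyx field_simps)
  show "w \<le> l \<Longrightarrow> l < u \<Longrightarrow> u \<le> 1 - w / 2 ^ v \<Longrightarrow> aff (yy v) l u l u"
    unfolding p_def[symmetric] aff_def using p w_bounds by (auto simp: yyx)
qed

text \<open>Multiplying by \<open>yy v\<close> opens one more place in the cycle. After
  \<open>rr v\<close>, the leaf arriving at the last place is compressed to its left half. The old
  last leaf arrives at \<open>[0, w)\<close> and is split: its left half fills the new last place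
  and its right half is stretched over \<open>[0, w)\<close>. All other leaves are untouched by
  \<open>yy v\<close>.\<close>

lemma rr_leaf_map: "i < M + v \<Longrightarrow> leaf_map (rr v) (M + v) i (Suc i mod (M + v))"
proof (induction v arbitrary: i)
  case 0
  have rx: "r x = rot w x" if "0 \<le> x" "x < 1" for x using representsD(2)[OF represents_r] that by simp
  have b: "bp M j = real j * w" if "j \<le> M" for j using that M_w by (auto simp: bp_def)
  show ?case
  proof (cases "Suc i = M")
    case True
    have iw: "real i * w = 1 - w" using M_w unfolding True[symmetric] by (simp add: algebra_simps)
    have "aff r (1 - w) 1 (1 - w + (w - 1)) (1 + (w - 1))"
      by (rule aff_translation) (use w_bounds rx in \<open>auto simp: rot_def\<close>)
    then show ?thesis unfolding leaf_map_def using True b[of i] b[of 0] b[of 1] M_ge iw by simp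
  next
    case False
    then have i: "Suc (Suc i) \<le> M" using 0 by simp
    then have "real (Suc (Suc i)) * w \<le> real M * w" using w_bounds by (intro mult_right_mono) auto
    then have iw: "real i * w + w + w \<le> 1" using M_w by (simp add: algebra_simps)
    have i0: "0 \<le> real i * w" using w_bounds by simp
    have "aff r (real i * w) (real i * w + w) (real i * w + w) (real i * w + w + w)"
    proof (rule aff_translation)
      fix x assume x: "real i * w \<le> x" "x < real i * w + w"
      then have "0 \<le> x" "x < 1 - w" using i0 iw by linarith+
      then show "r x = x + w" using rx[of x] w_bounds by (simp add: rot_def)
    qed (use w_bounds in simp)
    then show ?thesis unfolding leaf_map_def using False b[of i] b[of "Suc i"] b[of "Suc (Suc i)"] i
      by (simp add: algebra_simps)
  qed
next
  case (Suc v)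
  let ?n = "M + v"
  have n: "M \<le> ?n" "4 \<le> ?n" using M_ge by auto
  have last: "bp ?n (?n - 1) = 1 - w / 2 ^ v" by (rule bp_last)
  have last': "bp (Suc ?n) ?n = 1 - w / 2 ^ v / 2" by (rule bp_Suc_last)
  have lastS: "bp (Suc ?n) (?n - 1) = 1 - w / 2 ^ v" using last n bp_Suc[of "?n - 1" ?n] by simp
  have b0: "bp ?n 0 = 0" "bp (Suc ?n) 0 = 0" using bp_0[of ?n] bp_0[of "Suc ?n"] by simp_all
  have b1: "bp ?n 1 = w" "bp (Suc ?n) 1 = w" using n M_ge by (simp_all add: bp_def)
  have p: "0 < w / 2 ^ v" "w / 2 ^ v \<le> w"
    using w_bounds by (simp_all add: divide_le_eq mult_le_cancel_left1)
  have "1 - q < 1 - q / 2 \<and> 1 - q / 2 \<le> 1 \<and> 1 - q / 2 < 1 \<and> 0 \<le> 1 - q \<and> 0 \<le> 1 - q / 2"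
    if "0 < q" "q \<le> w" for q :: real
    using that w_bounds by auto
  from this[OF p] have hb: "1 - w / 2 ^ v < 1 - w / 2 ^ v / 2" "1 - w / 2 ^ v / 2 \<le> 1" "1 - w / 2 ^ v / 2 < 1"
    "0 \<le> 1 - w / 2 ^ v" "0 \<le> 1 - w / 2 ^ v / 2" "0 < w / 2" "w / 2 < w" "(1::real) \<le> 1"
    using w_bounds by auto
  consider "Suc (Suc i) < ?n" | "Suc (Suc i) = ?n" | "Suc i = ?n" | "i = ?n" using Suc.prems by linarith
  then show ?case
  proof cases
    case 1
    have "leaf_map (rr v) ?n i (Suc i)" using Suc.IH[of i] 1 by simp
    then have h: "aff (rr v) (bp ?n i) (bp ?n (Suc i)) (bp ?n (Suc i)) (bp ?n (Suc (Suc i)))"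
      by (simp add: leaf_map_def)
    have "aff (yy v) (bp ?n (Suc i)) (bp ?n (Suc (Suc i))) (bp ?n (Suc i)) (bp ?n (Suc (Suc i)))"
    proof (rule yy_aff(4))
      show "w \<le> bp ?n (Suc i)" using bp_mono[OF n(1), of 1 "Suc i"] b1 by simp
      show "bp ?n (Suc (Suc i)) \<le> 1 - w / 2 ^ v" using bp_mono[OF n(1), of "Suc (Suc i)" "?n - 1"] last 1 by simp
    qed (use bp_less[OF n(1)] 1 in simp)
    from aff_mult[OF yy_carrier rr_carrier _ _ _ _ h this]
    have "aff (yy v \<otimes> rr v) (bp ?n i) (bp ?n (Suc i)) (bp ?n (Suc i)) (bp ?n (Suc (Suc i)))"
      using bp_bounds[OF n(1)] bp_less[OF n(1)] 1 by simp
    then show ?thesis using 1 by (simp add: leaf_map_def bp_Suc)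
  next
    case 2
    then have i: "Suc i = ?n - 1" by simp
    have "leaf_map (rr v) ?n i (Suc i)" using Suc.IH[of i] 2 by simp
    then have h: "aff (rr v) (bp ?n i) (bp ?n (Suc i)) (1 - w / 2 ^ v) 1"
      using last 2 by (simp add: leaf_map_def i)
    from aff_mult[OF yy_carrier rr_carrier _ _ _ _ h yy_aff(1)]
    have "aff (yy v \<otimes> rr v) (bp ?n i) (bp ?n (Suc i)) (1 - w / 2 ^ v) (1 - w / 2 ^ v / 2)"
      using bp_bounds[OF n(1)] bp_less[OF n(1)] 2 p by simp
    moreover have "bp (Suc ?n) i = bp ?n i" "bp (Suc ?n) (Suc i) = bp ?n (Suc i)" using 2 by (simp_all add: bp_Suc)
    moreover have "bp (Suc ?n) (Suc i) = 1 - w / 2 ^ v" using lastS i by simp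
    ultimately show ?thesis using 2 last' by (simp add: leaf_map_def)
  next
    case 3
    then have i: "i = ?n - 1" by simp
    have "leaf_map (rr v) ?n i 0" using Suc.IH[of i] 3 by simp
    then have h: "aff (rr v) (1 - w / 2 ^ v) 1 0 w" using last 3 b0 b1 by (simp add: leaf_map_def i)
    have mid: "(1 - w / 2 ^ v + 1) / 2 = 1 - w / 2 ^ v / 2" by simp
    have "aff (rr v) (1 - w / 2 ^ v) (1 - w / 2 ^ v / 2) 0 (w / 2)"
      using aff_halves(1)[OF h, unfolded mid] p by simp
    then have "aff (yy v \<otimes> rr v) (1 - w / 2 ^ v) (1 - w / 2 ^ v / 2) (1 - w / 2 ^ v / 2) 1"
      by (rule aff_mult[OF yy_carrier rr_carrier _ _ _ _ _ yy_aff(2)[of v], rotated 4]) (assumption | rule hb)+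
    then show ?thesis using 3 lastS last' i by (simp add: leaf_map_def)
  next
    case 4
    have e: "Suc (?n - 1) = ?n" using n by simp
    have "leaf_map (rr v) ?n (?n - 1) (Suc (?n - 1) mod ?n)" by (rule Suc.IH) (use n in simp)
    then have "leaf_map (rr v) ?n (?n - 1) 0" unfolding e by simp
    then have h: "aff (rr v) (1 - w / 2 ^ v) 1 0 w"
      unfolding leaf_map_def e last bp_end b0 using b1 by simp
    have mid: "(1 - w / 2 ^ v + 1) / 2 = 1 - w / 2 ^ v / 2" by simp
    have "aff (rr v) (1 - w / 2 ^ v / 2) 1 (w / 2) w"
      using aff_halves(2)[OF h, unfolded mid] p by simp
    then have "aff (yy v \<otimes> rr v) (1 - w / 2 ^ v / 2) 1 0 w"
      by (rule aff_mult[OF yy_carrier rr_carrier _ _ _ _ _ yy_aff(3)[of v], rotated 4]) (assumption | rule hb)+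
    then show ?thesis using 4 b0 b1 last' by (simp add: leaf_map_def)
  qed
qed

lemma rr_pow_leaf_map: "i < M + v \<Longrightarrow> leaf_map (rr v [^] s) (M + v) i ((i + s) mod (M + v))"
proof (induction s arbitrary: i)
  case 0
  then show ?case using leaf_map_one[of "M + v" i] by simp
next
  case (Suc s)
  have n: "M \<le> M + v" by simp
  have "leaf_map (rr v [^] s) (M + v) (Suc i mod (M + v)) ((Suc i mod (M + v) + s) mod (M + v))"
    using M_ge by (intro Suc.IH) simp
  from leaf_map_mult[OF _ rr_carrier n Suc.prems _ rr_leaf_map[OF Suc.prems] this] M_ge
  show ?case by (simp add: mod_add_left_eq)
qed

lemma rr_order: "rr v [^] (M + v) = \<one>"
proof (rule leaf_map_eqI[of _ _ "M + v" "\<lambda>i. i"])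
  show "leaf_map (rr v [^] (M + v)) (M + v) i i" if "i < M + v" for i
    using rr_pow_leaf_map[OF that, of "M + v"] that by simp
qed (simp_all add: leaf_map_one)

lemma r_order: "r [^] M = \<one>"
  using rr_order[of 0] by simp

end

lemma cell_Suc: "cell q c = cell (2 * q) (Suc c) \<union> cell (2 * q + 1) (Suc c)"
  unfolding cell_def by (auto simp: field_simps)

context thompson_group
begin

text \<open>A telescoping product: passing from \<open>i\<close> to \<open>Suc i\<close> multiplies
  the element on the right by \<open>r [^] i \<otimes> y \<otimes> inv (r [^] i)\<close>, which is
  \<open>ys i\<close>.\<close>

lemma prod_ys: "(\<forall>i<M. ys i \<in> H) \<Longrightarrow> subgroup H G \<Longrightarrow> i \<le> M \<Longrightarrow> (y \<otimes> r) [^] i \<otimes> inv (r [^] i) \<in> H"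
proof (induction i)
  case 0
  then show ?case by (simp add: subgroup.one_closed)
next
  case (Suc i)
  have cancel: "g \<otimes> (inv g \<otimes> z) = z" "inv g \<otimes> (g \<otimes> z) = z" if "g \<in> carrier G" "z \<in> carrier G" for g z
    using that by (simp_all add: m_assoc[symmetric])
  have "(y \<otimes> r) [^] Suc i \<otimes> inv (r [^] Suc i) = (y \<otimes> r) [^] i \<otimes> (y \<otimes> inv (r [^] i))"
    by (simp add: inv_mult_group m_assoc cancel)
  also have "\<dots> = (y \<otimes> r) [^] i \<otimes> inv (r [^] i) \<otimes> ys i"
    unfolding ys_def by (simp add: m_assoc cancel)
  finally show ?case using Suc by (simp add: subgroup.m_closed)
qed

text \<open>Since \<open>ys 0 \<otimes> \<dots> \<otimes> ys (M - 1) = (y \<otimes> r)\<^sup>M\<close> and \<open>y \<otimes> r\<close> is conjugate to \<open>rr 1\<close>, which has order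
  \<open>M + 1\<close>, the rotation \<open>r\<close> is a product of bumps.\<close>

lemma r_in_subgroup:
  assumes H: "subgroup H G" and ys: "\<And>i. i < M \<Longrightarrow> ys i \<in> H"
  shows "r \<in> H" "y \<in> H"
proof -
  show yH: "y \<in> H" using ys[of 0] M_ge by (simp add: ys_def)
  have "(y \<otimes> r) [^] M \<otimes> inv (r [^] M) \<in> H" using prod_ys[OF _ H order_refl] ys by blast
  then have "(y \<otimes> r) [^] M \<in> H" by (simp add: r_order)
  then have P: "(y \<otimes> r) [^] M \<otimes> y \<in> H" using yH by (rule subgroup.m_closed[OF H])
  have conj: "(r \<otimes> rr 1 \<otimes> inv r) [^] k = r \<otimes> rr 1 [^] k \<otimes> inv r" for k :: nat
  proof (induction k)
    case (Suc k)
    have "(r \<otimes> rr 1 \<otimes> inv r) [^] Suc k = r \<otimes> rr 1 [^] k \<otimes> (inv r \<otimes> r) \<otimes> rr 1 \<otimes> inv r"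
      unfolding nat_pow_Suc Suc.IH by (simp only: m_assoc m_closed inv_closed r_carrier rr_carrier nat_pow_closed)
    then show ?case by (simp add: m_assoc)
  qed simp
  \<comment> \<open>Here \<open>rr 1\<close> unfolds to
    \<open>inv r \<otimes> y \<otimes> r \<otimes> r\<close>.\<close>
  have "r \<otimes> rr 1 \<otimes> inv r = y \<otimes> r"
    by (simp add: m_assoc inv_solve_left) (simp add: m_assoc[symmetric])
  then have "(y \<otimes> r) [^] Suc M = \<one>"
    using conj[of "Suc M"] rr_order[of 1] by (simp del: nat_pow_Suc rr.simps)
  then have "((y \<otimes> r) [^] M \<otimes> y) \<otimes> r = \<one>" by (simp add: m_assoc)
  then have "inv r = (y \<otimes> r) [^] M \<otimes> y" by (intro inv_equality) simp_all
  then have "inv r \<in> H" using P by simp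
  then have "inv (inv r) \<in> H" by (rule subgroup.m_inv_closed[OF H])
  then show "r \<in> H" by simp
qed

lemma yy_in: "subgroup H G \<Longrightarrow> r \<in> H \<Longrightarrow> y \<in> H \<Longrightarrow> yy v \<in> H"
  by (induction v) (simp_all add: zeta_def subgroup.m_closed subgroup.m_inv_closed)

lemma rr_in: "subgroup H G \<Longrightarrow> r \<in> H \<Longrightarrow> y \<in> H \<Longrightarrow> rr v \<in> H"
  by (induction v) (simp_all add: yy_in subgroup.m_closed)

lemma pow_in: "subgroup H G \<Longrightarrow> h \<in> H \<Longrightarrow> h [^] (n::nat) \<in> H"
  by (induction n) (simp_all add: subgroup.one_closed subgroup.m_closed)

section \<open>Mapping dyadic divisions to leaves\<close>

definition is_division :: "(nat \<times> nat) set \<Rightarrow> bool" where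
  "is_division D \<longleftrightarrow> finite D \<and> (\<forall>p\<in>D. fst p < 2 ^ snd p \<and> m \<le> snd p) \<and>
     (\<forall>x\<in>{0..<1}. \<exists>!p. p \<in> D \<and> x \<in> cell (fst p) (snd p))"

definition cell_map :: "(real \<Rightarrow> real) \<Rightarrow> nat \<times> nat \<Rightarrow> nat \<Rightarrow> nat \<Rightarrow> bool" where
  "cell_map g p n j \<longleftrightarrow>
     aff g (real (fst p) / 2 ^ snd p) ((real (fst p) + 1) / 2 ^ snd p) (bp n j) (bp n (Suc j))"

lemma is_divisionD:
  assumes "is_division D"
  shows "finite D" "p \<in> D \<Longrightarrow> fst p < 2 ^ snd p" "p \<in> D \<Longrightarrow> m \<le> snd p"
    "x \<in> {0..<1} \<Longrightarrow> \<exists>p\<in>D. x \<in> cell (fst p) (snd p)"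
    "p \<in> D \<Longrightarrow> q \<in> D \<Longrightarrow> x \<in> cell (fst p) (snd p) \<Longrightarrow> x \<in> cell (fst q) (snd q) \<Longrightarrow> p = q"
proof -
  show "finite D" "p \<in> D \<Longrightarrow> fst p < 2 ^ snd p" "p \<in> D \<Longrightarrow> m \<le> snd p"
    using assms by (auto simp: is_division_def)
  have ex1: "\<exists>!p. p \<in> D \<and> x \<in> cell (fst p) (snd p)" if "x \<in> {0..<1}" for x
    using assms that unfolding is_division_def by blast
  show "x \<in> {0..<1} \<Longrightarrow> \<exists>p\<in>D. x \<in> cell (fst p) (snd p)" using ex1[of x] by blast
  assume pq: "p \<in> D" "q \<in> D" "x \<in> cell (fst p) (snd p)" "x \<in> cell (fst q) (snd q)"
  have "x \<in> {0..<1}" using cell_subset[of "fst p" "snd p"] pq assms by (auto simp: is_division_def)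
  then show "p = q" using ex1[of x] pq by blast
qed

lemma bp_M: "j \<le> M \<Longrightarrow> bp M j = real j / 2 ^ m"
  using M_w by (auto simp: bp_def w_def)

text \<open>The sibling of a deepest cell also belongs to the division: the piece containing the
  left end of the sibling is no deeper, and if it were coarser it would contain the common parent
  and so overlap the deepest cell. Hence both siblings can be replaced by their parent.\<close>

lemma division_merge:
  assumes D: "is_division D" and a: "(a, Suc c) \<in> D" and max: "\<And>p. p \<in> D \<Longrightarrow> snd p \<le> Suc c" and mc: "m \<le> c"
  defines "q \<equiv> a div 2"
  shows "(2 * q, Suc c) \<in> D" "(2 * q + 1, Suc c) \<in> D" "(q, c) \<notin> D"
    "is_division (insert (q, c) (D - {(2 * q, Suc c), (2 * q + 1, Suc c)}))"
proof -
  have aq: "a < 2 * 2 ^ c" using is_divisionD(2)[OF D a] by simp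
  then have q: "q < 2 ^ c" by (simp add: q_def)
  have sib: "(\<alpha>, Suc c) \<in> D" if \<alpha>: "\<alpha> div 2 = q" for \<alpha>
  proof -
    have "\<alpha> < 2 ^ Suc c" using \<alpha> q by auto
    then have "real \<alpha> / 2 ^ Suc c \<in> {0..<1}" using cell_subset left_end_in_cell by blast
    then obtain p where p: "p \<in> D" "real \<alpha> / 2 ^ Suc c \<in> cell (fst p) (snd p)" using is_divisionD(4)[OF D] by blast
    have le: "snd p \<le> Suc c" by (rule max[OF p(1)])
    then have div: "\<alpha> div 2 ^ (Suc c - snd p) = fst p" using p(2) left_end_in_cell_iff by blast
    show ?thesis
    proof (cases "snd p = Suc c")
      case True
      then have "fst p = \<alpha>" using div by simp
      then show ?thesis using p(1) True by (metis prod.collapse)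
    next
      case False
      then obtain k where k: "Suc c - snd p = Suc k" using le by (cases "Suc c - snd p") auto
      have "\<alpha> div 2 ^ Suc k = a div 2 ^ Suc k" using \<alpha> by (simp add: div_mult2_eq q_def)
      then have "a div 2 ^ (Suc c - snd p) = fst p" using div k by simp
      then have "real a / 2 ^ Suc c \<in> cell (fst p) (snd p)" using left_end_in_cell_iff[OF le] by blast
      moreover have "real a / 2 ^ Suc c \<in> cell (fst (a, Suc c)) (snd (a, Suc c))"
        using left_end_in_cell[of a "Suc c"] by simp
      ultimately have "p = (a, Suc c)" using is_divisionD(5)[OF D p(1) a] by blast
      then show ?thesis using False by simp
    qed
  qed
  show s0: "(2 * q, Suc c) \<in> D" and s1: "(2 * q + 1, Suc c) \<in> D" by (rule sib, simp)+
  have l: "x \<in> cell (fst p) (snd p)" if "x \<in> cell i b" "p = (i, b)" for x p i b using that by simp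
  show new: "(q, c) \<notin> D"
  proof
    assume "(q, c) \<in> D"
    moreover have "real (2 * q) / 2 ^ Suc c \<in> cell (2 * q) (Suc c)" by (rule left_end_in_cell)
    ultimately have "(q, c) = (2 * q, Suc c)"
      using is_divisionD(5)[OF D, of "(q, c)" "(2 * q, Suc c)"] s0 cell_Suc[of q c] by simp
    then show False by simp
  qed
  let ?D = "insert (q, c) (D - {(2 * q, Suc c), (2 * q + 1, Suc c)})"
  show "is_division ?D"
    unfolding is_division_def
  proof (intro conjI ballI)
    show "finite ?D" using is_divisionD(1)[OF D] by simp
    show "fst p < 2 ^ snd p" "m \<le> snd p" if "p \<in> ?D" for p
      using that q mc is_divisionD(2,3)[OF D, of p] by auto
    fix x :: real assume x: "x \<in> {0..<1}"
    then obtain p where p: "p \<in> D" "x \<in> cell (fst p) (snd p)" using is_divisionD(4)[OF D] by blast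
    have uniq: "p' = p" if "p' \<in> D" "x \<in> cell (fst p') (snd p')" for p'
      using is_divisionD(5)[OF D that(1) p(1) that(2) p(2)] .
    show "\<exists>!p. p \<in> ?D \<and> x \<in> cell (fst p) (snd p)"
    proof (cases "p \<in> {(2 * q, Suc c), (2 * q + 1, Suc c)}")
      case True
      then have "p = (2 * q, Suc c) \<or> p = (2 * q + 1, Suc c)" by blast
      then have "x \<in> cell (2 * q) (Suc c) \<union> cell (2 * q + 1) (Suc c)" using p(2) by (elim disjE) simp_all
      then have "x \<in> cell q c" by (simp only: cell_Suc[of q c])
      then have "(q, c) \<in> ?D \<and> x \<in> cell (fst (q, c)) (snd (q, c))"
        unfolding fst_conv snd_conv by (intro conjI insertI1)
      moreover have "p' = (q, c)" if p': "p' \<in> ?D \<and> x \<in> cell (fst p') (snd p')" for p'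
      proof (rule ccontr)
        assume "p' \<noteq> (q, c)"
        then have "p' \<in> D - {(2 * q, Suc c), (2 * q + 1, Suc c)}" using p' by blast
        then show False using uniq[of p'] p' True by blast
      qed
      ultimately show ?thesis by (rule ex1I)
    next
      case False
      have "x \<notin> cell q c"
      proof
        assume "x \<in> cell q c"
        then consider "x \<in> cell (2 * q) (Suc c)" | "x \<in> cell (2 * q + 1) (Suc c)" using cell_Suc by blast
        then show False using uniq[OF s0] uniq[OF s1] False by cases auto
      qed
      have "p \<in> ?D \<and> x \<in> cell (fst p) (snd p)" using False p by blast
      moreover have "p' = p" if p': "p' \<in> ?D \<and> x \<in> cell (fst p') (snd p')" for p'
      proof -
        have "p' \<noteq> (q, c)" using p' \<open>x \<notin> cell q c\<close> by auto
        then show ?thesis using uniq[of p'] p' by blast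
      qed
      ultimately show ?thesis by (rule ex1I)
    qed
  qed
qed

text \<open>Induction on the number of pieces. Two deepest siblings are merged, the resulting
  division is mapped to the leaves, and a rotation makes the merged cell the last leaf. Halving the
  last leaf is precisely the passage from \<open>R\<^sub>n\<close> to the next division. The
  induction ends at the uniform division of level \<open>m\<close>.\<close>

lemma division_to_leaves:
  assumes H: "subgroup H G" "r \<in> H" "y \<in> H"
  shows "is_division D \<Longrightarrow> M \<le> card D \<and> (\<exists>h\<in>H. \<forall>p\<in>D. \<exists>j<card D. cell_map h p (card D) j)"
proof (induction "card D" arbitrary: D rule: less_induct)
  case less
  note D = less.prems
  define b where "b = Max (snd ` D)"
  have fin: "finite (snd ` D)" using is_divisionD(1)[OF D] by simp
  have Dne: "D \<noteq> {}" using is_divisionD(4)[OF D, of 0] by auto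
  have max: "snd p \<le> b" if "p \<in> D" for p unfolding b_def by (rule Max_ge[OF fin]) (use that in simp)
  have "b \<in> snd ` D" unfolding b_def by (rule Max_in[OF fin]) (use Dne in simp)
  then obtain a where a: "(a, b) \<in> D" by auto
  show ?case
  proof (cases "b = m")
    case True
    have Deq: "D = (\<lambda>i. (i, m)) ` {..<M}"
    proof (intro equalityI subsetI)
      fix p assume p: "p \<in> D"
      then have "snd p = m" using max[OF p] is_divisionD(3)[OF D p] True by simp
      then show "p \<in> (\<lambda>i. (i, m)) ` {..<M}"
        using is_divisionD(2)[OF D p] by (intro image_eqI[of _ _ "fst p"]) (auto simp: M_def)
    next
      fix p assume "p \<in> (\<lambda>i. (i, m)) ` {..<M}"
      then obtain i where i: "i < 2 ^ m" "p = (i, m)" by (auto simp: M_def)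
      then have "real i / 2 ^ m \<in> {0..<1}" using cell_subset left_end_in_cell by blast
      then obtain p' where p': "p' \<in> D" "real i / 2 ^ m \<in> cell (fst p') (snd p')" using is_divisionD(4)[OF D] by blast
      have e: "snd p' = m" using max[OF p'(1)] is_divisionD(3)[OF D p'(1)] True by simp
      then have "fst p' = i" using p'(2) left_end_in_cell_iff[of m m i "fst p'"] by simp
      then show "p \<in> D" using p'(1) e i by (metis prod.collapse)
    qed
    have card: "card D = M" unfolding Deq by (simp add: card_image inj_on_def)
    have "\<exists>j<M. cell_map \<one> p M j" if "p \<in> D" for p
    proof -
      obtain i where i: "i < M" "p = (i, m)" using \<open>p \<in> D\<close> Deq by auto
      have "cell_map \<one> p M i"
        using leaf_map_one[OF order_refl i(1)] i bp_M[of i] bp_M[of "Suc i"]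
        by (simp add: cell_map_def leaf_map_def add.commute)
      then show ?thesis using i by blast
    qed
    then have "\<forall>p\<in>D. \<exists>j<M. cell_map \<one> p M j" by blast
    then show ?thesis unfolding card using subgroup.one_closed[OF H(1)] by blast
  next
    case False
    then have "m < b" using is_divisionD(3)[OF D a] by simp
    then obtain c where c: "b = Suc c" "m \<le> c" by (cases b) auto
    define q where "q = a div 2"
    define D' where "D' = insert (q, c) (D - {(2 * q, b), (2 * q + 1, b)})"
    have mem: "(2 * q, b) \<in> D" "(2 * q + 1, b) \<in> D" "(q, c) \<notin> D" and D': "is_division D'"
      using division_merge[OF D a[unfolded c(1)] max[unfolded c(1)] c(2)] unfolding D'_def q_def c(1) by blast+
    have "card (D - {(2 * q, b), (2 * q + 1, b)}) = card D - 2"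
      by (subst card_Diff_subset) (use mem in auto)
    moreover have "2 \<le> card D"
      using card_mono[OF is_divisionD(1)[OF D], of "{(2 * q, b), (2 * q + 1, b)}"] mem by simp
    ultimately have card: "card D = Suc (card D')"
      unfolding D'_def using is_divisionD(1)[OF D] mem(3) by simp
    obtain h' where M: "M \<le> card D'" and h': "h' \<in> H" "\<forall>p\<in>D'. \<exists>j<card D'. cell_map h' p (card D') j"
      using less.hyps[OF _ D'] card by auto
    obtain v where v: "card D' = M + v" using M le_Suc_ex by blast
    have qD': "(q, c) \<in> D'" by (simp add: D'_def)
    then obtain j0 where j0: "j0 < M + v" "cell_map h' (q, c) (M + v) j0" using h'(2) v by auto
    \<comment> \<open>The rotation that brings leaf \<open>j0\<close> to the last place.\<close>
    define s where "s = M + v - 1 - j0"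
    define h where "h = rr v [^] s \<otimes> h'"
    have hH: "h \<in> H" unfolding h_def by (intro subgroup.m_closed[OF H(1)] pow_in rr_in H h')
    have hG: "h' \<in> carrier G" "h \<in> carrier G" using h'(1) hH subgroup.subset[OF H(1)] by auto
    have step: "cell_map h p (M + v) ((j + s) mod (M + v))"
      if p: "p \<in> D'" and j: "j < M + v" "cell_map h' p (M + v) j" for p j
    proof -
      have "leaf_map (rr v [^] s) (M + v) j ((j + s) mod (M + v))" by (rule rr_pow_leaf_map[OF j(1)])
      then have ag: "aff (rr v [^] s) (bp (M + v) j) (bp (M + v) (Suc j))
          (bp (M + v) ((j + s) mod (M + v))) (bp (M + v) (Suc ((j + s) mod (M + v))))"
        by (simp add: leaf_map_def)
      have "(real (fst p) + 1) / 2 ^ snd p \<le> 1"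
      proof -
        have "fst p < 2 ^ snd p" by (rule is_divisionD(2)[OF D' p])
        then have "real (Suc (fst p)) \<le> 2 ^ snd p" by (metis Suc_leI of_nat_le_iff of_nat_numeral of_nat_power)
        then show ?thesis by (simp add: divide_le_eq_1)
      qed
      then show ?thesis unfolding cell_map_def h_def
        by (intro aff_mult[OF _ hG(1) _ cell_lt _ _ j(2)[unfolded cell_map_def] ag]) (use bp_less[of "M + v" j] j in auto)
    qed
    have last: "(j0 + s) mod (M + v) = M + v - 1" using j0(1) by (simp add: s_def)
    have main: "cell_map h (q, c) (M + v) (M + v - 1)" using step[OF qD' j0] last by simp
    have Sl: "Suc (M + v - 1) = M + v" using M_ge by simp
    have hq: "aff h (real q / 2 ^ c) ((real q + 1) / 2 ^ c) (1 - w / 2 ^ v) 1"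
      using main unfolding cell_map_def Sl bp_last by simp
    have mid: "(real q / 2 ^ c + (real q + 1) / 2 ^ c) / 2 = (real (2 * q) + 1) / 2 ^ b"
      "real q / 2 ^ c = real (2 * q) / 2 ^ b" "(real q + 1) / 2 ^ c = (real (2 * q + 1) + 1) / 2 ^ b"
      "(real (2 * q) + 1) / 2 ^ b = real (2 * q + 1) / 2 ^ b"
      unfolding c(1) by (simp_all add: field_simps)
    have midl: "(1 - w / 2 ^ v + 1) / 2 = bp (Suc (M + v)) (M + v)" unfolding bp_Suc_last by simp
    have "bp (Suc (M + v)) (M + v - 1) = bp (M + v) (M + v - 1)" by (rule bp_Suc) (use M_ge in simp)
    then have bl: "bp (Suc (M + v)) (M + v - 1) = 1 - w / 2 ^ v" unfolding bp_last .
    have half0: "cell_map h (2 * q, b) (Suc (M + v)) (M + v - 1)"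
      using aff_halves(1)[OF hq cell_lt, unfolded mid(1) midl, unfolded mid(2)]
      unfolding cell_map_def Sl bl fst_conv snd_conv .
    have half1: "cell_map h (2 * q + 1, b) (Suc (M + v)) (M + v)"
      using aff_halves(2)[OF hq cell_lt, unfolded mid(1) midl, unfolded mid(3,4)]
      unfolding cell_map_def bp_end fst_conv snd_conv .
    have "\<exists>j<Suc (M + v). cell_map h p (Suc (M + v)) j" if p: "p \<in> D" for p
    proof -
      consider "p = (2 * q, b)" | "p = (2 * q + 1, b)" | "p \<in> D'" "p \<noteq> (q, c)"
        using p mem(3) by (auto simp: D'_def)
      then show ?thesis
      proof cases
        case 1
        then show ?thesis using half0 by (intro exI[of _ "M + v - 1"]) simp
      next
        case 2
        then show ?thesis using half1 by (intro exI[of _ "M + v"]) simp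
      next
        case 3
        then obtain j where j: "j < M + v" "cell_map h' p (M + v) j" using h'(2) v by auto
        define j' where "j' = (j + s) mod (M + v)"
        have j': "cell_map h p (M + v) j'" using step[OF 3(1) j] by (simp add: j'_def)
        have "j' < M + v" unfolding j'_def using M_ge by simp
        \<comment> \<open>Injectivity of \<open>h\<close> reserves the last leaf for the merged
          cell; all other leaves are the same before and after the halving.\<close>
        moreover have "j' \<noteq> M + v - 1"
        proof
          assume e: "j' = M + v - 1"
          let ?x = "real (fst p) / 2 ^ snd p" and ?z = "real q / 2 ^ c"
          have "h ?x = bp (M + v) j'" using aff_left[OF j'[unfolded cell_map_def] cell_lt] .
          moreover have "h ?z = bp (M + v) j'" using aff_left[OF main[unfolded cell_map_def fst_conv snd_conv] cell_lt] e by simp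
          moreover have "?x \<in> {0..<1}" "?z \<in> {0..<1}"
            using cell_subset is_divisionD(2)[OF D' 3(1)] is_divisionD(2)[OF D' qD'] left_end_in_cell by fastforce+
          ultimately have "?x = ?z" using apply_eq_iff[OF hG(2)] by metis
          then have "?x \<in> cell q c" using left_end_in_cell[of q c] by simp
          then have "p = (q, c)"
            using is_divisionD(5)[OF D' 3(1) qD'] left_end_in_cell[of "fst p" "snd p"] by simp
          then show False using 3(2) by simp
        qed
        ultimately have "Suc j' < M + v" by simp
        then have "cell_map h p (Suc (M + v)) j'" using j' by (simp add: cell_map_def bp_Suc)
        then show ?thesis using \<open>j' < M + v\<close> by (intro exI[of _ j']) simp
      qed
    qed
    then have "\<forall>p\<in>D. \<exists>j<card D. cell_map h p (card D) j" unfolding card v by blast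
    then show ?thesis using hH M card by auto
  qed
qed

section \<open>Permutations of the leaves\<close>

definition swap :: "real \<Rightarrow> real" where
  "swap = restrict (\<lambda>x. if x < w then x + w else if x < 2 * w then x - w else x) {0..<1}"

lemma swap_carrier:
  assumes "G = thompson_V"
  shows "swap \<in> carrier G"
proof -
  have "V_map swap" unfolding swap_def
  proof (rule V_map_permute_cells[where \<sigma> = "Transposition.transpose 0 1" and m = m])
    show "restrict (\<lambda>x. if x < w then x + w else if x < 2 * w then x - w else x) {0..<1} \<in> Bij {0..<1}"
      by (rule restrict_BijI[of _ _ "\<lambda>x. if x < w then x + w else if x < 2 * w then x - w else x"])
         (use w_bounds in \<open>auto split: if_splits\<close>)
    show "Transposition.transpose 0 1 a < 2 ^ m" if "a < 2 ^ m" for a :: nat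
      using that M_ge unfolding M_def by (auto simp: Transposition.transpose_def)
    fix a x assume a: "a < (2::nat) ^ m" and x: "x \<in> cell a m"
    have x: "real a * w \<le> x" "x < real a * w + w" using x by (auto simp: cell_m)
    consider "a = 0" | "a = 1" | "2 \<le> a" by linarith
    then show "(if x < w then x + w else if x < 2 * w then x - w else x) = x + (real (Transposition.transpose 0 1 a) - real a) / 2 ^ m"
    proof cases
      case 3
      then have "2 * w \<le> real a * w" using w_bounds by (intro mult_right_mono) auto
      then have "\<not> x < w" "\<not> x < 2 * w" using x(1) w_bounds by linarith+
      then show ?thesis using 3 by (simp add: Transposition.transpose_def)
    qed (use x in \<open>simp_all add: Transposition.transpose_def\<close>, simp_all add: w_def)
  qed
  then show ?thesis using assms by (simp add: thompson_V_def)
qed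

lemma swap_swap:
  assumes "G = thompson_V"
  shows "swap \<otimes> swap = \<one>"
proof (rule carrier_eqI)
  show "swap \<otimes> swap \<in> carrier G" using swap_carrier[OF assms] by simp
  fix x :: real assume x: "x \<in> {0..<1}"
  have "(swap \<otimes> swap) x = swap (swap x)" using swap_carrier[OF assms] x by (simp add: mult_apply)
  also have "\<dots> = x" using x w_bounds by (auto simp: swap_def)
  finally show "(swap \<otimes> swap) x = \<one> x" using x one_apply by simp
qed simp

lemma swap_leaf_map:
  assumes n: "M \<le> n" and i: "i < n"
  shows "leaf_map swap n i (Transposition.transpose 0 1 i)"
proof -
  have b: "bp n 0 = 0" "bp n (Suc 0) = w" "bp n 2 = 2 * w"
    using n M_ge bp_0 by (simp_all add: bp_def)
  consider "i = 0" | "i = 1" | "2 \<le> i" by linarith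
  then show ?thesis
  proof cases
    case 1
    have "aff swap 0 w (0 + w) (w + w)"
      by (rule aff_translation) (use w_bounds in \<open>auto simp: swap_def\<close>)
    then show ?thesis using 1 b by (simp add: leaf_map_def numeral_2_eq_2[symmetric])
  next
    case 2
    have "aff swap w (2 * w) (w + (- w)) (2 * w + (- w))"
      by (rule aff_translation) (use w_bounds in \<open>auto simp: swap_def\<close>)
    then show ?thesis using 2 b by (simp add: leaf_map_def numeral_2_eq_2[symmetric])
  next
    case 3
    have "2 * w \<le> bp n i" using bp_mono[OF n 3] b by simp
    then have "aff swap (bp n i) (bp n (Suc i)) (bp n i + 0) (bp n (Suc i) + 0)"
      by (intro aff_translation) (use w_bounds bp_less[OF n i] bp_bounds[OF n, of "Suc i"] in \<open>auto simp: swap_def\<close>)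
    then show ?thesis using 3 by (simp add: leaf_map_def Transposition.transpose_def)
  qed
qed

text \<open>A full cycle and one transposition of neighbours generate the symmetric group: rotations
  move the transposition to every adjacent pair, and conjugating adjacent transpositions with each
  other gives the rest.\<close>

lemma leaf_map_permutation:
  assumes H: "subgroup H G" "r \<in> H" "y \<in> H" and swap: "swap \<in> H"
  shows "\<pi> permutes {..<M + v} \<Longrightarrow> \<exists>h\<in>H. \<forall>i<M + v. leaf_map h (M + v) i (\<pi> i)"
proof -
  let ?n = "M + v"
  have HG: "h \<in> carrier G" if "h \<in> H" for h using that subgroup.subset[OF H(1)] by blast
  have n: "M \<le> ?n" "2 \<le> ?n" using M_ge by simp_all
  define R where "R \<pi> \<longleftrightarrow> (\<exists>h\<in>H. \<forall>i<?n. leaf_map h ?n i (\<pi> i))" for \<pi>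
  have comp: "R (\<sigma> \<circ> \<tau>)" if R: "R \<sigma>" "R \<tau>" and \<tau>: "\<And>i. i < ?n \<Longrightarrow> \<tau> i < ?n" for \<sigma> \<tau>
  proof -
    obtain g where g: "g \<in> H" "\<And>i. i < ?n \<Longrightarrow> leaf_map g ?n i (\<sigma> i)" using R(1) unfolding R_def by blast
    obtain h where h: "h \<in> H" "\<And>i. i < ?n \<Longrightarrow> leaf_map h ?n i (\<tau> i)" using R(2) unfolding R_def by blast
    have "leaf_map (g \<otimes> h) ?n i (\<sigma> (\<tau> i))" if i: "i < ?n" for i
      by (rule leaf_map_mult[OF HG[OF g(1)] HG[OF h(1)] n(1) i \<tau>[OF i] h(2)[OF i] g(2)[OF \<tau>[OF i]]])
    then show ?thesis unfolding R_def using subgroup.m_closed[OF H(1) g(1) h(1)] by auto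
  qed
  have rot: "R (\<lambda>i. (i + s) mod ?n)" for s
    unfolding R_def using rr_pow_leaf_map[of _ v s] pow_in[OF H(1) rr_in[OF H]] by blast
  have R_swap: "R (Transposition.transpose 0 1)" unfolding R_def using swap swap_leaf_map[OF n(1)] by blast
  have R_cong: "R \<tau>" if "R \<sigma>" "\<And>i. i < ?n \<Longrightarrow> \<sigma> i = \<tau> i" for \<sigma> \<tau>
    using that unfolding R_def by auto
  have adj: "R (Transposition.transpose i (Suc i))" if i: "Suc i < ?n" for i
  proof (rule R_cong)
    show "R ((\<lambda>j. (j + i) mod ?n) \<circ> (Transposition.transpose 0 1 \<circ> (\<lambda>j. (j + (?n - i)) mod ?n)))"
    proof (intro comp rot R_swap)
      have "(j + (?n - i)) mod ?n < ?n" for j using n by (intro mod_less_divisor) linarith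
      then show "(Transposition.transpose 0 1 \<circ> (\<lambda>j. (j + (?n - i)) mod ?n)) j < ?n"
        "(j + (?n - i)) mod ?n < ?n" for j
        using n M_ge by (auto simp: Transposition.transpose_def)
    qed
    fix j assume j: "j < ?n"
    have l: "(j + (?n - i)) mod ?n = (if i \<le> j then j - i else j + (?n - i))"
      using i j by (auto simp: mod_if)
    show "((\<lambda>j. (j + i) mod ?n) \<circ> (Transposition.transpose 0 1 \<circ> (\<lambda>j. (j + (?n - i)) mod ?n))) j = Transposition.transpose i (Suc i) j"
      unfolding comp_def l using i j by (auto simp: Transposition.transpose_def mod_if)
  qed
  have tr: "R (Transposition.transpose i (Suc (i + d)))" if "Suc (i + d) < ?n" for i d
    using that
  proof (induction d)
    case 0
    then show ?case using adj by simp
  next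
    case (Suc d)
    let ?t = "Transposition.transpose (Suc (i + d)) (Suc (Suc (i + d)))"
    have "?t \<circ> Transposition.transpose i (Suc (i + d)) \<circ> ?t = Transposition.transpose i (Suc (Suc (i + d)))"
      by (rule ext) (auto simp: Transposition.transpose_def)
    moreover have "R (?t \<circ> Transposition.transpose i (Suc (i + d)) \<circ> ?t)"
      by (intro comp adj Suc.IH) (use Suc.prems in \<open>auto simp: Transposition.transpose_def\<close>)
    ultimately show ?case by simp
  qed
  have tr': "R (Transposition.transpose a b)" if "a < ?n" "b < ?n" "a \<noteq> b" for a b
  proof (cases "a < b")
    case True
    then obtain d where "b = Suc (a + d)" using less_imp_Suc_add by blast
    then show ?thesis using tr that by simp
  next
    case False
    then have "b < a" using that by simp
    then obtain d where "a = Suc (b + d)" using less_imp_Suc_add by blast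
    then show ?thesis using tr[of b d] that by (simp add: transpose_commute)
  qed
  assume "\<pi> permutes {..<M + v}"
  from this finite_lessThan have "R \<pi>"
  proof (induction rule: permutes_induct)
    case id
    show ?case unfolding R_def using subgroup.one_closed[OF H(1)] leaf_map_one[OF n(1)] by auto
  next
    case (swap a b p)
    show ?case
    proof (rule comp[OF tr' swap.IH])
      show "p i < ?n" if "i < ?n" for i using permutes_in_image[OF swap.hyps(4), of i] that by simp
    qed (use swap.hyps in auto)
  qed
  then show ?thesis by (simp add: R_def)
qed

lemma leaf_map_injective:
  assumes u: "u \<in> carrier G" and n: "M \<le> n" and i: "i < n" "i' < n" and j: "leaf_map u n i j" "leaf_map u n i' j"
  shows "i = i'"
proof -
  have "u (bp n i) = bp n j" "u (bp n i') = bp n j"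
    using aff_left[OF j(1)[unfolded leaf_map_def] bp_less[OF n i(1)]]
      aff_left[OF j(2)[unfolded leaf_map_def] bp_less[OF n i(2)]] by simp_all
  moreover have "bp n i \<in> {0..<1}" "bp n i' \<in> {0..<1}"
    using bp_bounds(1)[OF n] bp_less[OF n i(1)] bp_less[OF n i(2)] bp_bounds(2)[OF n, of "Suc i"] bp_bounds(2)[OF n, of "Suc i'"]
    by auto
  ultimately have "bp n i = bp n i'" using apply_eq_iff[OF u] by metis
  then show ?thesis
    using leaf_unique[OF n order_refl bp_less[OF n i(1)], of i'] bp_less[OF n i(2)] by simp
qed

text \<open>By continuity the right end of leaf \<open>i\<close> goes to the right end of leaf
  \<open>\<sigma> i\<close>. So successive leaves stay successive in cyclic order, and one value
  determines \<sigma>.\<close>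

lemma circle_leaf_rotation:
  assumes u: "continuous_map circle_topology circle_topology u" and n: "M \<le> n"
    and \<sigma>: "\<And>i. i < n \<Longrightarrow> \<sigma> i < n \<and> leaf_map u n i (\<sigma> i)" and i: "i < n"
  shows "\<sigma> i = (i + \<sigma> 0) mod n"
proof -
  have n0: "0 < n" using n M_ge by simp
  have proj: "circle_proj (bp n (Suc j)) = bp n (Suc j mod n)" if j: "j < n" for j
  proof (cases "Suc j = n")
    case True
    then show ?thesis using bp_0[OF n] by (simp add: circle_proj_def)
  next
    case False
    then have "bp n (Suc j) < 1" using bp_less[OF n, of "Suc j"] bp_bounds(2)[OF n, of "Suc (Suc j)"] j by simp
    then show ?thesis using False j by (simp add: circle_proj_def)
  qed
  have step: "\<sigma> (Suc i mod n) = Suc (\<sigma> i) mod n" if i: "i < n" for i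
  proof -
    have m: "Suc i mod n < n" "Suc (\<sigma> i) mod n < n" using n0 by simp_all
    have "u (circle_proj (bp n (Suc i))) = circle_proj (bp n (Suc (\<sigma> i)))"
      by (rule circle_left_limit[OF u _ bp_bounds(1)[OF n] bp_less[OF n i] bp_bounds(2)[OF n]
            bp_bounds(1)[OF n] bp_less[OF n] bp_bounds(2)[OF n]])
         (use \<sigma>[OF i] in \<open>simp_all add: leaf_map_def\<close>)
    then have "u (bp n (Suc i mod n)) = bp n (Suc (\<sigma> i) mod n)" using proj i \<sigma>[OF i] by simp
    moreover have "u (bp n (Suc i mod n)) = bp n (\<sigma> (Suc i mod n))"
      using aff_left[OF conjunct2[OF \<sigma>[OF m(1)], unfolded leaf_map_def] bp_less[OF n m(1)]] .
    ultimately have e: "bp n (\<sigma> (Suc i mod n)) = bp n (Suc (\<sigma> i) mod n)" by simp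
    show ?thesis
      using leaf_unique[OF n order_refl bp_less[OF n], of "\<sigma> (Suc i mod n)" "Suc (\<sigma> i) mod n"]
        \<sigma>[OF m(1)] e bp_less[OF n m(2)] by simp
  qed
  show ?thesis using i
  proof (induction i)
    case 0
    then show ?case using \<sigma>[of 0] by simp
  next
    case (Suc i)
    then have "\<sigma> (Suc i) = Suc (\<sigma> i) mod n" using step[of i] by simp
    then show ?case using Suc by (simp add: mod_Suc_eq)
  qed
qed

text \<open>Here the two groups part: in T the leaves can only be rotated, which is a power of
  \<open>rr v\<close>, while in V every permutation may occur and \<open>swap\<close> is
  needed.\<close>

lemma leaf_permuting_in_subgroup:
  assumes H: "subgroup H G" "r \<in> H" "y \<in> H" and swap: "G = thompson_V \<Longrightarrow> swap \<in> H"
    and u: "u \<in> carrier G" and \<sigma>: "\<And>i. i < M + v \<Longrightarrow> \<sigma> i < M + v \<and> leaf_map u (M + v) i (\<sigma> i)"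
  shows "u \<in> H"
proof (cases "G = thompson_V")
  case False
  then have "G = thompson_T" using thompson by simp
  then have cont: "continuous_map circle_topology circle_topology u"
    using u by (simp add: thompson_T_def homeomorphic_imp_continuous_map)
  have "u = rr v [^] \<sigma> 0"
  proof (rule leaf_map_eqI[OF u, of _ "M + v" \<sigma>])
    fix i assume i: "i < M + v"
    show "leaf_map u (M + v) i (\<sigma> i)" using \<sigma> i by blast
    have "\<sigma> i = (i + \<sigma> 0) mod (M + v)" by (rule circle_leaf_rotation[OF cont _ \<sigma> i]) simp
    then show "leaf_map (rr v [^] \<sigma> 0) (M + v) i (\<sigma> i)" using rr_pow_leaf_map[OF i] by simp
  qed simp_all
  then show ?thesis using pow_in[OF H(1) rr_in[OF H]] by simp
next
  case True
  have n: "M \<le> M + v" by simp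
  define \<pi> where "\<pi> i = (if i < M + v then \<sigma> i else i)" for i
  have inj: "inj_on \<sigma> {..<M + v}"
    by (rule inj_onI) (use leaf_map_injective[OF u n] \<sigma> in \<open>metis lessThan_iff\<close>)
  have "\<sigma> ` {..<M + v} = {..<M + v}"
    by (rule endo_inj_surj[OF _ _ inj]) (use \<sigma> in auto)
  then have "bij_betw \<sigma> {..<M + v} {..<M + v}" using inj by (simp add: bij_betw_def)
  then have "bij_betw \<pi> {..<M + v} {..<M + v}" by (subst bij_betw_cong[of _ _ \<sigma>]) (simp_all add: \<pi>_def)
  then have "\<pi> permutes {..<M + v}" by (rule bij_imp_permutes) (simp add: \<pi>_def)
  from leaf_map_permutation[OF H swap[OF True] this]
  obtain h where h: "h \<in> H" "\<forall>i<M + v. leaf_map h (M + v) i (\<pi> i)" by blast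
  have "u = h"
    by (rule leaf_map_eqI[OF u _ n, of _ \<pi>]) (use h \<sigma> subgroup.subset[OF H(1)] in \<open>auto simp: \<pi>_def\<close>)
  then show ?thesis using h(1) by simp
qed

text \<open>A uniform division fine enough for \<open>g\<close> and its image under \<open>g\<close>
  have equally many pieces, so elements \<open>h1\<close> and \<open>h2\<close> of \<open>H\<close>
  map them to the same leaves. What remains, \<open>h2 \<otimes> (g \<otimes> inv h1)\<close>,
  permutes these leaves.\<close>

theorem subgroup_eq_carrier:
  assumes H: "subgroup H G" and ys: "\<And>i. i < M \<Longrightarrow> ys i \<in> H" and swap: "G = thompson_V \<Longrightarrow> swap \<in> H"
  shows "H = carrier G"
proof (rule equalityI)
  show "H \<subseteq> carrier G" by (rule subgroup.subset[OF H])
  have ry: "r \<in> H" "y \<in> H" by (rule r_in_subgroup[OF H ys], assumption)+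
  show "carrier G \<subseteq> H"
  proof
    fix g assume g: "g \<in> carrier G"
    obtain L where L: "m \<le> L" "\<And>a. a < 2 ^ L \<Longrightarrow> \<exists>c e. c < 2 ^ e \<and> m \<le> e \<and>
        aff g (real a / 2 ^ L) ((real a + 1) / 2 ^ L) (real c / 2 ^ e) ((real c + 1) / 2 ^ e)"
      by (rule V_mapD[OF carrier_V_map[OF g], of m]) (rule that)
    then have "\<forall>a. \<exists>p. a < 2 ^ L \<longrightarrow> fst p < 2 ^ snd p \<and> m \<le> snd p \<and>
        aff g (real a / 2 ^ L) ((real a + 1) / 2 ^ L) (real (fst p) / 2 ^ snd p) ((real (fst p) + 1) / 2 ^ snd p)"
      by (metis fst_conv snd_conv)
    from choice[OF this] obtain \<kappa> where \<kappa>: "\<And>a. a < 2 ^ L \<Longrightarrow> fst (\<kappa> a) < 2 ^ snd (\<kappa> a) \<and> m \<le> snd (\<kappa> a) \<and>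
        aff g (real a / 2 ^ L) ((real a + 1) / 2 ^ L) (real (fst (\<kappa> a)) / 2 ^ snd (\<kappa> a)) ((real (fst (\<kappa> a)) + 1) / 2 ^ snd (\<kappa> a))"
      by blast
    have image: "g ` cell a L = cell (fst (\<kappa> a)) (snd (\<kappa> a))" if "a < 2 ^ L" for a
      unfolding cell_def by (rule aff_image[OF _ cell_lt cell_lt]) (use \<kappa>[OF that] in blast)
    have same: "a = a'" if aa: "a < 2 ^ L" "a' < 2 ^ L" and x: "x \<in> g ` cell a L" "x \<in> g ` cell a' L" for a a' x
    proof -
      obtain z z' where z: "z \<in> cell a L" "x = g z" "z' \<in> cell a' L" "x = g z'" using x by blast
      then have "z = z'" using apply_eq_iff[OF g, of z z'] cell_subset aa by blast
      then show ?thesis using z in_cell_iff cell_nonneg by metis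
    qed
    define P :: "(nat \<times> nat) set" where "P = (\<lambda>a. (a, L)) ` {..<2 ^ L}"
    have P: "is_division P" unfolding is_division_def
    proof (intro conjI ballI)
      show "fst p < 2 ^ snd p" "m \<le> snd p" if "p \<in> P" for p using that L(1) by (auto simp: P_def)
      fix x :: real assume "x \<in> {0..<1}"
      then have x: "0 \<le> x" "x < 1" by auto
      show "\<exists>!p. p \<in> P \<and> x \<in> cell (fst p) (snd p)"
        by (rule ex1I[of _ "(nat \<lfloor>x * 2 ^ L\<rfloor>, L)"])
           (use in_cell_iff[OF x(1)] floor_power_less[OF x] in \<open>auto simp: P_def\<close>)
    qed (simp add: P_def)
    have Q: "is_division (\<kappa> ` {..<2 ^ L})" unfolding is_division_def
    proof (intro conjI ballI)
      show "fst p < 2 ^ snd p" "m \<le> snd p" if "p \<in> \<kappa> ` {..<2 ^ L}" for p using that \<kappa> by auto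
      fix x :: real assume "x \<in> {0..<1}"
      then obtain z where z: "z \<in> {0..<1}" "g z = x"
        using apply_in[OF inv_closed[OF g]] inv_apply(2)[OF g] by blast
      then obtain p where p: "p \<in> P" "z \<in> cell (fst p) (snd p)" using is_divisionD(4)[OF P] by blast
      then obtain a where a: "a < 2 ^ L" "z \<in> cell a L" by (auto simp: P_def)
      have x: "x \<in> g ` cell a L" using a z by blast
      show "\<exists>!p. p \<in> \<kappa> ` {..<2 ^ L} \<and> x \<in> cell (fst p) (snd p)"
      proof (rule ex1I[of _ "\<kappa> a"])
        show "\<kappa> a \<in> \<kappa> ` {..<2 ^ L} \<and> x \<in> cell (fst (\<kappa> a)) (snd (\<kappa> a))" using a x image[OF a(1)] by auto
        fix p assume p: "p \<in> \<kappa> ` {..<2 ^ L} \<and> x \<in> cell (fst p) (snd p)"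
        then obtain a' where a': "a' < 2 ^ L" "p = \<kappa> a'" by auto
        then have "x \<in> g ` cell a' L" using p image[OF a'(1)] by simp
        then show "p = \<kappa> a" using same[OF a(1) a'(1) x] a'(2) by simp
      qed
    qed simp
    have inj: "inj_on \<kappa> {..<2 ^ L}"
    proof (rule inj_onI)
      fix a a' assume a: "a \<in> {..<2 ^ L}" "a' \<in> {..<2 ^ L}" "\<kappa> a = \<kappa> a'"
      then have "g ` cell a L = g ` cell a' L" using image by simp
      moreover have "g (real a / 2 ^ L) \<in> g ` cell a L" using left_end_in_cell by blast
      ultimately show "a = a'" using same[of a a' "g (real a / 2 ^ L)"] a by simp
    qed
    have cardP: "card P = 2 ^ L" unfolding P_def by (simp add: card_image inj_on_def)
    have cardQ: "card (\<kappa> ` {..<2 ^ L}) = 2 ^ L" using card_image[OF inj] by simp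
    obtain h1 where M: "M \<le> 2 ^ L" and h1: "h1 \<in> H" "\<And>p. p \<in> P \<Longrightarrow> \<exists>j<2 ^ L. cell_map h1 p (2 ^ L) j"
      using division_to_leaves[OF H ry P] unfolding cardP by blast
    obtain h2 where h2: "h2 \<in> H" "\<And>p. p \<in> \<kappa> ` {..<2 ^ L} \<Longrightarrow> \<exists>j<2 ^ L. cell_map h2 p (2 ^ L) j"
      using division_to_leaves[OF H ry Q] unfolding cardQ by blast
    obtain v where v: "2 ^ L = M + v" using M le_Suc_ex by blast
    have hG: "h1 \<in> carrier G" "h2 \<in> carrier G" using h1 h2 subgroup.subset[OF H] by auto
    have "\<forall>a. \<exists>j. a < 2 ^ L \<longrightarrow> j < 2 ^ L \<and> cell_map h1 (a, L) (2 ^ L) j" using h1(2) by (auto simp: P_def)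
    from choice[OF this] obtain j1 where j1: "\<And>a. a < 2 ^ L \<Longrightarrow> j1 a < 2 ^ L \<and> cell_map h1 (a, L) (2 ^ L) (j1 a)" by blast
    have left1: "h1 (real a / 2 ^ L) = bp (2 ^ L) (j1 a)" if "a < 2 ^ L" for a
      using aff_left[OF conjunct2[OF j1[OF that], unfolded cell_map_def fst_conv snd_conv] cell_lt] .
    have inj1: "inj_on j1 {..<2 ^ L}"
    proof (rule inj_onI)
      fix a a' assume a: "a \<in> {..<2 ^ L}" "a' \<in> {..<2 ^ L}" "j1 a = j1 a'"
      have "h1 (real a / 2 ^ L) = bp (2 ^ L) (j1 a)" "h1 (real a' / 2 ^ L) = bp (2 ^ L) (j1 a')"
        using left1 a by simp_all
      moreover have "real a / 2 ^ L \<in> {0..<1}" "real a' / 2 ^ L \<in> {0..<1}"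
        using cell_subset left_end_in_cell a by blast+
      ultimately have "real a / 2 ^ L = real a' / 2 ^ L" using apply_eq_iff[OF hG(1)] a(3) by metis
      then show "a = a'" by simp
    qed
    have surj1: "j1 ` {..<2 ^ L} = {..<2 ^ L}"
      by (rule endo_inj_surj[OF _ _ inj1]) (use j1 in auto)
    define u where "u = h2 \<otimes> (g \<otimes> inv h1)"
    have u: "u \<in> carrier G" unfolding u_def using hG g by simp
    have "\<exists>j'. j' < M + v \<and> leaf_map u (M + v) j j'" if j: "j < M + v" for j
    proof -
      obtain a where a: "a < 2 ^ L" "j1 a = j" using j surj1 unfolding v[symmetric] by (metis imageE lessThan_iff)
      obtain j2 where j2: "j2 < 2 ^ L" "cell_map h2 (\<kappa> a) (2 ^ L) j2" using h2(2)[of "\<kappa> a"] a by auto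
      have "aff h1 (real a / 2 ^ L) ((real a + 1) / 2 ^ L) (bp (2 ^ L) j) (bp (2 ^ L) (Suc j))"
        using j1[OF a(1)] a(2) by (simp add: cell_map_def)
      then have 1: "aff (inv h1) (bp (2 ^ L) j) (bp (2 ^ L) (Suc j)) (real a / 2 ^ L) ((real a + 1) / 2 ^ L)"
      proof (rule aff_inverse[OF _ cell_lt])
        show "bp (2 ^ L) j < bp (2 ^ L) (Suc j)" using bp_less[OF M] j v by simp
        fix x assume "real a / 2 ^ L \<le> x" "x < (real a + 1) / 2 ^ L"
        then have "x \<in> {0..<1}" using subsetD[OF cell_subset[OF a(1)], of x] unfolding cell_def by simp
        then show "(inv h1) (h1 x) = x" by (rule inv_apply(1)[OF hG(1)])
      qed
      have 2: "aff g (real a / 2 ^ L) ((real a + 1) / 2 ^ L) (real (fst (\<kappa> a)) / 2 ^ snd (\<kappa> a)) ((real (fst (\<kappa> a)) + 1) / 2 ^ snd (\<kappa> a))"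
        using \<kappa>[OF a(1)] by blast
      have bj: "0 \<le> bp (2 ^ L) j" "bp (2 ^ L) j < bp (2 ^ L) (Suc j)" "bp (2 ^ L) (Suc j) \<le> 1"
        using bp_bounds[OF M] bp_less[OF M] j v by simp_all
      have "aff (g \<otimes> inv h1) (bp (2 ^ L) j) (bp (2 ^ L) (Suc j)) (real (fst (\<kappa> a)) / 2 ^ snd (\<kappa> a)) ((real (fst (\<kappa> a)) + 1) / 2 ^ snd (\<kappa> a))"
        by (rule aff_mult[OF g inv_closed[OF hG(1)] bj cell_lt 1 2])
      from aff_mult[OF hG(2) _ bj cell_lt this j2(2)[unfolded cell_map_def]]
      have "leaf_map u (2 ^ L) j j2" unfolding u_def leaf_map_def using g hG by simp
      then show ?thesis using j2(1) v by auto
    qed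
    then have "\<forall>j. \<exists>j'. j < M + v \<longrightarrow> j' < M + v \<and> leaf_map u (M + v) j j'" by blast
    from choice[OF this] obtain \<sigma> where \<sigma>: "\<And>j. j < M + v \<Longrightarrow> \<sigma> j < M + v \<and> leaf_map u (M + v) j (\<sigma> j)" by blast
    have uH: "u \<in> H" by (rule leaf_permuting_in_subgroup[OF H ry swap u \<sigma>])
    have "g = inv h2 \<otimes> u \<otimes> h1"
      unfolding u_def using g hG by (simp add: m_assoc inv_solve_left)
    then show "g \<in> H" using uH h1(1) h2(1) by (simp add: subgroup.m_closed[OF H] subgroup.m_inv_closed[OF H])
  qed
qed

section \<open>Displacing generators\<close>

definition fixes_cell :: "nat \<Rightarrow> (real \<Rightarrow> real) \<Rightarrow> bool" where
  "fixes_cell j g \<longleftrightarrow> g \<in> carrier G \<and> (\<forall>x\<in>cell j m. g x = x)"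

lemma cell_M_subset: "j < M \<Longrightarrow> cell j m \<subseteq> {0..<1}"
  using cell_subset by (simp add: M_def)

lemma cell_exists: "x \<in> {0..<1} \<Longrightarrow> \<exists>j<M. x \<in> cell j m"
  by (rule exI[of _ "nat \<lfloor>x * 2 ^ m\<rfloor>"]) (use floor_power_less[of x m] in \<open>simp add: in_cell_iff M_def\<close>)

lemma cell_unique: "x \<in> cell i m \<Longrightarrow> x \<in> cell j m \<Longrightarrow> i = j"
  using in_cell_iff[OF cell_nonneg, of x i m] in_cell_iff[OF cell_nonneg, of x i m j m] by simp

lemma cell_bp: "j < M \<Longrightarrow> cell j m = {bp M j ..< bp M (Suc j)}"
  using bp_M[of j] bp_M[of "Suc j"] by (simp add: cell_def add.commute)

lemma r_pow_cell:
  assumes "j < M" "x \<in> cell j m"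
  shows "(r [^] s) x \<in> cell ((j + s) mod M) m"
proof -
  have l: "(j + s) mod M < M" using M_ge by simp
  have "aff (r [^] s) (bp M j) (bp M (Suc j)) (bp M ((j + s) mod M)) (bp M (Suc ((j + s) mod M)))"
    using rr_pow_leaf_map[of j 0 s] assms(1) by (simp add: leaf_map_def)
  from aff_range[OF this bp_less[OF order_refl assms(1)] bp_less[OF order_refl l]] assms
  show ?thesis by (simp add: cell_bp[OF l] cell_bp[OF assms(1)])
qed

lemma y_fixes_cell: "2 \<le> j \<Longrightarrow> j < M \<Longrightarrow> fixes_cell j y"
  unfolding fixes_cell_def
proof (intro conjI ballI y_carrier)
  fix x assume j: "2 \<le> j" "j < M" and x: "x \<in> cell j m"
  have "2 * w \<le> real j * w" using j w_bounds by (intro mult_right_mono) auto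
  moreover have "real j * w \<le> x" using x by (simp add: cell_m)
  ultimately have "2 * w \<le> x" by linarith
  moreover have "x \<in> {0..<1}" by (rule subsetD[OF cell_M_subset[OF j(2)] x])
  ultimately show "y x = x" using representsD(2)[OF represents_y, of x] w_bounds by (simp add: bump_def)
qed

lemma swap_fixes_cell: "G = thompson_V \<Longrightarrow> 2 \<le> j \<Longrightarrow> j < M \<Longrightarrow> fixes_cell j swap"
  unfolding fixes_cell_def
proof (intro conjI ballI swap_carrier)
  fix x assume j: "2 \<le> j" "j < M" and x: "x \<in> cell j m"
  have "2 * w \<le> real j * w" using j w_bounds by (intro mult_right_mono) auto
  moreover have "real j * w \<le> x" using x by (simp add: cell_m)
  ultimately have "2 * w \<le> x" by linarith
  moreover have "x \<in> {0..<1}" by (rule subsetD[OF cell_M_subset[OF j(2)] x])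
  ultimately show "swap x = x" using w_bounds by (simp add: swap_def)
qed

lemma ys_fixes_cell:
  assumes i: "i < M" and j: "j < M" "j \<noteq> i" "j \<noteq> Suc i mod M"
  shows "fixes_cell j (ys i)"
  unfolding fixes_cell_def
proof (intro conjI ballI ys_carrier)
  fix x assume x: "x \<in> cell j m"
  have xW: "x \<in> {0..<1}" using x cell_M_subset[OF j(1)] by blast
  define z where "z = (inv (r [^] i)) x"
  have z: "z \<in> {0..<1}" unfolding z_def by (rule apply_in[OF _ xW]) simp
  have rz: "(r [^] i) z = x" unfolding z_def by (rule inv_apply(2)[OF _ xW]) simp
  obtain l where l: "l < M" "z \<in> cell l m" using cell_exists[OF z] by blast
  have "(l + i) mod M = j" using cell_unique[OF r_pow_cell[OF l, of i, unfolded rz] x] .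
  then have "l \<noteq> 0" "l \<noteq> 1" using mod_less[OF i] j(2,3) by (metis add_0, metis plus_1_eq_Suc)
  then have "y z = z" using y_fixes_cell[of l] l by (auto simp: fixes_cell_def)
  moreover have "ys i x = (r [^] i) (y z)" unfolding ys_def using xW z by (simp add: mult_apply z_def)
  ultimately show "ys i x = x" using rz by simp
qed

text \<open>The rightmost factor takes cell \<open>j\<close> to the last cell. The division into
  \<open>2 * M - 2\<close> leaves consists of the first \<open>M - 1\<close> cells and
  \<open>M - 1\<close> further leaves inside the last cell; rotating by \<open>M - 1\<close> places
  exchanges these two blocks. So everything outside cell \<open>j\<close> ends up in the last cell,
  and \<open>r [^] i\<close> selects the target.\<close>

definition squeeze :: "nat \<Rightarrow> nat \<Rightarrow> real \<Rightarrow> real" where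
  "squeeze j i = r [^] i \<otimes> rr (M - 2) [^] (M - 1) \<otimes> r [^] (M - 1 - j)"

lemma squeeze_carrier [simp]: "squeeze j i \<in> carrier G"
  by (simp add: squeeze_def)

lemma squeeze_cell:
  assumes j: "j < M" and x: "x \<in> {0..<1}" "x \<notin> cell j m"
  shows "squeeze j i x \<in> cell ((M - 1 + i) mod M) m"
proof -
  let ?n = "M + (M - 2)"
  obtain l where l: "l < M" "x \<in> cell l m" using cell_exists[OF x(1)] by blast
  define a where "a = (l + (M - 1 - j)) mod M"
  define z where "z = (r [^] (M - 1 - j)) x"
  have z: "z \<in> cell a m" unfolding z_def a_def by (rule r_pow_cell[OF l])
  have "a < M" unfolding a_def using M_ge by simp
  \<comment> \<open>Cell \<open>j\<close> is the only one rotated to the last place.\<close>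
  moreover have "a \<noteq> M - 1"
  proof
    assume "a = M - 1"
    then have "l = j" unfolding a_def using l(1) j by (auto simp: mod_if split: if_splits)
    then show False using l x by simp
  qed
  ultimately have a: "a < M - 1" by simp
  have zW: "z \<in> {0..<1}" unfolding z_def by (rule apply_in[OF _ x(1)]) simp
  have n: "M \<le> ?n" "a < ?n" "a + (M - 1) < ?n" using a M_ge by linarith+
  have b: "bp ?n a = bp M a" "bp ?n (Suc a) = bp M (Suc a)" "bp ?n (M - 1) = bp M (M - 1)"
  proof -
    have "a < M" "Suc a < M" "\<not> ?n \<le> a" "\<not> ?n \<le> Suc a" "\<not> ?n \<le> M - 1" "\<not> M \<le> M - 1"
      using a M_ge by linarith+
    then show "bp ?n a = bp M a" "bp ?n (Suc a) = bp M (Suc a)" "bp ?n (M - 1) = bp M (M - 1)"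
      unfolding bp_def by simp_all
  qed
  have "aff (rr (M - 2) [^] (M - 1)) (bp ?n a) (bp ?n (Suc a)) (bp ?n (a + (M - 1))) (bp ?n (Suc (a + (M - 1))))"
    using rr_pow_leaf_map[OF n(2), of "M - 1"] n(3) by (simp add: leaf_map_def)
  moreover have "bp ?n a \<le> z" "z < bp ?n (Suc a)" unfolding b using z a by (simp_all add: cell_bp)
  ultimately have "bp ?n (a + (M - 1)) \<le> (rr (M - 2) [^] (M - 1)) z"
    by (intro aff_range(1)[OF _ bp_less[OF n(1,2)] bp_less[OF n(1,3)]])
  moreover have "bp M (M - 1) \<le> bp ?n (a + (M - 1))" using bp_mono[OF n(1), of "M - 1" "a + (M - 1)"] b(3) by simp
  moreover have "(rr (M - 2) [^] (M - 1)) z \<in> {0..<1}" by (rule apply_in[OF _ zW]) simp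
  moreover have "Suc (M - 1) = M" using M_ge by simp
  ultimately have "(rr (M - 2) [^] (M - 1)) z \<in> cell (M - 1) m" using cell_bp[of "M - 1"] by simp
  from r_pow_cell[OF _ this, of i] M_ge
  have "(r [^] i) ((rr (M - 2) [^] (M - 1)) z) \<in> cell ((M - 1 + i) mod M) m" by simp
  moreover have "squeeze j i x = (r [^] i) ((rr (M - 2) [^] (M - 1)) z)"
    unfolding squeeze_def using x(1) zW by (simp add: mult_apply z_def)
  ultimately show ?thesis by simp
qed

lemma conj_squeeze_fixes:
  assumes j: "j < M" and g: "fixes_cell j g" and x: "x \<in> {0..<1}" "x \<notin> cell ((M - 1 + i) mod M) m"
  shows "(squeeze j i \<otimes> g \<otimes> inv (squeeze j i)) x = x"
proof -
  have gG: "g \<in> carrier G" using g by (simp add: fixes_cell_def)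
  define z where "z = (inv (squeeze j i)) x"
  have z: "z \<in> {0..<1}" unfolding z_def by (rule apply_in[OF _ x(1)]) simp
  have sz: "squeeze j i z = x" unfolding z_def by (rule inv_apply(2)[OF _ x(1)]) simp
  have "z \<in> cell j m" using squeeze_cell[OF j z, of i] sz x(2) by auto
  then have "g z = z" using g by (simp add: fixes_cell_def)
  then show ?thesis using x(1) z gG sz by (simp add: mult_apply z_def)
qed

lemma disjoint_support_commute:
  assumes g: "g \<in> carrier G" "\<And>x. x \<in> {0..<1} \<Longrightarrow> x \<notin> A \<Longrightarrow> g x = x"
    and h: "h \<in> carrier G" "\<And>x. x \<in> {0..<1} \<Longrightarrow> x \<notin> B \<Longrightarrow> h x = x" and AB: "A \<inter> B = {}"
  shows "g \<otimes> h = h \<otimes> g"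
proof (rule carrier_eqI)
  fix x :: real assume x: "x \<in> {0..<1}"
  \<comment> \<open>A bijection fixing every point outside \<open>C\<close> maps \<open>C\<close> to
    itself.\<close>
  have keep: "f x \<in> C" if "f \<in> carrier G" "\<And>x. x \<in> {0..<1} \<Longrightarrow> x \<notin> C \<Longrightarrow> f x = x" "x \<in> C" for f C
    using that apply_in[OF that(1) x] apply_eq_iff[OF that(1) apply_in[OF that(1) x] x] by metis
  have "g (h x) = h (g x)"
  proof (cases "x \<in> A")
    case True
    then have "g x \<in> A" using keep[OF g] by simp
    then have "h (g x) = g x" "h x = x" using AB True h(2) x apply_in[OF g(1) x] by blast+
    then show ?thesis by simp
  next
    case False
    then have gx: "g x = x" using g(2) x by simp
    show ?thesis
    proof (cases "x \<in> B")
      case True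
      then have "h x \<in> B" using keep[OF h] by simp
      then have "g (h x) = h x" using AB g(2) apply_in[OF h(1) x] by blast
      then show ?thesis using gx by simp
    qed (use h(2) x gx in simp)
  qed
  then show "(g \<otimes> h) x = (h \<otimes> g) x" using g h x by (simp add: mult_apply)
qed (use g h in simp_all)

lemma conj_squeeze_commute:
  assumes j: "j < M" and g: "fixes_cell j g" and h: "fixes_cell j h" and i: "i < M" "i' < M" "i \<noteq> i'"
  shows "(squeeze j i \<otimes> g \<otimes> inv (squeeze j i)) \<otimes> (squeeze j i' \<otimes> h \<otimes> inv (squeeze j i')) =
    (squeeze j i' \<otimes> h \<otimes> inv (squeeze j i')) \<otimes> (squeeze j i \<otimes> g \<otimes> inv (squeeze j i))"
proof (rule disjoint_support_commute[OF _ conj_squeeze_fixes[OF j g] _ conj_squeeze_fixes[OF j h]])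
  have "(M - 1 + i) mod M \<noteq> (M - 1 + i') mod M" using i by (auto simp: mod_if split: if_splits)
  then show "cell ((M - 1 + i) mod M) m \<inter> cell ((M - 1 + i') mod M) m = {}" using cell_unique by blast
qed (use g h in \<open>simp_all add: fixes_cell_def\<close>)

text \<open>Each generator moves points of at most two cells, so fewer than \<open>M\<close> cells
  are affected altogether.\<close>

lemma few_fix_common_cell:
  assumes E: "E \<subseteq> ys ` {..<M} \<union> (if G = thompson_V then {swap} else {})" "2 * card E < M"
  obtains j where "j < M" "\<And>g. g \<in> E \<Longrightarrow> fixes_cell j g"
proof -
  have "\<exists>J. card J \<le> 2 \<and> finite J \<and> (\<forall>j<M. j \<notin> J \<longrightarrow> fixes_cell j g)" if "g \<in> E" for g
  proof -
    have "g \<in> ys ` {..<M} \<or> G = thompson_V \<and> g = swap"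
      using subsetD[OF E(1) that] by (simp split: if_splits)
    then consider i where "i < M" "g = ys i" | "G = thompson_V" "g = swap" by blast
    then show ?thesis
    proof cases
      case 1
      then show ?thesis using ys_fixes_cell[OF 1(1)] card_insert_le_m1[of 2 "{Suc i mod M}" i]
        by (intro exI[of _ "{i, Suc i mod M}"]) auto
    next
      case 2
      then show ?thesis using swap_fixes_cell[OF 2(1)] by (intro exI[of _ "{0, 1}"]) auto
    qed
  qed
  then have "\<forall>g\<in>E. \<exists>J. card J \<le> 2 \<and> finite J \<and> (\<forall>j<M. j \<notin> J \<longrightarrow> fixes_cell j g)" by blast
  from bchoice[OF this] obtain J where J: "\<And>g. g \<in> E \<Longrightarrow> card (J g) \<le> 2" "\<And>g. g \<in> E \<Longrightarrow> finite (J g)"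
    "\<And>g j. g \<in> E \<Longrightarrow> j < M \<Longrightarrow> j \<notin> J g \<Longrightarrow> fixes_cell j g" by blast
  have finE: "finite E" by (rule finite_subset[OF E(1)]) simp
  have "card (\<Union>g\<in>E. J g) \<le> (\<Sum>g\<in>E. card (J g))" by (rule card_UN_le[OF finE])
  also have "\<dots> \<le> (\<Sum>g\<in>E. 2)" by (rule sum_mono) (rule J(1))
  also have "\<dots> < card {..<M}" using E(2) by simp
  finally have "\<not> {..<M} \<subseteq> (\<Union>g\<in>E. J g)"
    using card_mono[of "\<Union>g\<in>E. J g" "{..<M}"] finE J(2) by auto
  then obtain j where "j < M" "j \<notin> (\<Union>g\<in>E. J g)" by auto
  then show ?thesis using that[of j] J(3) by blast
qed

end

section \<open>The fixed point theorem for T and V\<close>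

lemma thompson_fixed_point:
  fixes G :: "(real \<Rightarrow> real) monoid" (structure)
  assumes "CAT0_semisimple_action G X d \<phi> k" and "thompson_group G (k + 3)"
  shows "\<exists>x\<in>X. \<forall>g\<in>carrier G. \<phi> g x = x"
proof -
  interpret A: CAT0_semisimple_action G X d \<phi> k by fact
  interpret T: thompson_group G "k + 3" by fact
  \<comment> \<open>The number of cells is \<open>8 * 2 ^ k\<close> and so at least
    \<open>8 * Suc k\<close>. The three bounds drawn from this serve the count in
    \<open>few_fix_common_cell\<close>, the supply of \<open>k + 1\<close> target cells, and the
    existence of cell 3.\<close>
  have "Suc k \<le> 2 ^ k" by (rule Suc_leI[OF less_exp])
  then have "Suc k * 2 ^ 3 \<le> T.M" unfolding T.M_def power_add by (rule mult_le_mono1)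
  then have M: "2 * Suc k < T.M" "Suc k \<le> T.M" "3 < T.M" by simp_all
  have disp: "A.displaceable E" if j: "j < T.M" "\<And>g. g \<in> E \<Longrightarrow> T.fixes_cell j g" for E j
    unfolding A.displaceable_def
  proof (intro exI[of _ "T.squeeze j"] conjI allI impI ballI)
    fix i i' a b assume "i \<le> k" "i' \<le> k" "i \<noteq> i'" and ab: "a \<in> E" "b \<in> E"
    then have "i < T.M" "i' < T.M" "i \<noteq> i'" using M(2) by simp_all
    from T.conj_squeeze_commute[OF j(1) j(2)[OF ab(1)] j(2)[OF ab(2)] this]
    show "A.conjg (T.squeeze j i) a \<otimes> A.conjg (T.squeeze j i') b =
      A.conjg (T.squeeze j i') b \<otimes> A.conjg (T.squeeze j i) a"
      unfolding A.conjg_def .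
  qed simp
  have y_fixed: "A.fixed {T.y} \<noteq> {}"
  proof -
    obtain g where g: "g \<in> carrier G" "T.ys 1 \<otimes> inv T.y \<otimes> inv (T.ys 1) \<otimes> T.y = g \<otimes> T.y \<otimes> inv g"
      by (rule T.commutator_conjugate_y) (rule that)
    \<comment> \<open>Cell 3 lies off the support of \<open>y\<close>, in the cells 0 and 1, and off
      that of \<open>ys 1\<close>, in the cells 1 and 2. Squeezing its complement displaces both, so
      their commutator is elliptic, and with it its conjugate \<open>y\<close>.\<close>
    have yc: "T.fixes_cell 3 T.y" by (rule T.y_fixes_cell) (use M in simp_all)
    have "T.fixes_cell 3 (T.ys 1)" by (rule T.ys_fixes_cell) (use M in simp_all)
    moreover have "T.fixes_cell 3 (inv T.y)"
      unfolding T.fixes_cell_def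
    proof (intro conjI ballI)
      fix x assume x: "x \<in> cell 3 (k + 3)"
      then have "T.y x = x" using yc by (simp add: T.fixes_cell_def)
      moreover have "x \<in> {0..<1}" using x T.cell_M_subset[OF M(3)] by blast
      ultimately show "(inv T.y) x = x" using T.inv_apply(1)[OF T.y_carrier, of x] by simp
    qed simp
    ultimately have "A.displaceable {T.ys 1, inv T.y}" by (intro disp[OF M(3)]) auto
    from A.fixed_commutator[OF _ _ this]
    have "A.fixed {T.ys 1 \<otimes> inv T.y \<otimes> inv (T.ys 1) \<otimes> T.y} \<noteq> {}" by simp
    then have "A.fixed {A.conjg g T.y} \<noteq> {}" unfolding g(2) A.conjg_def .
    from A.fixed_conjg_nonempty[OF _ _ this, of "inv g"] g(1) show ?thesis by simp
  qed
  have ys_fixed: "A.fixed {T.ys i} \<noteq> {}" for i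
    using A.fixed_conjg_nonempty[OF _ _ y_fixed, of "T.r [^] i"] unfolding T.ys_def by (simp add: A.conjg_def)
  define S where "S = T.ys ` {..<T.M} \<union> (if G = thompson_V then {T.swap} else {})"
  have "A.fixed S \<noteq> {}"
  proof (rule A.fixed_locally_displaceable)
    show "finite S" by (simp add: S_def)
    have S: "a \<in> T.ys ` {..<T.M} \<or> G = thompson_V \<and> a = T.swap" if "a \<in> S" for a
      using that unfolding S_def by (simp split: if_splits)
    then show "S \<subseteq> carrier G" using T.ys_carrier T.swap_carrier by blast
    show "A.fixed {a} \<noteq> {}" if "a \<in> S" for a
    proof -
      from S[OF that] show ?thesis using ys_fixed A.fixed_involution T.swap_carrier T.swap_swap by blast
    qed
    fix E assume E: "E \<subseteq> S" "card E \<le> Suc k"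
    then have "2 * card E < T.M" using M(1) by (meson le_less_trans mult_le_mono2)
    from T.few_fix_common_cell[OF E(1)[unfolded S_def] this]
    obtain j where "j < T.M" "\<And>g. g \<in> E \<Longrightarrow> T.fixes_cell j g" by blast
    then show "A.displaceable E" by (rule disp)
  qed
  then obtain x where x: "x \<in> X" "\<And>a. a \<in> S \<Longrightarrow> \<phi> a x = x" by (auto simp: A.fixed_def)
  have "stabilizer G \<phi> x = carrier G"
  proof (rule T.subgroup_eq_carrier)
    show "subgroup (stabilizer G \<phi> x) G" by (rule A.stabilizer_subgroup[OF x(1)])
    show "T.ys i \<in> stabilizer G \<phi> x" if "i < T.M" for i
      using x(2)[of "T.ys i"] that by (simp add: stabilizer_def S_def)
    assume V: "G = thompson_V"
    have "T.swap \<in> S" unfolding S_def if_P[OF V] by blast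
    then show "T.swap \<in> stabilizer G \<phi> x"
      using x(2) T.swap_carrier[OF V] by (simp add: stabilizer_def)
  qed
  then have "\<forall>g\<in>carrier G. \<phi> g x = x" unfolding stabilizer_def by blast
  with x(1) show ?thesis by blast
qed

theorem corollary1p3:
  fixes G :: "(real \<Rightarrow> real) monoid"
    and X :: "'a set" and d :: "'a \<Rightarrow> 'a \<Rightarrow> real"
    and \<phi> :: "(real \<Rightarrow> real) \<Rightarrow> 'a \<Rightarrow> 'a" and k :: nat
  assumes "G = thompson_T \<or> G = thompson_V"
    and "CAT0_space X d"
    and "Metric_space.mcomplete X d"
    and "has_covering_dim (Metric_space.mtopology X d) (int k)"
    and "semisimple_action G X d \<phi>"
  shows "\<exists>x\<in>X. \<forall>g\<in>carrier G. \<phi> g x = x"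
proof (rule thompson_fixed_point)
  interpret semisimple_action G X d \<phi> by fact
  show "thompson_group G (k + 3)"
    using group_hom assms(1) by (simp add: thompson_group_def thompson_group_axioms_def group_hom_def)
  show "CAT0_semisimple_action G X d \<phi> k"
    using assms by (simp add: CAT0_semisimple_action_def CAT0_semisimple_action_axioms_def has_covering_dim_def)
qed

end
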